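(* Let $m\ge 1$, $p,q\ge 0$ be integers, $T\in\mathbb Z[z]\setminus\{0\}$, $\xi\in\mathbb Q$ with $\xi T(\xi)\ne 0$, and $\kappa>0$ a real number. There exists an effectively computable polynomial $P\in\mathbb R[X_1,X_2,X_3]$ with non-negative coefficients, depending only on $m,p,q,\xi,T,\kappa$, such that the following holds. Let $f_1,\dots,f_m\in\mathbb Q[[z]]$ be strict $E$-functions, linearly independent over $\mathbb Q(z)$, such that $Y={}^t(f_1,\dots,f_m)$ is a solution of a differential system $Y'=AY$ with $A=(A_{i,j})\in M_m(\mathbb Q(z))$. Assume that $T$ is a common denominator of minimal degree of the entries of $A$, that $$p=\min_{1\le j\le m}\operatorname{ord}_{z=0}f_j(z),\qquad q=\max\big(\deg T,\max_{i,j}\deg(TA_{i,j})\big),$$ and that $\kappa\le\max_{1\le j\le m}|f_j(\xi)|$. Let $C,D,E,n_0$ be the quantities attached to these data as in the context, and put $c=P(C,D,E)$. Then for every integer $H\ge\max(3,n_0^{n_0})$ and every $(a_1,\dots,a_m)\in\mathbb Z^m\setminus\{0\}$ with $\max_k|a_k|\le H$, $$\bigg|\sum_{j=1}^m a_jf_j(\xi)\bigg|>\frac1{H^{c}}.$$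
   Context: A power series $F(z)=\sum_{n=0}^\infty a_n z^n/n!\in\mathbb Q[[z]]$ is a strict $E$-function if: (i) $F$ is a solution of a non-zero linear differential equation with coefficients in $\mathbb Q(z)$; (ii) there exists $C_1>0$ such that $|a_n|\le C_1^{n+1}$ for all $n\ge 0$; (iii) there exist $C_2>0$ and positive integers $d_n\le C_2^{n+1}$ such that $d_na_m\in\mathbb Z$ for all $m\le n$. It is an entire function. $T$ being a common denominator of minimal degree of the entries of $A$ means: $TA_{i,j}\in\mathbb Z[z]$ for all $i,j$, and $T\in\mathbb Z[z]\setminus\{0\}$ has minimal degree with this property. Constants attached to the data. Write $f_i(z)=\sum_{k\ge0}\frac{\varphi_{k,i}}{k!}z^k$. - $C>0$ is a constant such that $|\varphi_{k,i}|\le C^{k+1}$ for all $k\ge0$, $1\le i\le m$. - $D>0$ is a constant such that the (least positive) common denominator $d_{k,i}$ of $\varphi_{0,i},\dots,\varphi_{k,i}$ satisfies $d_{k,i}\le D^{k+1}$ for all $k\ge0$, $1\le i\le m$. - $E$ is the maximum modulus of the coefficients of the polynomials $T$ and $TA_{i,j}$, $1\le i,j\le m$. - $n_0\ge0$ is the constant in Shidlovskii's zero estimate, i.e. an integer with the following property. Let $\varepsilon_1\in(0,\frac1{2m-1})$, $n\ge n_0$, and let $P_1,\dots,P_m\in\mathbb Z[z]$ be of degree at most $n$, not all zero, such that $R:=\sum_iP_if_i$ satisfies $\operatorname{ord}_{z=0}R\ge m(n+1)-\lfloor\varepsilon_1n\rfloor-1$. Define $R_1=R$, $R_{k+1}=T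 R_k'$, and write $R_k=\sum_{i=1}^mP_{k,i}f_i$ with $P_{1,i}=P_i$ and $P_{k+1,i}=TP_{k,i}'+\sum_{j=1}^m TA_{j,i}P_{k,j}$. Then for every $\zeta\in\mathbb C$ with $\zeta T(\zeta)\ne0$, among the vectors $(P_{k,1}(\zeta),\dots,P_{k,m}(\zeta))$, $1\le k\le m+t_1$, there are $m$ linearly independent ones, where $t_1=q\frac{m(m-1)}2+\lfloor\varepsilon_1n\rfloor+p$. (Such an $n_0$ exists and can be bounded effectively.) *)

theory Defs
  imports
    "HOL-Computational_Algebra.Computational_Algebra"
    "HOL-Analysis.Analysis"
    "HOL-Library.Nat_Bijection"
begin

section \<open>Rational functions and power series\<close>

text \<open>Q(z) is \<^typ>\<open>rat poly fract\<close>; it is embedded into the field of Laurent series Q((z)), so that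
  it can be multiplied with elements of Q[[z]].\<close>

definition ratfun_fls :: "rat poly fract \<Rightarrow> rat fls" where
  "ratfun_fls r = (THE F. \<exists>a b. b \<noteq> 0 \<and> r = Fract a b \<and>
     F = fps_to_fls (fps_of_poly a) / fps_to_fls (fps_of_poly b))"

lemma ratfun_fls_Fract:
  assumes "b \<noteq> 0"
  shows "ratfun_fls (Fract a b) = fps_to_fls (fps_of_poly a) / fps_to_fls (fps_of_poly b)"
  unfolding ratfun_fls_def
proof (rule the_equality)
  fix F :: "rat fls"
  assume "\<exists>c d. d \<noteq> 0 \<and> Fract a b = Fract c d \<and>
    F = fps_to_fls (fps_of_poly c) / fps_to_fls (fps_of_poly d)"
  then obtain c d where d: "d \<noteq> 0" and eq: "Fract a b = Fract c d"
    and F: "F = fps_to_fls (fps_of_poly c) / fps_to_fls (fps_of_poly d)"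
    by blast
  have "a * d = c * b"
    using eq assms d by (simp add: eq_fract)
  hence "fps_to_fls (fps_of_poly a) * fps_to_fls (fps_of_poly d)
       = fps_to_fls (fps_of_poly c) * (fps_to_fls (fps_of_poly b) :: rat fls)"
    by (metis fls_times_fps_to_fls fps_of_poly_mult)
  with F d assms show "F = fps_to_fls (fps_of_poly a) / fps_to_fls (fps_of_poly b)"
    by (simp add: frac_eq_eq)
qed (use assms in blast)

definition int_ratfun :: "int poly \<Rightarrow> rat poly fract" where
  "int_ratfun S = to_fract (map_poly of_int S)"

definition lin_indep_over_Qz :: "nat \<Rightarrow> (nat \<Rightarrow> rat fps) \<Rightarrow> bool" where
  "lin_indep_over_Qz m f \<longleftrightarrow>
     (\<forall>c. (\<Sum>j<m. ratfun_fls (c j) * fps_to_fls (f j)) = 0 \<longrightarrow> (\<forall>j<m. c j = 0))"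

section \<open>Strict E-functions\<close>

definition egf_coeff :: "rat fps \<Rightarrow> nat \<Rightarrow> rat" where
  "egf_coeff F n = fps_nth F n * fact n"

definition strict_E_function :: "rat fps \<Rightarrow> bool" where
  "strict_E_function F \<longleftrightarrow>
     (\<exists>r c. (\<exists>k\<le>r. c k \<noteq> 0) \<and>
        (\<Sum>k\<le>r. ratfun_fls (c k) * fps_to_fls ((fps_deriv ^^ k) F)) = 0) \<and>
     (\<exists>C1>0. \<forall>n. \<bar>real_of_rat (egf_coeff F n)\<bar> \<le> C1 ^ (n + 1)) \<and>
     (\<exists>C2>0. \<exists>d :: nat \<Rightarrow> nat. \<forall>n. 0 < d n \<and> real (d n) \<le> C2 ^ (n + 1) \<and>
        (\<forall>l\<le>n. of_nat (d n) * egf_coeff F l \<in> \<int>))"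

definition E_value :: "rat fps \<Rightarrow> rat \<Rightarrow> real" where
  "E_value F x = eval_fps (Abs_fps (\<lambda>n. of_rat (fps_nth F n))) (of_rat x)"

definition common_denom :: "rat fps \<Rightarrow> nat \<Rightarrow> nat" where
  "common_denom F k = (LEAST d. 0 < d \<and> (\<forall>l\<le>k. of_nat d * egf_coeff F l \<in> \<int>))"

section \<open>Differential systems\<close>

text \<open>Vectors and matrices of size \<open>m\<close> are functions of which only the values at indices below
  \<open>m\<close> matter.\<close>

definition solves_system :: "nat \<Rightarrow> (nat \<Rightarrow> nat \<Rightarrow> rat poly fract) \<Rightarrow> (nat \<Rightarrow> rat fps) \<Rightarrow> bool" where
  "solves_system m A f \<longleftrightarrow>
     (\<forall>i<m. fps_to_fls (fps_deriv (f i)) = (\<Sum>j<m. ratfun_fls (A i j) * fps_to_fls (f j)))"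

definition is_common_denominator :: "nat \<Rightarrow> (nat \<Rightarrow> nat \<Rightarrow> rat poly fract) \<Rightarrow> int poly \<Rightarrow> bool" where
  "is_common_denominator m A T \<longleftrightarrow>
     T \<noteq> 0 \<and> (\<forall>i<m. \<forall>j<m. int_ratfun T * A i j \<in> range int_ratfun)"

definition is_min_common_denominator :: "nat \<Rightarrow> (nat \<Rightarrow> nat \<Rightarrow> rat poly fract) \<Rightarrow> int poly \<Rightarrow> bool" where
  "is_min_common_denominator m A T \<longleftrightarrow>
     is_common_denominator m A T \<and>
     (\<forall>T'. is_common_denominator m A T' \<longrightarrow> degree T \<le> degree T')"

lemma inj_int_ratfun: "inj int_ratfun"
proof (rule injI)
  fix S S' assume "int_ratfun S = int_ratfun S'"
  hence *: "map_poly rat_of_int S = map_poly rat_of_int S'"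
    by (simp add: int_ratfun_def)
  show "S = S'"
  proof (rule poly_eqI)
    fix n
    have "coeff (map_poly rat_of_int S) n = coeff (map_poly rat_of_int S') n"
      by (simp only: *)
    thus "coeff S n = coeff S' n"
      by (simp add: coeff_map_poly)
  qed
qed

text \<open>The entry \<open>T A\<^sub>i\<^sub>j\<close> as an integer polynomial; meaningful when \<open>T\<close> is a common denominator.\<close>

definition numer_entry :: "int poly \<Rightarrow> (nat \<Rightarrow> nat \<Rightarrow> rat poly fract) \<Rightarrow> nat \<Rightarrow> nat \<Rightarrow> int poly" where
  "numer_entry T A i j = (THE S. int_ratfun S = int_ratfun T * A i j)"

definition system_degree :: "nat \<Rightarrow> int poly \<Rightarrow> (nat \<Rightarrow> nat \<Rightarrow> rat poly fract) \<Rightarrow> nat" where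
  "system_degree m T A =
     Max (insert (degree T) ((\<lambda>(i, j). degree (numer_entry T A i j)) ` ({..<m} \<times> {..<m})))"

definition system_height :: "nat \<Rightarrow> int poly \<Rightarrow> (nat \<Rightarrow> nat \<Rightarrow> rat poly fract) \<Rightarrow> int" where
  "system_height m T A =
     Max (abs ` (set (coeffs T) \<union> (\<Union>i<m. \<Union>j<m. set (coeffs (numer_entry T A i j)))))"

section \<open>The constant in Shidlovskii's zero estimate\<close>

text \<open>\<open>shidlovskii_poly m T A Q k\<close> is the coefficient vector of the linear form
  \<open>R\<^sub>k\<^sub>+\<^sub>1\<close>, where \<open>R\<^sub>1 = (\<Sum>i<m. Q i * f i)\<close>: the numbering of the forms is shifted to start at 0.\<close>

primrec shidlovskii_poly ::
  "nat \<Rightarrow> int poly \<Rightarrow> (nat \<Rightarrow> nat \<Rightarrow> rat poly fract) \<Rightarrow> (nat \<Rightarrow> int poly) \<Rightarrow> nat \<Rightarrow> nat \<Rightarrow> int poly" where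
  "shidlovskii_poly m T A Q 0 = Q"
| "shidlovskii_poly m T A Q (Suc k) =
     (\<lambda>i. T * pderiv (shidlovskii_poly m T A Q k i) +
        (\<Sum>j<m. numer_entry T A j i * shidlovskii_poly m T A Q k j))"

definition eval_int_poly :: "int poly \<Rightarrow> complex \<Rightarrow> complex" where
  "eval_int_poly S \<zeta> = poly (map_poly of_int S) \<zeta>"

definition zero_estimate_constant ::
  "nat \<Rightarrow> nat \<Rightarrow> nat \<Rightarrow> int poly \<Rightarrow> (nat \<Rightarrow> nat \<Rightarrow> rat poly fract) \<Rightarrow> (nat \<Rightarrow> rat fps) \<Rightarrow> nat \<Rightarrow> bool" where
  "zero_estimate_constant m p q T A f n0 \<longleftrightarrow>
     (\<forall>(\<epsilon> :: real) (n :: nat) (Q :: nat \<Rightarrow> int poly) (\<zeta> :: complex).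
        0 < \<epsilon> \<and> \<epsilon> < 1 / (2 * real m - 1) \<and> n0 \<le> n \<and>
        (\<forall>i<m. degree (Q i) \<le> n) \<and> (\<exists>i<m. Q i \<noteq> 0) \<and>
        (\<forall>l. int l < int (m * (n + 1)) - \<lfloor>\<epsilon> * real n\<rfloor> - 1 \<longrightarrow>
           fps_nth (\<Sum>i<m. fps_of_poly (map_poly of_int (Q i)) * f i) l = 0) \<and>
        \<zeta> * eval_int_poly T \<zeta> \<noteq> 0 \<longrightarrow>
        (\<exists>K \<subseteq> {..< m + (q * (m * (m - 1) div 2) + nat \<lfloor>\<epsilon> * real n\<rfloor> + p)}.
           card K = m \<and>
           (\<forall>c :: nat \<Rightarrow> complex.
              (\<forall>i<m. (\<Sum>k\<in>K. c k * eval_int_poly (shidlovskii_poly m T A Q k i) \<zeta>) = 0) \<longrightarrow>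
              (\<forall>k\<in>K. c k = 0))))"

section \<open>Polynomials in three variables\<close>

text \<open>\<^typ>\<open>real poly poly poly\<close> stands for R[X3][X2][X1].\<close>

definition coeff3 :: "real poly poly poly \<Rightarrow> nat \<Rightarrow> nat \<Rightarrow> nat \<Rightarrow> real" where
  "coeff3 P i j k = coeff (coeff (coeff P i) j) k"

definition eval3 :: "real poly poly poly \<Rightarrow> real \<Rightarrow> real \<Rightarrow> real \<Rightarrow> real" where
  "eval3 P x y z = poly (poly (poly P [:[:x:]:]) [:y:]) z"

lemma eval3_monom:
  "eval3 (monom (monom (monom c k) j) i) x y z = c * x ^ i * y ^ j * z ^ k"
  by (simp add: eval3_def poly_monom poly_const_pow)

section \<open>Effective computability\<close>

text \<open>Partial recursive functions relative to an oracle \<open>g\<close>. The oracle supplies approximations of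
  a real argument.\<close>

datatype prog =
    Zero
  | Succ
  | Proj nat
  | Oracle
  | Comp prog "prog list"
  | PrimRec prog prog
  | Mu prog

inductive runs :: "(nat \<Rightarrow> nat) \<Rightarrow> prog \<Rightarrow> nat list \<Rightarrow> nat \<Rightarrow> bool" for g :: "nat \<Rightarrow> nat" where
  Zero: "runs g Zero xs 0"
| Succ: "runs g Succ [x] (Suc x)"
| Proj: "i < length xs \<Longrightarrow> runs g (Proj i) xs (xs ! i)"
| Oracle: "runs g Oracle [x] (g x)"
| Comp: "list_all2 (\<lambda>q y. runs g q xs y) qs ys \<Longrightarrow> runs g p ys z \<Longrightarrow> runs g (Comp p qs) xs z"
| PrimRec_0: "runs g p xs y \<Longrightarrow> runs g (PrimRec p q) (0 # xs) y"
| PrimRec_Suc: "runs g (PrimRec p q) (n # xs) r \<Longrightarrow> runs g q (n # r # xs) y \<Longrightarrow>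
    runs g (PrimRec p q) (Suc n # xs) y"
| Mu: "runs g p (n # xs) 0 \<Longrightarrow> (\<And>i. i < n \<Longrightarrow> \<exists>y. runs g p (i # xs) (Suc y)) \<Longrightarrow>
    runs g (Mu p) xs n"

inductive_cases runs_ZeroE: "runs g Zero xs y"
inductive_cases runs_SuccE: "runs g Succ xs y"
inductive_cases runs_ProjE: "runs g (Proj i) xs y"
inductive_cases runs_OracleE: "runs g Oracle xs y"
inductive_cases runs_CompE: "runs g (Comp p qs) xs y"
inductive_cases runs_PrimRec0E: "runs g (PrimRec p q) (0 # xs) y"
inductive_cases runs_PrimRecSucE: "runs g (PrimRec p q) (Suc n # xs) y"
inductive_cases runs_MuE: "runs g (Mu p) xs y"

lemma runs_deterministic: "runs g p xs y \<Longrightarrow> runs g p xs z \<Longrightarrow> y = z"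
proof (induction arbitrary: z rule: runs.induct)
  case (Comp xs qs ys p y)
  from Comp.prems obtain zs where zs: "list_all2 (\<lambda>q y. runs g q xs y) qs zs" "runs g p zs z"
    by (rule runs_CompE)
  have "ys = zs"
    using Comp.IH(1) zs(1)
    by (auto simp: list_all2_conv_all_nth intro!: nth_equalityI)
  thus ?case
    using Comp.IH(2) zs(2) by simp
next
  case (PrimRec_0 p xs y q)
  thus ?case by (blast elim: runs_PrimRec0E)
next
  case (PrimRec_Suc p q n xs r y)
  thus ?case by (blast elim: runs_PrimRecSucE)
next
  case (Mu p n xs)
  from Mu.prems obtain less: "\<And>i. i < z \<Longrightarrow> \<exists>y. runs g p (i # xs) (Suc y)"
    and zero: "runs g p (z # xs) 0"
    by (rule runs_MuE) blast
  show ?case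
  proof (rule linorder_cases[of n z])
    assume "n < z"
    thus ?thesis using less Mu.IH(1) by fastforce
  next
    assume "z < n"
    thus ?thesis using Mu.IH(2) zero by fastforce
  qed
qed (auto elim: runs_ZeroE runs_SuccE runs_ProjE runs_OracleE)

text \<open>A non-negative real is presented by dyadic approximations: \<open>g n / 2 ^ n\<close> is within
  \<open>1 / 2 ^ n\<close> of it.\<close>

definition approximates :: "(nat \<Rightarrow> nat) \<Rightarrow> real \<Rightarrow> bool" where
  "approximates g x \<longleftrightarrow> (\<forall>n. \<bar>real (g n) - 2 ^ n * x\<bar> \<le> 1)"

definition encode_data :: "nat \<Rightarrow> nat \<Rightarrow> nat \<Rightarrow> rat \<Rightarrow> int poly \<Rightarrow> nat list" where
  "encode_data m p q \<xi> T =
     [m, p, q, int_encode (fst (quotient_of \<xi>)), nat (snd (quotient_of \<xi>)),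
      list_encode (map int_encode (coeffs T))]"

definition admissible :: "nat \<Rightarrow> rat \<Rightarrow> int poly \<Rightarrow> real \<Rightarrow> bool" where
  "admissible m \<xi> T \<kappa> \<longleftrightarrow>
     1 \<le> m \<and> T \<noteq> 0 \<and> \<xi> * poly (map_poly of_int T) \<xi> \<noteq> 0 \<and> 0 < \<kappa>"

text \<open>A family of polynomials with non-negative coefficients is effectively computable if there is
  one algorithm that finds a bound for the degree, and another one that approximates each
  coefficient to any precision, uniformly in the data. These data are finite objects,
  except for the real \<open>\<kappa>\<close>, of which the algorithms may query arbitrary approximations.\<close>

definition effectively_computable ::
  "(nat \<Rightarrow> nat \<Rightarrow> nat \<Rightarrow> rat \<Rightarrow> int poly \<Rightarrow> real \<Rightarrow> real poly poly poly) \<Rightarrow> bool" where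
  "effectively_computable \<Phi> \<longleftrightarrow>
     (\<exists>deg_prog coeff_prog. \<forall>m p q \<xi> T \<kappa> g.
        admissible m \<xi> T \<kappa> \<and> approximates g \<kappa> \<longrightarrow>
        (\<exists>N. runs g deg_prog (encode_data m p q \<xi> T) N \<and>
           (\<forall>i j k. N < i + j + k \<longrightarrow> coeff3 (\<Phi> m p q \<xi> T \<kappa>) i j k = 0)) \<and>
        (\<forall>i j k. \<exists>h. approximates h (coeff3 (\<Phi> m p q \<xi> T \<kappa>) i j k) \<and>
           (\<forall>n. runs g coeff_prog (encode_data m p q \<xi> T @ [i, j, k, n]) (h n))))"

end

theory Submission
  imports Defs "Jordan_Normal_Form.Determinant"
begin

text \<open>The proof is Siegel's method for $E$-functions, with all constants tracked. Siegel's lemma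
(\<open>siegel_lemma\<close>) yields integer polynomials \<open>Q\<^sub>1, \<dots>, Q\<^sub>m\<close> of degree at most \<open>n\<close>, with coefficients of
size about \<open>n!\<close>, such that \<open>R = \<Sum> Q\<^sub>i f\<^sub>i\<close> vanishes at 0 to order about \<open>m n\<close>
(\<open>exists_auxiliary_form\<close>). Since the coefficients of the \<open>f\<^sub>i\<close> have factorials in the denominator, the
value \<open>R(\<xi>)\<close> has size about \<open>n! / (m n)!\<close>. The derivation \<open>F \<mapsto> T F'\<close> maps such forms to such forms and,
as long as it is iterated at most \<open>\<epsilon> n + O(1)\<close> times, changes these sizes, apart from geometric factors, only by factors \<open>n\<^sup>\<delta>\<^sup>n\<close> with a
small \<open>\<delta>\<close>. The zero estimate provides \<open>m\<close> independent forms among them at \<open>\<xi>\<close>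
(\<open>independent_small_forms\<close>).

Given \<open>a \<noteq> 0\<close>, one of these \<open>m\<close> forms can be replaced by \<open>a\<close> so that the determinant \<open>\<Delta>\<close> of the resulting
integer matrix is not 0. Cramer's rule expresses \<open>\<Delta> f\<^sub>j(\<xi>)\<close> by the values of the forms, and \<open>|\<Delta>| \<ge> 1\<close>;
hence \<open>|f\<^sub>j(\<xi>)|\<close> is at most \<open>|\<Sum> a\<^sub>i f\<^sub>i(\<xi>)|\<close> times a power \<open>n\<^sup>O\<^sup>(\<^sup>n\<^sup>)\<close>, plus an error of at most
\<open>H n\<^sup>-\<^sup>n\<^sup>/\<^sup>2\<close> (\<open>coordinate_bound_of_linear_forms\<close>, \<open>coordinate_bound\<close>). As some \<open>|f\<^sub>j(\<xi>)|\<close> is at least \<open>\<kappa>\<close>, the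
linear form in question is bounded below by \<open>n\<^sup>-\<^sup>O\<^sup>(\<^sup>n\<^sup>)\<close> as soon as the error is below \<open>\<kappa> / 2\<close>.

It remains to choose \<open>n\<close>. All geometric factors are \<open>Z\<^sup>O\<^sup>(\<^sup>n\<^sup>)\<close>, where \<open>Z\<close> is an integer that bounds the data,
and they are negligible once \<open>n\<close> is at least a fixed power of \<open>Z\<close>. The least \<open>n\<close> with
\<open>n\<^sup>n \<ge> H\<^sup>K\<close> has this property, is at least \<open>n\<^sub>0\<close> because \<open>H\<close> is at least \<open>n\<^sub>0\<close> to the power \<open>n\<^sub>0\<close>, and makes the error small, when
\<open>K\<close> is a larger power of \<open>Z\<close> plus a multiple of \<open>1/\<kappa>\<close>; and then \<open>n\<^sup>O\<^sup>(\<^sup>n\<^sup>)\<close> is \<open>H\<^sup>O\<^sup>(\<^sup>K\<^sup>)\<close>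
(\<open>linear_form_lower_bound\<close>). As \<open>Z\<close> may be taken affine in \<open>C, D, E\<close>, the exponent is polynomial in them,
and affine in \<open>1/\<kappa>\<close>. It is majorized by a polynomial all of whose coefficients in a box equal \<open>W + W/\<kappa>\<close> for
one integer \<open>W\<close>, an elementary function of \<open>m, p, q, \<xi>\<close>; this makes the computability of the coefficients
easy to establish (\<open>effectively_computable_exponent_poly\<close>).\<close>

section \<open>Computability relative to an oracle\<close>

text \<open>The condition \<open>P\<close> on oracle and arguments is where lengths of argument lists and positivity of divisors
enter, so that functions computed by partial programs can be composed freely.\<close>

definition computable_on ::
  "((nat \<Rightarrow> nat) \<Rightarrow> nat list \<Rightarrow> bool) \<Rightarrow> ((nat \<Rightarrow> nat) \<Rightarrow> nat list \<Rightarrow> nat) \<Rightarrow> bool" where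
  "computable_on P F \<longleftrightarrow> (\<exists>p. \<forall>g xs. P g xs \<longrightarrow> runs g p xs (F g xs))"

lemma computable_onI: "(\<And>g xs. P g xs \<Longrightarrow> runs g p xs (F g xs)) \<Longrightarrow> computable_on P F"
  unfolding computable_on_def by blast

lemma runs_Comp1: "runs g q xs y \<Longrightarrow> runs g p [y] z \<Longrightarrow> runs g (Comp p [q]) xs z"
  by (rule runs.Comp[of _ _ _ "[y]"]) simp_all

lemma runs_Comp2:
  "runs g q1 xs y1 \<Longrightarrow> runs g q2 xs y2 \<Longrightarrow> runs g p [y1, y2] z \<Longrightarrow> runs g (Comp p [q1, q2]) xs z"
  by (rule runs.Comp[of _ _ _ "[y1, y2]"]) simp_all

lemma computable_on_compose:
  assumes "computable_on P F" "computable_on Q f" "\<And>g xs. P g xs \<Longrightarrow> Q g [F g xs]"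
  shows "computable_on P (\<lambda>g xs. f g [F g xs])"
proof -
  from assms obtain p q where "\<And>g xs. P g xs \<Longrightarrow> runs g p xs (F g xs)"
    "\<And>g xs. Q g xs \<Longrightarrow> runs g q xs (f g xs)"
    unfolding computable_on_def by blast
  note progs = this
  show ?thesis
    by (rule computable_onI[of _ "Comp q [p]"]) (rule runs_Comp1[OF progs(1) progs(2)[OF assms(3)]])
qed

lemma computable_on_compose2:
  assumes "computable_on P F" "computable_on P G" "computable_on Q f"
    "\<And>g xs. P g xs \<Longrightarrow> Q g [F g xs, G g xs]"
  shows "computable_on P (\<lambda>g xs. f g [F g xs, G g xs])"
proof -
  from assms obtain p1 p2 q where "\<And>g xs. P g xs \<Longrightarrow> runs g p1 xs (F g xs)"
    "\<And>g xs. P g xs \<Longrightarrow> runs g p2 xs (G g xs)"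
    "\<And>g xs. Q g xs \<Longrightarrow> runs g q xs (f g xs)"
    unfolding computable_on_def by blast
  note progs = this
  show ?thesis
    by (rule computable_onI[of _ "Comp q [p1, p2]"])
      (rule runs_Comp2[OF progs(1,2) progs(3)[OF assms(4)]])
qed

lemma computable_on_nth: "(\<And>g xs. P g xs \<Longrightarrow> i < length xs) \<Longrightarrow> computable_on P (\<lambda>g xs. xs ! i)"
  by (rule computable_onI[of _ "Proj i"]) (auto intro: runs.Proj)

lemma computable_on_oracle:
  assumes "computable_on P F"
  shows "computable_on P (\<lambda>g xs. g (F g xs))"
proof -
  have "computable_on (\<lambda>g xs. length xs = 1) (\<lambda>g xs. g (xs ! 0))"
    by (rule computable_onI[of _ Oracle]) (auto simp: length_Suc_conv intro: runs.Oracle)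
  from computable_on_compose[OF assms this] show ?thesis by simp
qed

lemma computable_on_Suc:
  assumes "computable_on P F"
  shows "computable_on P (\<lambda>g xs. Suc (F g xs))"
proof -
  have "computable_on (\<lambda>g xs. length xs = 1) (\<lambda>g xs. Suc (xs ! 0))"
    by (rule computable_onI[of _ Succ]) (auto simp: length_Suc_conv intro: runs.Succ)
  from computable_on_compose[OF assms this] show ?thesis by simp
qed

lemma computable_on_const: "computable_on P (\<lambda>g xs. c)"
proof (induction c)
  case 0
  show ?case by (rule computable_onI[of _ Zero]) (rule runs.Zero)
next
  case (Suc c)
  thus ?case by (rule computable_on_Suc)
qed

definition add_prog where "add_prog = PrimRec (Proj 0) (Comp Succ [Proj 1])"
definition mult_prog where "mult_prog = PrimRec Zero (Comp add_prog [Proj 1, Proj 2])"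
definition power_prog where "power_prog = PrimRec (Comp Succ [Zero]) (Comp mult_prog [Proj 1, Proj 2])"
definition pred_prog where "pred_prog = PrimRec Zero (Proj 0)"
definition monus_prog where "monus_prog = PrimRec (Proj 0) (Comp pred_prog [Proj 1])"

lemma runs_Proj_eq: "i < length xs \<Longrightarrow> y = xs ! i \<Longrightarrow> runs g (Proj i) xs y"
  by (auto intro: runs.Proj)

lemma runs_add: "runs g add_prog [x, y] (x + y)"
  unfolding add_prog_def
proof (induction x)
  case 0
  show ?case by (intro runs.PrimRec_0 runs_Proj_eq) auto
next
  case (Suc x)
  show ?case
    by (rule runs.PrimRec_Suc[OF Suc]) (auto intro!: runs_Comp1[of _ _ _ "x + y"] runs_Proj_eq runs.Succ)
qed

lemma runs_mult: "runs g mult_prog [x, y] (x * y)"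
  unfolding mult_prog_def
proof (induction x)
  case 0
  show ?case by (simp add: runs.PrimRec_0 runs.Zero)
next
  case (Suc x)
  show ?case
    by (rule runs.PrimRec_Suc[OF Suc])
      (use runs_add[of g "x * y" y] in
        \<open>auto intro!: runs_Comp2[of _ _ _ "x * y" _ y] runs_Proj_eq simp: add.commute\<close>)
qed

lemma runs_power: "runs g power_prog [n, b] (b ^ n)"
  unfolding power_prog_def
proof (induction n)
  case 0
  show ?case
    by (rule runs.PrimRec_0, rule runs_Comp1[OF runs.Zero]) (use runs.Succ[of g 0] in simp)
next
  case (Suc n)
  show ?case
    by (rule runs.PrimRec_Suc[OF Suc])
      (use runs_mult[of g "b ^ n" b] in
        \<open>auto intro!: runs_Comp2[of _ _ _ "b ^ n" _ b] runs_Proj_eq simp: mult.commute\<close>)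
qed

lemma runs_pred: "runs g pred_prog [n] (n - 1)"
  unfolding pred_prog_def
proof (induction n)
  case 0
  show ?case by (simp add: runs.PrimRec_0 runs.Zero)
next
  case (Suc n)
  show ?case by (rule runs.PrimRec_Suc[OF Suc]) (auto intro: runs_Proj_eq)
qed

lemma runs_monus: "runs g monus_prog [x, y] (y - x)"
  unfolding monus_prog_def
proof (induction x)
  case 0
  show ?case by (intro runs.PrimRec_0 runs_Proj_eq) auto
next
  case (Suc x)
  show ?case
    by (rule runs.PrimRec_Suc[OF Suc])
      (use runs_pred[of g "y - x"] in \<open>auto intro!: runs_Comp1[of _ _ _ "y - x"] runs_Proj_eq\<close>)
qed

lemma computable_on_binop:
  assumes "\<And>g x y. runs g p [x, y] (f x y)" "computable_on P F" "computable_on P G"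
  shows "computable_on P (\<lambda>g xs. f (F g xs) (G g xs))"
proof -
  have "computable_on (\<lambda>g xs. length xs = 2) (\<lambda>g xs. f (xs ! 0) (xs ! 1))"
    by (rule computable_onI[of _ p])
      (use assms(1) in \<open>auto simp: length_Suc_conv numeral_2_eq_2\<close>)
  from computable_on_compose2[OF assms(2,3) this] show ?thesis by simp
qed

lemmas computable_on_add = computable_on_binop[OF runs_add]
  and computable_on_mult = computable_on_binop[OF runs_mult]

lemma computable_on_power:
  "computable_on P F \<Longrightarrow> computable_on P G \<Longrightarrow> computable_on P (\<lambda>g xs. F g xs ^ G g xs)"
  by (rule computable_on_binop[where f = "\<lambda>x y. y ^ x", OF runs_power])

lemma computable_on_monus:
  "computable_on P F \<Longrightarrow> computable_on P G \<Longrightarrow> computable_on P (\<lambda>g xs. F g xs - G g xs)"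
  by (rule computable_on_binop[where f = "\<lambda>x y. y - x", OF runs_monus])

lemma runs_Mu_Least:
  assumes p: "\<And>d. runs g p (d # xs) (f d)" and ex: "\<exists>d. f d = 0"
  shows "runs g (Mu p) xs (LEAST d. f d = 0)"
proof (rule runs.Mu)
  show "runs g p ((LEAST d. f d = 0) # xs) 0"
    using p[of "LEAST d. f d = 0"] LeastI_ex[OF ex] by simp
  fix i assume "i < (LEAST d. f d = 0)"
  hence "f i \<noteq> 0" by (rule not_less_Least)
  thus "\<exists>y. runs g p (i # xs) (Suc y)"
    using p[of i] by (metis not0_implies_Suc)
qed

text \<open>The quotient \<open>x div y\<close> is the least \<open>d\<close> with \<open>x < (d + 1) y\<close>.\<close>

lemma computable_on_div:
  assumes "computable_on P F" "computable_on P G" "\<And>g xs. P g xs \<Longrightarrow> 0 < G g xs"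
  shows "computable_on P (\<lambda>g xs. F g xs div G g xs)"
proof -
  have "computable_on (\<lambda>g xs. length xs = 3) (\<lambda>g xs. Suc (xs ! 1) - Suc (xs ! 0) * (xs ! 2))"
    by (intro computable_on_monus computable_on_mult computable_on_Suc computable_on_nth) simp_all
  then obtain p where p: "\<And>g xs. length xs = 3 \<Longrightarrow> runs g p xs (Suc (xs ! 1) - Suc (xs ! 0) * (xs ! 2))"
    unfolding computable_on_def by blast
  have "computable_on (\<lambda>g xs. length xs = 2 \<and> 0 < xs ! 1) (\<lambda>g xs. xs ! 0 div xs ! 1)"
  proof (rule computable_onI[of _ "Mu p"])
    fix g and xs :: "nat list" assume xs: "length xs = 2 \<and> 0 < xs ! (1 :: nat)"
    then obtain x y :: nat where xy: "xs = [x, y]" "0 < y"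
      by (auto simp: length_Suc_conv numeral_2_eq_2)
    have zero_iff: "Suc x - Suc d * y = 0 \<longleftrightarrow> x div y \<le> d" for d
      using xy(2) div_less_iff_less_mult[of y x "Suc d"] by (simp only: diff_is_0_eq Suc_le_eq less_Suc_eq_le)
    have "runs g (Mu p) [x, y] (LEAST d. Suc x - Suc d * y = 0)"
      by (rule runs_Mu_Least) (use p[of "[d, x, y]" for d] zero_iff in auto)
    moreover have "(LEAST d. x div y \<le> d) = x div y"
      by (rule Least_equality) auto
    ultimately show "runs g (Mu p) xs (xs ! 0 div xs ! 1)"
      unfolding zero_iff using xy by simp
  qed
  from computable_on_compose2[OF assms(1,2) this] assms(3) show ?thesis by simp
qed

text \<open>With \<open>c = 2\<close>, the search finds a positive lower bound for the real number that the oracle presents.\<close>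

lemma computable_on_search:
  assumes "\<And>g xs. P g xs \<Longrightarrow> \<exists>s. c \<le> g s"
  shows "computable_on P (\<lambda>g xs. LEAST s. c \<le> g s)"
proof -
  have "computable_on (\<lambda>g xs. xs \<noteq> []) (\<lambda>g xs. c - g (xs ! 0))"
    by (intro computable_on_monus computable_on_oracle computable_on_const computable_on_nth) simp
  then obtain p where p: "\<And>g xs. xs \<noteq> [] \<Longrightarrow> runs g p xs (c - g (xs ! 0))"
    unfolding computable_on_def by blast
  show ?thesis
  proof (rule computable_onI[of _ "Mu p"])
    fix g xs assume "P g xs"
    hence "runs g (Mu p) xs (LEAST s. c - g s = 0)"
      by (intro runs_Mu_Least) (use p[of "d # xs" for d] assms in auto)
    thus "runs g (Mu p) xs (LEAST s. c \<le> g s)" by simp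
  qed
qed

lemmas computable_on_intros =
  computable_on_const computable_on_Suc computable_on_add computable_on_mult computable_on_power
  computable_on_monus computable_on_oracle

lemma nat_round_div:
  fixes a b :: nat
  assumes "0 < b"
  shows "\<bar>real ((2 * a + b) div (2 * b)) - real a / real b\<bar> \<le> 1 / 2"
proof -
  define d where "d = (2 * a + b) div (2 * b)"
  define r where "r = (2 * a + b) mod (2 * b)"
  have "2 * b * d + r = 2 * a + b" "r < 2 * b"
    using assms unfolding d_def r_def by simp_all
  hence "real (2 * b * d + r) = real (2 * a + b)" "real r < real (2 * b)" "0 \<le> real r"
    by (simp_all only: of_nat_less_iff of_nat_0_le_iff)
  hence "2 * real b * real d \<le> 2 * real a + real b" "2 * real a + real b < 2 * real b * real d + 2 * real b"
    by simp_all
  thus ?thesis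
    using assms unfolding d_def[symmetric] abs_le_iff by (simp add: field_simps)
qed

text \<open>The search for \<open>s\<close> succeeds because \<open>2\<^sup>s \<kappa>\<close> is unbounded; an \<open>s\<close> with \<open>g s \<ge> 2\<close> certifies \<open>\<kappa> \<ge> 2\<^sup>-\<^sup>s\<close>.\<close>

lemma approximates_eventually_ge:
  assumes "approximates g \<kappa>" "0 < \<kappa>"
  shows "\<exists>s. 2 \<le> g s"
proof -
  obtain s where "3 / \<kappa> < 2 ^ s"
    using real_arch_pow[of 2 "3 / \<kappa>"] by auto
  hence "3 < 2 ^ s * \<kappa>" using assms(2) by (simp add: field_simps)
  moreover have "\<bar>real (g s) - 2 ^ s * \<kappa>\<bar> \<le> 1"
    using assms(1) by (simp add: approximates_def)
  ultimately have "2 \<le> real (g s)" by linarith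
  thus ?thesis by (intro exI[of _ s]) simp
qed

text \<open>The oracle is queried at the precision \<open>t\<close>: dividing \<open>c 2\<^sup>n\<^sup>+\<^sup>t\<close> by \<open>g t \<approx> 2\<^sup>t \<kappa>\<close> has an error of at most
\<open>2\<^sup>n c / (\<kappa> g t)\<close>, which the choice of \<open>t\<close> makes at most \<open>1/2\<close>; rounding to the nearest integer adds
another \<open>1/2\<close>.\<close>

definition scaled_inverse_approx :: "(nat \<Rightarrow> nat) \<Rightarrow> nat \<Rightarrow> nat \<Rightarrow> nat" where
  "scaled_inverse_approx g c n =
     (let t = n + 2 * (LEAST s. 2 \<le> g s) + 2 + c
      in (2 * (c * 2 ^ (n + t)) + g t) div (2 * g t))"

lemma scaled_inverse_approx:
  fixes c :: nat
  assumes g: "approximates g \<kappa>" and "0 < \<kappa>"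
  defines "t \<equiv> \<lambda>n. n + 2 * (LEAST s. 2 \<le> g s) + 2 + c"
  shows "0 < g (t n)" "approximates (scaled_inverse_approx g c) (real c / \<kappa>)"
proof -
  define s where "s = (LEAST s. 2 \<le> g s)"
  have err: "\<bar>real (g n) - 2 ^ n * \<kappa>\<bar> \<le> 1" for n
    using g by (simp add: approximates_def)
  have "2 \<le> g s"
    unfolding s_def using approximates_eventually_ge[OF assms(1,2)] by (rule LeastI_ex)
  with err[of s] have s: "1 \<le> 2 ^ s * \<kappa>" by linarith
  have gt: "2 ^ (n + s + 1 + c) \<le> real (g (t n))" for n
  proof -
    have "2 ^ (n + s + 2 + c) * 1 \<le> 2 ^ (n + s + 2 + c) * (2 ^ s * \<kappa>)"
      using s by (intro mult_left_mono) auto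
    also have "\<dots> = 2 ^ (n + s + 2 + c + s) * \<kappa>"
      by (simp only: power_add mult.assoc)
    also have "n + s + 2 + c + s = t n"
      by (simp add: t_def s_def)
    finally have "2 ^ (n + s + 2 + c) \<le> real (g (t n)) + 1"
      using err[of "t n"] by linarith
    moreover have "(1 :: real) \<le> 2 ^ (n + s + 1 + c)" by (rule one_le_power) simp
    moreover have "(2 :: real) ^ (n + s + 2 + c) = 2 * 2 ^ (n + s + 1 + c)" by simp
    ultimately show ?thesis by linarith
  qed
  have pos: "0 < g (t n)" for n
  proof -
    have "0 < (2 :: real) ^ (n + s + 1 + c)" by simp
    also note gt[of n]
    finally show ?thesis by simp
  qed
  show "0 < g (t n)" by (rule pos)
  show "approximates (scaled_inverse_approx g c) (real c / \<kappa>)"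
    unfolding approximates_def
  proof
    fix n
    let ?G = "real (g (t n))"
    have "real (c * 2 ^ (n + t n)) / ?G - 2 ^ n * (real c / \<kappa>) = 2 ^ n * real c * (2 ^ t n * \<kappa> - ?G) / (\<kappa> * ?G)"
      using pos[of n] \<open>0 < \<kappa>\<close> by (simp add: field_simps power_add)
    hence "\<bar>real (c * 2 ^ (n + t n)) / ?G - 2 ^ n * (real c / \<kappa>)\<bar> = 2 ^ n * real c * \<bar>2 ^ t n * \<kappa> - ?G\<bar> / (\<kappa> * ?G)"
      using \<open>0 < \<kappa>\<close> by (simp add: abs_mult)
    also have "\<dots> \<le> 2 ^ n * real c * 1 / (\<kappa> * ?G)"
      using err[of "t n"] \<open>0 < \<kappa>\<close> by (intro divide_right_mono mult_left_mono) (auto simp: abs_minus_commute)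
    also have "\<dots> \<le> 1 / 2"
    proof -
      \<comment> \<open>The term \<open>c\<close> in the precision \<open>t\<close> absorbs the factor \<open>c < 2\<^sup>c\<close>.\<close>
      have "2 ^ n * real c * 2 \<le> 2 ^ n * 2 ^ c * 2"
        using of_nat_less_two_power[of c, where 'a = real] by (intro mult_right_mono mult_left_mono) auto
      also have "\<dots> \<le> (2 ^ s * \<kappa>) * (2 ^ n * 2 ^ c * 2)"
        using mult_right_mono[OF s, of "2 ^ n * 2 ^ c * 2"] by simp
      also have "\<dots> = \<kappa> * 2 ^ (n + s + 1 + c)"
        by (simp add: power_add)
      also have "\<dots> \<le> \<kappa> * ?G"
        using gt[of n] \<open>0 < \<kappa>\<close> by (intro mult_left_mono) auto
      finally show ?thesis using pos[of n] \<open>0 < \<kappa>\<close> by (simp add: field_simps)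
    qed
    finally have "\<bar>real (c * 2 ^ (n + t n)) / ?G - 2 ^ n * (real c / \<kappa>)\<bar> \<le> 1 / 2" .
    moreover have "scaled_inverse_approx g c n = (2 * (c * 2 ^ (n + t n)) + g (t n)) div (2 * g (t n))"
      by (simp add: scaled_inverse_approx_def t_def Let_def)
    hence "\<bar>real (scaled_inverse_approx g c n) - real (c * 2 ^ (n + t n)) / ?G\<bar> \<le> 1 / 2"
      using nat_round_div[OF pos[of n], of "c * 2 ^ (n + t n)"] by (simp del: of_nat_mult)
    ultimately show "\<bar>real (scaled_inverse_approx g c n) - 2 ^ n * (real c / \<kappa>)\<bar> \<le> 1"
      by linarith
  qed
qed

section \<open>The exponent as a computable family of polynomials\<close>

definition box_poly :: "nat \<Rightarrow> real \<Rightarrow> real poly poly poly" where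
  "box_poly W c = (\<Sum>i\<le>W. monom (\<Sum>j\<le>W. monom (\<Sum>k\<le>W. monom c k) j) i)"

lemma coeff3_box_poly: "coeff3 (box_poly W c) i j k = (if i \<le> W \<and> j \<le> W \<and> k \<le> W then c else 0)"
  by (simp add: coeff3_def box_poly_def coeff_sum)

lemma eval3_box_poly:
  "eval3 (box_poly W c) x y z = c * (\<Sum>i\<le>W. x ^ i) * (\<Sum>j\<le>W. y ^ j) * (\<Sum>k\<le>W. z ^ k)"
  by (simp add: eval3_def box_poly_def poly_sum poly_monom poly_const_pow sum_distrib_left
      sum_distrib_right mult_ac)

text \<open>The numerator of \<open>\<xi>\<close> enters through its code, which a program reads off its input directly and which
majorizes the absolute value.\<close>

definition data_size :: "nat \<Rightarrow> nat \<Rightarrow> nat \<Rightarrow> rat \<Rightarrow> nat" where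
  "data_size m p q \<xi> =
     m + p + q + int_encode (fst (quotient_of \<xi>)) + nat (snd (quotient_of \<xi>))"

text \<open>A crude majorant, doubly exponential in \<open>s\<close>, of all constants and exponents depending on \<open>m, p, q, \<xi>\<close> in the
lower bound. It serves both as degree and as size of the coefficients.\<close>

definition box_size :: "nat \<Rightarrow> nat" where
  "box_size s = (8 * (s + 8)) ^ ((8 * (s + 8)) ^ 8)"

definition exponent_poly :: "nat \<Rightarrow> nat \<Rightarrow> nat \<Rightarrow> rat \<Rightarrow> int poly \<Rightarrow> real \<Rightarrow> real poly poly poly" where
  "exponent_poly m p q \<xi> T \<kappa> =
     (let W = box_size (data_size m p q \<xi>) in box_poly W (real W + real W / \<kappa>))"

lemma effectively_computable_exponent_poly: "effectively_computable exponent_poly"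
proof -
  define size where "size xs = xs ! 0 + xs ! 1 + xs ! 2 + xs ! 3 + xs ! 4" for xs :: "nat list"
  define W where "W = (\<lambda>xs. box_size (size xs))"
  define good where "good k g xs \<longleftrightarrow> length xs = k \<and> (\<exists>\<kappa>. 0 < \<kappa> \<and> approximates g \<kappa>)"
    for k :: nat and g :: "nat \<Rightarrow> nat" and xs :: "nat list"
  have W: "computable_on (good k) (\<lambda>g xs. W xs)" if "5 \<le> k" for k
    unfolding W_def box_size_def size_def
    by (intro computable_on_intros computable_on_nth) (use that in \<open>auto simp: good_def\<close>)
  have "computable_on (good 6) (\<lambda>g xs. 3 * W xs)"
    by (intro computable_on_intros W) simp
  then obtain deg_prog where deg: "\<And>g xs. good 6 g xs \<Longrightarrow> runs g deg_prog xs (3 * W xs)"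
    unfolding computable_on_def by blast
  \<comment> \<open>The factor \<open>1 - (\<dots>)\<close> is the indicator of the box \<open>i, j, k \<le> W\<close>, by truncated subtraction.\<close>
  define co where "co g xs = (1 - ((xs ! 6 - W xs) + (xs ! 7 - W xs) + (xs ! 8 - W xs))) *
      (W xs * 2 ^ (xs ! 9) + scaled_inverse_approx g (W xs) (xs ! 9))" for g xs
  have "computable_on (good 10) co"
    unfolding co_def scaled_inverse_approx_def Let_def
    by (intro computable_on_intros W computable_on_nth computable_on_div computable_on_search)
      (auto simp: good_def dest: approximates_eventually_ge scaled_inverse_approx(1))
  then obtain coeff_prog where coeff: "\<And>g xs. good 10 g xs \<Longrightarrow> runs g coeff_prog xs (co g xs)"
    unfolding computable_on_def by blast
  show ?thesis
    unfolding effectively_computable_def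
  proof (rule exI[of _ deg_prog], rule exI[of _ coeff_prog], intro allI impI conjI)
    fix m p q \<xi> T \<kappa> g assume *: "admissible m \<xi> T \<kappa> \<and> approximates g \<kappa>"
    hence \<kappa>: "0 < \<kappa>" and g: "approximates g \<kappa>" by (auto simp: admissible_def)
    define N where "N = box_size (data_size m p q \<xi>)"
    have N: "W (encode_data m p q \<xi> T @ ys) = N" for ys
      by (simp add: W_def size_def N_def data_size_def encode_data_def)
    have N': "W (encode_data m p q \<xi> T) = N" using N[of "[]"] by simp
    have good: "good 6 g (encode_data m p q \<xi> T)" "good 10 g (encode_data m p q \<xi> T @ [i, j, k, n])" for i j k n
      using \<kappa> g by (auto simp: good_def encode_data_def)
    have coeff3: "coeff3 (exponent_poly m p q \<xi> T \<kappa>) i j k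
        = (if i \<le> N \<and> j \<le> N \<and> k \<le> N then real N + real N / \<kappa> else 0)" for i j k
      by (simp add: exponent_poly_def Let_def coeff3_box_poly N_def)
    show "\<exists>N. runs g deg_prog (encode_data m p q \<xi> T) N \<and>
         (\<forall>i j k. N < i + j + k \<longrightarrow> coeff3 (exponent_poly m p q \<xi> T \<kappa>) i j k = 0)"
      using deg[OF good(1)] by (intro exI[of _ "3 * N"]) (auto simp: coeff3 N')
    fix i j k
    let ?h = "\<lambda>n. if i \<le> N \<and> j \<le> N \<and> k \<le> N then N * 2 ^ n + scaled_inverse_approx g N n else 0"
    have "approximates ?h (coeff3 (exponent_poly m p q \<xi> T \<kappa>) i j k)"
      using scaled_inverse_approx(2)[OF g \<kappa>, of N]
      by (auto simp: approximates_def coeff3 algebra_simps)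
    moreover have "runs g coeff_prog (encode_data m p q \<xi> T @ [i, j, k, n]) (?h n)" for n
    proof -
      let ?xs = "encode_data m p q \<xi> T @ [i, j, k, n]"
      have "?xs ! 6 = i" "?xs ! 7 = j" "?xs ! 8 = k" "?xs ! 9 = n"
        by (simp_all add: encode_data_def)
      hence "co g ?xs = (1 - ((i - N) + (j - N) + (k - N))) * (N * 2 ^ n + scaled_inverse_approx g N n)"
        by (simp only: co_def N)
      also have "\<dots> = ?h n"
        by (cases "i \<le> N \<and> j \<le> N \<and> k \<le> N") auto
      finally have "co g ?xs = ?h n" .
      with coeff[OF good(2)[of i j k n]] show ?thesis by (simp only:)
    qed
    ultimately show "\<exists>h. approximates h (coeff3 (exponent_poly m p q \<xi> T \<kappa>) i j k) \<and>
           (\<forall>n. runs g coeff_prog (encode_data m p q \<xi> T @ [i, j, k, n]) (h n))"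
      by blast
  qed
qed

section \<open>Siegel's lemma\<close>

text \<open>Pigeonhole principle: the vectors with entries in \<open>{0..<Y}\<close> outnumber the possible values of the \<open>M\<close>
linear forms on them, so two of these vectors have the same values, and their difference is a solution.\<close>

lemma siegel_lemma:
  fixes c :: "nat \<Rightarrow> 'i \<Rightarrow> int" and B h M :: nat
  assumes fin: "finite I" and I: "card I = N" and MN: "M < N"
    and bound: "\<And>l i. l < M \<Longrightarrow> i \<in> I \<Longrightarrow> \<bar>c l i\<bar> \<le> int B"
    and B: "0 < B" and h: "M < h * (N - M)"
  shows "\<exists>x :: 'i \<Rightarrow> int. (\<exists>i\<in>I. x i \<noteq> 0) \<and> (\<forall>l<M. (\<Sum>i\<in>I. c l i * x i) = 0) \<and>
    (\<forall>i\<in>I. \<bar>x i\<bar> \<le> int ((2 * N * B) ^ h))"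
proof -
  define Y where "Y = (2 * N * B) ^ h"
  define bd where "bd = N * B * (Y - 1)"
  define X where "X = (I \<rightarrow>\<^sub>E {0..<int Y})"
  define V where "V = ({..<M} \<rightarrow>\<^sub>E {- int bd..int bd})"
  define L where "L x = (\<lambda>l\<in>{..<M}. \<Sum>i\<in>I. c l i * x i)" for x :: "'i \<Rightarrow> int"
  have pos: "2 \<le> 2 * N * B" using B MN by simp
  hence Y: "0 < Y" unfolding Y_def by simp
  have "L ` X \<subseteq> V"
  proof (intro image_subsetI)
    fix x assume x: "x \<in> X"
    have "\<bar>\<Sum>i\<in>I. c l i * x i\<bar> \<le> int bd" if "l < M" for l
    proof -
      have "\<bar>\<Sum>i\<in>I. c l i * x i\<bar> \<le> (\<Sum>i\<in>I. \<bar>c l i * x i\<bar>)" by (rule sum_abs)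
      also have "\<dots> \<le> (\<Sum>i\<in>I. int B * int (Y - 1))"
      proof (rule sum_mono)
        fix i assume i: "i \<in> I"
        hence "x i \<in> {0..<int Y}" using x by (auto simp: X_def)
        hence "\<bar>x i\<bar> \<le> int (Y - 1)" by auto
        thus "\<bar>c l i * x i\<bar> \<le> int B * int (Y - 1)"
          unfolding abs_mult using bound[OF that i] by (intro mult_mono) auto
      qed
      also have "\<dots> = int bd" by (simp add: bd_def I)
      finally show ?thesis .
    qed
    thus "L x \<in> V" unfolding L_def V_def by (auto simp: abs_le_iff) (smt (verit))
  qed
  moreover have finV: "finite V" unfolding V_def by (intro finite_PiE) auto
  moreover have "card V < card X"
  proof -
    \<comment> \<open>Each form takes at most \<open>2 N B Y\<close> values, and \<open>Y\<close> is the power of \<open>2 N B\<close> for which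
      \<open>(2 N B Y)\<^sup>M < Y\<^sup>N\<close>; this is where \<open>M < h (N - M)\<close> is used.\<close>
    have "2 * bd + 1 \<le> 2 * N * B * Y"
    proof -
      have "2 * bd + 2 * N * B = 2 * N * B * Y"
        using Y by (cases Y) (simp_all add: bd_def algebra_simps)
      thus ?thesis using pos by linarith
    qed
    hence "(2 * bd + 1) ^ M \<le> (2 * N * B * Y) ^ M" by (rule power_mono) simp
    also have "\<dots> = (2 * N * B) ^ M * Y ^ M" by (rule power_mult_distrib)
    also have "(2 * N * B) ^ M < (2 * N * B) ^ (h * (N - M))"
      using h pos by (intro power_strict_increasing) linarith+
    also have "\<dots> * Y ^ M = Y ^ (N - M) * Y ^ M" by (simp only: Y_def power_mult)
    also have "\<dots> = Y ^ N" using MN by (simp flip: power_add)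
    finally have "(2 * bd + 1) ^ M < Y ^ N" using Y by simp
    moreover have "card {- int bd..int bd} = 2 * bd + 1" by simp
    ultimately show ?thesis by (simp add: V_def X_def card_PiE fin I)
  qed
  ultimately have "\<not> inj_on L X"
    by (metis card_inj_on_le not_less)
  then obtain x y where xy: "x \<in> X" "y \<in> X" "x \<noteq> y" "L x = L y"
    by (auto simp: inj_on_def)
  show ?thesis
  proof (intro exI[of _ "\<lambda>i. x i - y i"] conjI allI impI ballI)
    have "\<exists>i\<in>I. x i \<noteq> y i"
      using xy(1-3) unfolding X_def by (metis PiE_ext)
    thus "\<exists>i\<in>I. x i - y i \<noteq> 0" by auto
    fix l assume "l < M"
    with fun_cong[OF xy(4), of l] show "(\<Sum>i\<in>I. c l i * (x i - y i)) = 0"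
      by (simp add: L_def right_diff_distrib sum_subtractf)
  next
    fix i assume "i \<in> I"
    hence "x i \<in> {0..<int Y}" "y i \<in> {0..<int Y}" using xy by (auto simp: X_def)
    thus "\<bar>x i - y i\<bar> \<le> int ((2 * N * B) ^ h)" unfolding Y_def by auto
  qed
qed

section \<open>Coefficient norm and values of integer polynomials\<close>

definition coeff_sum_norm :: "int poly \<Rightarrow> int" where
  "coeff_sum_norm p = sum_list (map abs (coeffs p))"

lemma coeff_sum_norm_0 [simp]: "coeff_sum_norm 0 = 0"
  by (simp add: coeff_sum_norm_def)

lemma coeff_sum_norm_pCons [simp]: "coeff_sum_norm (pCons a p) = \<bar>a\<bar> + coeff_sum_norm p"
  by (auto simp: coeff_sum_norm_def coeffs_pCons_eq_cCons cCons_def)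

lemma coeff_sum_norm_nonneg [simp]: "0 \<le> coeff_sum_norm p"
  by (induction p) auto

lemma coeff_sum_norm_add: "coeff_sum_norm (p + q) \<le> coeff_sum_norm p + coeff_sum_norm q"
  by (induction p q rule: poly_induct2) (auto intro: order_trans[OF abs_triangle_ineq])

lemma coeff_sum_norm_sum: "coeff_sum_norm (\<Sum>i\<in>I. p i) \<le> (\<Sum>i\<in>I. coeff_sum_norm (p i))"
  by (induction I rule: infinite_finite_induct) (auto intro: order_trans[OF coeff_sum_norm_add])

lemma coeff_sum_norm_smult [simp]: "coeff_sum_norm (Polynomial.smult a p) = \<bar>a\<bar> * coeff_sum_norm p"
  by (induction p) (auto simp: abs_mult algebra_simps)

lemma coeff_sum_norm_mult: "coeff_sum_norm (p * q) \<le> coeff_sum_norm p * coeff_sum_norm q"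
proof (induction p)
  case (pCons a p)
  have "coeff_sum_norm (pCons a p * q) \<le> coeff_sum_norm (Polynomial.smult a q) + coeff_sum_norm (pCons 0 (p * q))"
    unfolding mult_pCons_left by (rule coeff_sum_norm_add)
  with pCons show ?case by (auto simp: algebra_simps)
qed auto

text \<open>The degree appears because the derivation multiplies the coefficient of index \<open>i\<close> by \<open>i\<close>; it is the
only source of factors \<open>n\<close> when linear forms are differentiated.\<close>

lemma coeff_sum_norm_pderiv: "coeff_sum_norm (pderiv p) \<le> int (degree p) * coeff_sum_norm p"
proof (induction p)
  case (pCons a p)
  show ?case
  proof (cases "p = 0")
    case False
    have "coeff_sum_norm (pderiv (pCons a p)) \<le> coeff_sum_norm p + coeff_sum_norm (pCons 0 (pderiv p))"
      unfolding pderiv_pCons by (rule coeff_sum_norm_add)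
    also have "\<dots> \<le> (int (degree p) + 1) * coeff_sum_norm p"
      using pCons by (simp add: algebra_simps)
    also have "\<dots> \<le> (int (degree p) + 1) * (\<bar>a\<bar> + coeff_sum_norm p)"
      by (intro mult_left_mono) auto
    finally show ?thesis using False by (simp add: algebra_simps)
  qed (simp add: pderiv_pCons)
qed auto

lemma coeff_sum_norm_le:
  assumes "\<And>i. \<bar>coeff p i\<bar> \<le> b" "degree p \<le> d"
  shows "coeff_sum_norm p \<le> (int d + 1) * b"
proof -
  have "\<bar>c\<bar> \<le> b" if "c \<in> set (coeffs p)" for c
  proof -
    have "c \<in> range (coeff p)" using that by (simp add: range_coeff)
    thus ?thesis using assms(1) by auto
  qed
  hence "sum_list (map abs (coeffs p)) \<le> sum_list (map (\<lambda>_. b) (coeffs p))"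
    by (intro sum_list_mono) auto
  also have "\<dots> = int (length (coeffs p)) * b" by (simp add: sum_list_triv)
  also have "\<dots> \<le> (int d + 1) * b"
    using assms(2) order_trans[OF abs_ge_zero assms(1)[of 0]]
    by (intro mult_right_mono) (auto simp: length_coeffs_degree coeffs_def)
  finally show ?thesis by (simp add: coeff_sum_norm_def)
qed

lemma sum_coeff_le_coeff_sum_norm: "(\<Sum>i\<le>d. \<bar>coeff p i\<bar>) \<le> coeff_sum_norm p"
proof (induction p arbitrary: d)
  case (pCons a p)
  show ?case
  proof (cases d)
    case (Suc e)
    show ?thesis using pCons(2)[of e] unfolding Suc sum.atMost_Suc_shift by (simp del: sum.atMost_Suc)
  qed simp
qed simp

text \<open>The value at \<open>u/v\<close> with the denominator \<open>v\<^sup>d\<close> cleared.\<close>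

definition homogenize :: "nat \<Rightarrow> int poly \<Rightarrow> int \<Rightarrow> int \<Rightarrow> int" where
  "homogenize d p u v = (\<Sum>i\<le>d. coeff p i * u ^ i * v ^ (d - i))"

lemma of_int_homogenize:
  fixes x :: "'a :: field_char_0"
  assumes "degree p \<le> d" "v \<noteq> 0"
  shows "of_int (homogenize d p u v) = of_int v ^ d * poly (map_poly of_int p) (of_int u / of_int v :: 'a)"
proof -
  have "poly (map_poly of_int p) (of_int u / of_int v :: 'a) =
      (\<Sum>i\<le>d. of_int (coeff p i) * (of_int u / of_int v) ^ i)"
    using order_trans[OF map_poly_degree_leq assms(1)] by (subst poly_altdef, subst sum.mono_neutral_left[of "{..d}"])
      (auto simp: coeff_map_poly coeff_eq_0 intro: le_degree)
  also have "of_int v ^ d * \<dots> = (\<Sum>i\<le>d. of_int (coeff p i * u ^ i * v ^ (d - i)))"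
    unfolding sum_distrib_left
  proof (intro sum.cong refl)
    fix i assume "i \<in> {..d}"
    hence "(of_int v :: 'a) ^ d = of_int v ^ (d - i) * of_int v ^ i" by (simp flip: power_add)
    thus "(of_int v :: 'a) ^ d * (of_int (coeff p i) * (of_int u / of_int v) ^ i) =
        of_int (coeff p i * u ^ i * v ^ (d - i))"
      using assms(2) by (simp add: power_divide)
  qed
  finally show ?thesis by (simp add: homogenize_def)
qed

lemma abs_homogenize_le:
  assumes "\<bar>u\<bar> \<le> z" "\<bar>v\<bar> \<le> z"
  shows "\<bar>homogenize d p u v\<bar> \<le> coeff_sum_norm p * z ^ d"
proof -
  have "\<bar>homogenize d p u v\<bar> \<le> (\<Sum>i\<le>d. \<bar>coeff p i * u ^ i * v ^ (d - i)\<bar>)"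
    unfolding homogenize_def by (rule sum_abs)
  also have "\<dots> \<le> (\<Sum>i\<le>d. \<bar>coeff p i\<bar> * z ^ d)"
  proof (rule sum_mono)
    fix i assume "i \<in> {..d}"
    hence "z ^ d = z ^ i * z ^ (d - i)" by (simp flip: power_add)
    thus "\<bar>coeff p i * u ^ i * v ^ (d - i)\<bar> \<le> \<bar>coeff p i\<bar> * z ^ d"
      unfolding abs_mult power_abs mult.assoc
      using assms by (auto intro!: mult_left_mono mult_mono power_mono)
  qed
  also have "\<dots> \<le> coeff_sum_norm p * z ^ d"
    unfolding sum_distrib_right[symmetric]
    using assms by (intro mult_right_mono sum_coeff_le_coeff_sum_norm) auto
  finally show ?thesis .
qed

section \<open>Coordinates bounded by independent integer linear forms\<close>

lemma abs_det_le:
  fixes A :: "int mat"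
  assumes A: "A \<in> carrier_mat n n" and r: "\<And>i j. i < n \<Longrightarrow> j < n \<Longrightarrow> \<bar>A $$ (i, j)\<bar> \<le> r i"
  shows "\<bar>det A\<bar> \<le> fact n * (\<Prod>i<n. r i)"
proof -
  have "\<bar>det A\<bar> = \<bar>\<Sum>p | p permutes {0..<n}. signof p * (\<Prod>i = 0..<n. A $$ (i, p i))\<bar>"
    using A by (simp add: det_def)
  also have "\<dots> \<le> (\<Sum>p | p permutes {0..<n}. \<bar>signof p * (\<Prod>i = 0..<n. A $$ (i, p i))\<bar>)"
    by (rule sum_abs)
  also have "\<dots> \<le> (\<Sum>p | p permutes {0..<n}. \<Prod>i<n. r i)"
  proof (rule sum_mono)
    fix p assume "p \<in> {p. p permutes {0..<n}}"
    hence p: "p permutes {0..<n}" by simp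
    have "\<bar>signof p * (\<Prod>i = 0..<n. A $$ (i, p i))\<bar> = (\<Prod>i = 0..<n. \<bar>A $$ (i, p i)\<bar>)"
      by (simp add: abs_mult abs_prod sign_def)
    also have "\<dots> \<le> (\<Prod>i = 0..<n. r i)"
      using permutes_in_image[OF p] by (intro prod_mono conjI r) auto
    finally show "\<bar>signof p * (\<Prod>i = 0..<n. A $$ (i, p i))\<bar> \<le> (\<Prod>i<n. r i)"
      by (simp add: atLeast0LessThan)
  qed
  also have "\<dots> = fact n * (\<Prod>i<n. r i)"
    by (simp add: card_permutations)
  finally show ?thesis .
qed

text \<open>The rows \<open>w k\<close> span the space, so replacing a suitable one of them by \<open>a \<noteq> 0\<close> leaves an integer matrix \<open>V k\<close>
with nonzero determinant. By Cramer's rule, \<open>det (V k) x\<^sub>j\<close> is a combination of the values of the rows at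
\<open>x\<close> with cofactors as coefficients. The cofactor that multiplies the value of \<open>a\<close> does not contain the
row \<open>a\<close>, while the others contain it once: hence the exponents of \<open>b\<close> and the factor \<open>H\<close>. The
independence is stated over the complex numbers, as in the zero estimate.\<close>

lemma coordinate_bound_of_linear_forms:
  fixes w :: "nat \<Rightarrow> nat \<Rightarrow> int" and a :: "nat \<Rightarrow> int" and x :: "nat \<Rightarrow> real" and b H :: int and r :: real
  assumes m: "2 \<le> m"
    and indep: "\<And>c :: nat \<Rightarrow> complex. \<forall>i<m. (\<Sum>k<m. c k * of_int (w k i)) = 0 \<Longrightarrow> \<forall>k<m. c k = 0"
    and w: "\<And>k i. k < m \<Longrightarrow> i < m \<Longrightarrow> \<bar>w k i\<bar> \<le> b"
    and a: "\<exists>i<m. a i \<noteq> 0" "\<And>i. i < m \<Longrightarrow> \<bar>a i\<bar> \<le> H"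
    and r: "\<And>k. k < m \<Longrightarrow> \<bar>\<Sum>i<m. of_int (w k i) * x i\<bar> \<le> r"
    and j: "j < m"
  shows "\<bar>x j\<bar> \<le> fact m *
    (of_int b ^ (m - 1) * \<bar>\<Sum>i<m. of_int (a i) * x i\<bar> + of_int H * of_int b ^ (m - 2) * r)"
proof -
  define W where "W = mat m m (\<lambda>(k, i). w k i)"
  define V where "V k = mat m m (\<lambda>(k', i). if k' = k then a i else w k' i)" for k
  have W: "W \<in> carrier_mat m m" and V: "V k \<in> carrier_mat m m" for k
    by (auto simp: W_def V_def)
  have detW: "det W \<noteq> 0"
  proof
    assume "det W = 0"
    define WC where "WC = transpose_mat (map_mat complex_of_int W)"
    have WC: "WC \<in> carrier_mat m m" using W by (simp add: WC_def)
    have "det WC = complex_of_int (det W)"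
      unfolding WC_def using W by (subst det_transpose[of _ m]) (auto simp: of_int_hom.hom_det)
    with \<open>det W = 0\<close> obtain v where v: "v \<in> carrier_vec m" "v \<noteq> 0\<^sub>v m" "WC *\<^sub>v v = 0\<^sub>v m"
      using det_0_iff_vec_prod_zero[OF WC] by auto
    have "\<forall>i<m. (\<Sum>k<m. vec_index v k * of_int (w k i)) = 0"
    proof (intro allI impI)
      fix i assume i: "i < m"
      have "0 = vec_index (WC *\<^sub>v v) i" using v(3) i by simp
      also have "\<dots> = (\<Sum>k<m. of_int (w k i) * vec_index v k)"
        using i v(1) by (simp add: WC_def W_def scalar_prod_def atLeast0LessThan)
      finally show "(\<Sum>k<m. vec_index v k * of_int (w k i)) = 0" by (simp add: mult.commute)
    qed
    from indep[OF this] have "v = 0\<^sub>v m" using v(1) by (intro eq_vecI) auto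
    with v(2) show False by simp
  qed
  have cof: "cofactor (V k) k i = cofactor W k i" for k i
    unfolding cofactor_def mat_delete_def by (intro arg_cong2[of _ _ _ _ "(*)"] arg_cong[of _ _ det] refl eq_matI)
      (auto simp: V_def W_def)
  have detV: "det (V k) = (\<Sum>i<m. a i * cofactor W k i)" if "k < m" for k
    using laplace_expansion_row[OF V that, of k] that by (simp add: cof) (simp add: V_def)
  \<comment> \<open>The vector of the \<open>det (V k)\<close> is \<open>a\<close> times the adjugate of \<open>W\<close>, which is invertible with \<open>W\<close>.\<close>
  have "\<exists>k<m. det (V k) \<noteq> 0"
  proof (rule ccontr)
    assume "\<not> ?thesis"
    hence zero: "(\<Sum>i<m. a i * cofactor W k i) = 0" if "k < m" for k using detV that by metis
    have "a i * det W = 0" if i: "i < m" for i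
    proof -
      have "(\<Sum>k<m. cofactor W k i' * w k i) = (if i' = i then det W else 0)" if i': "i' < m" for i'
      proof -
        have "(adj_mat W * W) $$ (i', i) = (\<Sum>k<m. cofactor W k i' * w k i)"
          using i i' W by (simp add: adj_mat_def scalar_prod_def atLeast0LessThan) (simp add: W_def)
        thus ?thesis using adj_mat(3)[OF W] i i' by auto
      qed
      hence "(\<Sum>i'<m. a i' * (\<Sum>k<m. cofactor W k i' * w k i)) = (\<Sum>i'<m. a i' * (if i' = i then det W else 0))"
        by (intro sum.cong) auto
      also have "\<dots> = a i * det W" using i by (simp add: if_distrib cong: if_cong)
      finally have "a i * det W = (\<Sum>i'<m. \<Sum>k<m. a i' * cofactor W k i' * w k i)"
        by (simp add: sum_distrib_left mult.assoc)
      also have "\<dots> = (\<Sum>k<m. (\<Sum>i'<m. a i' * cofactor W k i') * w k i)"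
        by (subst sum.swap) (simp add: sum_distrib_right)
      also have "\<dots> = 0" using zero by simp
      finally show ?thesis .
    qed
    thus False using detW a(1) by auto
  qed
  then obtain k where k: "k < m" "det (V k) \<noteq> 0" by blast
  have b: "0 \<le> b" using w[of 0 0] m by linarith
  have H: "0 \<le> H" using a by fastforce
  have cofk: "\<bar>cofactor (V k) i j\<bar> \<le> fact (m - 1) * (if i = k then b ^ (m - 1) else H * b ^ (m - 2))"
    if i: "i < m" for i
  proof -
    define r' where "r' i' = (if insert_index i i' = k then H else b)" for i'
    have "\<bar>det (mat_delete (V k) i j)\<bar> \<le> fact (m - 1) * (\<Prod>i'<m - 1. r' i')"
    proof (rule abs_det_le)
      show "mat_delete (V k) i j \<in> carrier_mat (m - 1) (m - 1)" using V[of k] by (simp add: mat_delete_def)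
      fix i' j' assume ij: "i' < m - 1" "j' < m - 1"
      have "insert_index i i' < m" "insert_index j j' < m" using ij by (auto simp: insert_index_def)
      moreover have "mat_delete (V k) i j $$ (i', j') = V k $$ (insert_index i i', insert_index j j')"
        using mat_delete_index[of "V k" "m - 1" i j i' j'] V[of k] m i j ij by simp
      ultimately show "\<bar>mat_delete (V k) i j $$ (i', j')\<bar> \<le> r' i'"
        using w a(2) by (auto simp: V_def r'_def)
    qed
    also have "(\<Prod>i'<m - 1. r' i') = (if i = k then b ^ (m - 1) else H * b ^ (m - 2))"
    proof (cases "i = k")
      case True
      hence "r' i' = b" for i' by (auto simp: r'_def insert_index_def)
      thus ?thesis using True by simp
    next
      case False
      \<comment> \<open>The index at which row \<open>k\<close> appears after row \<open>i\<close> has been deleted.\<close>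
      define i0 where "i0 = (if k < i then k else k - 1)"
      have i0: "i0 < m - 1" using False k(1) i by (auto simp: i0_def)
      have r': "r' i' = (if i' = i0 then H else b)" for i'
        using False by (auto simp: r'_def i0_def insert_index_def)
      have "(\<Prod>i'<m - 1. r' i') = H * (\<Prod>i'\<in>{..<m - 1} - {i0}. r' i')"
        using i0 by (subst prod.remove[of _ i0]) (auto simp: r')
      also have "(\<Prod>i'\<in>{..<m - 1} - {i0}. r' i') = b ^ card ({..<m - 1} - {i0})"
        by (simp add: r')
      also have "card ({..<m - 1} - {i0}) = m - 2" using i0 by simp
      finally show ?thesis using False by simp
    qed
    finally show ?thesis by (simp add: cofactor_def abs_mult power_abs)
  qed
  define S where "S = \<bar>\<Sum>i<m. of_int (a i) * x i\<bar>"
  have r0: "0 \<le> r" using r[of 0] m by linarith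
  define y where "y i = (\<Sum>l<m. of_int (V k $$ (i, l)) * x l)" for i
  have yk: "\<bar>y k\<bar> = S" using k(1) by (simp add: y_def S_def V_def)
  have yi: "\<bar>y i\<bar> \<le> r" if "i < m" "i \<noteq> k" for i
    using r[OF that(1)] that by (simp add: y_def V_def)
  have cramer: "of_int (det (V k)) * x j = (\<Sum>i<m. of_int (cofactor (V k) i j) * y i)"
  proof -
    have cofsum: "(\<Sum>i<m. cofactor (V k) i j * V k $$ (i, l)) = (if j = l then det (V k) else 0)" if l: "l < m" for l
    proof -
      have "(adj_mat (V k) * V k) $$ (j, l) = (\<Sum>i<m. cofactor (V k) i j * V k $$ (i, l))"
        using l j V[of k] by (simp add: adj_mat_def scalar_prod_def atLeast0LessThan)
      thus ?thesis using adj_mat(3)[OF V[of k]] l j by auto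
    qed
    have *: "(\<Sum>i<m. real_of_int (cofactor (V k) i j) * of_int (V k $$ (i, l))) = of_int (if j = l then det (V k) else 0)"
      if "l < m" for l using arg_cong[OF cofsum[OF that], of real_of_int] by (simp only: of_int_sum of_int_mult)
    have "(\<Sum>i<m. of_int (cofactor (V k) i j) * y i)
        = (\<Sum>l<m. (\<Sum>i<m. of_int (cofactor (V k) i j) * of_int (V k $$ (i, l))) * x l)"
      unfolding y_def sum_distrib_left sum_distrib_right
      by (subst sum.swap) (simp add: mult.assoc)
    also have "\<dots> = (\<Sum>l<m. of_int (if j = l then det (V k) else 0) * x l)" using * by simp
    also have "\<dots> = of_int (det (V k)) * x j" using j by (simp add: if_distrib[of "\<lambda>t. t * _"] if_distrib[of of_int] cong: if_cong)
    finally show ?thesis by simp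
  qed
  have "1 \<le> \<bar>det (V k)\<bar>" using k(2) by linarith
  hence "1 \<le> \<bar>real_of_int (det (V k))\<bar>" by (metis of_int_1_le_iff of_int_abs)
  hence "\<bar>x j\<bar> \<le> \<bar>real_of_int (det (V k))\<bar> * \<bar>x j\<bar>"
    using mult_right_mono[of 1 "\<bar>real_of_int (det (V k))\<bar>" "\<bar>x j\<bar>"] by simp
  also have "\<dots> = \<bar>\<Sum>i<m. of_int (cofactor (V k) i j) * y i\<bar>" by (simp only: cramer flip: abs_mult)
  also have "\<dots> \<le> (\<Sum>i<m. \<bar>of_int (cofactor (V k) i j) * y i\<bar>)" by (rule sum_abs)
  also have "\<dots> \<le> (\<Sum>i<m. fact (m - 1) * (of_int b ^ (m - 1) * S + of_int H * of_int b ^ (m - 2) * r))"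
  proof (rule sum_mono)
    fix i assume "i \<in> {..<m}"
    hence i: "i < m" by simp
    have "\<bar>real_of_int (cofactor (V k) i j)\<bar> \<le> of_int (fact (m - 1) * (if i = k then b ^ (m - 1) else H * b ^ (m - 2)))"
      using cofk[OF i] by (simp only: flip: of_int_abs of_int_le_iff)
    also have "\<dots> = fact (m - 1) * (if i = k then of_int b ^ (m - 1) else of_int H * of_int b ^ (m - 2))"
      by simp
    finally have c: "\<bar>real_of_int (cofactor (V k) i j)\<bar> \<le> \<dots>" .
    have "\<bar>of_int (cofactor (V k) i j) * y i\<bar> \<le>
        fact (m - 1) * (if i = k then of_int b ^ (m - 1) else of_int H * of_int b ^ (m - 2)) * (if i = k then S else r)"
      unfolding abs_mult using c yk yi i b H by (intro mult_mono) auto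
    also have "\<dots> = fact (m - 1) * (if i = k then of_int b ^ (m - 1) * S else of_int H * of_int b ^ (m - 2) * r)"
      by simp
    also have "\<dots> \<le> fact (m - 1) * (of_int b ^ (m - 1) * S + of_int H * of_int b ^ (m - 2) * r)"
      using b H r0 by (intro mult_left_mono) (auto simp: S_def)
    finally show "\<bar>of_int (cofactor (V k) i j) * y i\<bar> \<le> fact (m - 1) * (of_int b ^ (m - 1) * S + of_int H * of_int b ^ (m - 2) * r)" .
  qed
  also have "\<dots> = fact m * (of_int b ^ (m - 1) * S + of_int H * of_int b ^ (m - 2) * r)"
    using m by (cases m) (simp_all add: mult.assoc)
  finally show ?thesis by (simp add: S_def)
qed

section \<open>Power series coefficients under the derivation\<close>

abbreviation rat_fps :: "int poly \<Rightarrow> rat fps" where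
  "rat_fps p \<equiv> fps_of_poly (map_poly of_int p)"

lemma rat_fps_nth [simp]: "fps_nth (rat_fps p) l = of_int (coeff p l)"
  by (simp add: coeff_map_poly)

lemma rat_fps_add: "rat_fps (p + q) = rat_fps p + rat_fps q"
  by (rule fps_ext) (simp add: coeff_map_poly)

lemma rat_fps_sum: "rat_fps (\<Sum>i\<in>I. p i) = (\<Sum>i\<in>I. rat_fps (p i))"
  by (rule fps_ext) (simp add: coeff_map_poly coeff_sum fps_sum_nth)

lemma rat_fps_mult: "rat_fps (p * q) = rat_fps p * rat_fps q"
  by (rule fps_ext) (simp add: coeff_map_poly coeff_mult fps_mult_nth atLeast0AtMost)

lemma rat_fps_pderiv: "rat_fps (pderiv p) = fps_deriv (rat_fps p)"
  by (rule fps_ext) (simp add: coeff_map_poly coeff_pderiv)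

text \<open>On the sequence \<open>l! F\<^sub>l\<close> differentiation is the shift, which costs nothing, and multiplication by
\<open>z\<^sup>j\<close> costs the factor \<open>l! / (l - j)! \<le> l\<^sup>j\<close>.\<close>

lemma abs_nth_poly_times_deriv_le:
  fixes F :: "rat fps" and w :: "nat \<Rightarrow> rat"
  assumes q: "degree S \<le> q" and F: "\<And>l. \<bar>fps_nth F l\<bar> * fact l \<le> w l" and w: "mono w"
  shows "\<bar>fps_nth (rat_fps S * fps_deriv F) l\<bar> * fact l \<le>
      of_int (coeff_sum_norm S) * of_nat (Suc l) ^ q * w (Suc l)"
proof -
  have "\<bar>fps_nth (rat_fps S * fps_deriv F) l\<bar> * fact l =
      \<bar>\<Sum>j = 0..l. of_int (coeff S j) * (of_nat (l - j + 1) * fps_nth F (l - j + 1))\<bar> * fact l"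
    unfolding fps_mult_nth rat_fps_nth fps_deriv_nth by simp
  also have "\<dots> \<le> (\<Sum>j = 0..l. \<bar>of_int (coeff S j) * (of_nat (l - j + 1) * fps_nth F (l - j + 1))\<bar>) * fact l"
    by (intro mult_right_mono sum_abs) auto
  also have "\<dots> \<le> (\<Sum>j = 0..l. \<bar>of_int (coeff S j)\<bar> * (of_nat (Suc l) ^ q * w (Suc l)))"
    unfolding sum_distrib_right
  proof (rule sum_mono)
    fix j assume j: "j \<in> {0..l}"
    show "\<bar>of_int (coeff S j) * (of_nat (l - j + 1) * fps_nth F (l - j + 1))\<bar> * fact l
        \<le> \<bar>of_int (coeff S j)\<bar> * (of_nat (Suc l) ^ q * w (Suc l))"
    proof (cases "j \<le> q")
      case False
      hence "coeff S j = 0" using q by (intro coeff_eq_0) simp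
      thus ?thesis by simp
    next
      case True
      have "fact l \<le> (Suc l) ^ j * fact (l - j)"
      proof -
        have "fact l div fact (l - j) \<le> l ^ j" using j by (intro fact_div_fact_le_pow) simp
        also have "\<dots> \<le> Suc l ^ j" by (intro power_mono) auto
        finally have "(fact l div fact (l - j)) * fact (l - j) \<le> Suc l ^ j * (fact (l - j) :: nat)"
          by (rule mult_right_mono) simp
        moreover have "fact l = (fact l div fact (l - j)) * (fact (l - j) :: nat)"
          using fact_dvd[of "l - j" l, where 'a = nat] by simp
        ultimately show ?thesis by (simp only:)
      qed
      also have "\<dots> \<le> Suc l ^ q * fact (l - j)" using True by (intro mult_right_mono power_increasing) auto
      finally have "(of_nat (fact l) :: rat) \<le> of_nat (Suc l ^ q * fact (l - j))"
        by (simp only: of_nat_le_iff)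
      hence "(fact l :: rat) \<le> of_nat (Suc l) ^ q * fact (l - j)"
        by (simp only: of_nat_fact of_nat_mult of_nat_power)
      hence "(of_nat (l - j + 1) * \<bar>fps_nth F (l - j + 1)\<bar>) * fact l \<le>
          (of_nat (l - j + 1) * \<bar>fps_nth F (l - j + 1)\<bar>) * (of_nat (Suc l) ^ q * fact (l - j))"
        by (intro mult_left_mono) auto
      also have "\<dots> = of_nat (Suc l) ^ q * (\<bar>fps_nth F (l - j + 1)\<bar> * fact (l - j + 1))"
        by (simp add: mult_ac)
      also have "\<dots> \<le> of_nat (Suc l) ^ q * w (l - j + 1)"
        by (intro mult_left_mono F) auto
      also have "\<dots> \<le> of_nat (Suc l) ^ q * w (Suc l)"
        by (intro mult_left_mono monoD[OF w]) auto
      finally show ?thesis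
        by (simp add: abs_mult mult.assoc mult_left_mono)
    qed
  qed
  also have "\<dots> = of_int (\<Sum>j\<le>l. \<bar>coeff S j\<bar>) * (of_nat (Suc l) ^ q * w (Suc l))"
    by (simp add: sum_distrib_right atLeast0AtMost)
  also have "\<dots> \<le> of_int (coeff_sum_norm S) * (of_nat (Suc l) ^ q * w (Suc l))"
  proof (intro mult_right_mono)
    show "of_int (\<Sum>j\<le>l. \<bar>coeff S j\<bar>) \<le> (of_int (coeff_sum_norm S) :: rat)"
      unfolding of_int_le_iff by (rule sum_coeff_le_coeff_sum_norm)
    have "0 \<le> w (Suc l)" using F[of "Suc l"] by (rule order_trans[rotated]) simp
    thus "0 \<le> of_nat (Suc l) ^ q * w (Suc l)" by simp
  qed
  finally show ?thesis by (simp add: mult.assoc)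
qed

section \<open>Linear forms attached to a differential system\<close>

text \<open>The data of the theorem with every constant replaced by a single integer \<open>Z\<close>. All geometric factors
then become powers of \<open>Z\<close>, and only the competition between such powers and \<open>n\<^sup>n\<close> has to be followed.\<close>

locale bounded_E_system =
  fixes m q Z :: nat and T :: "int poly" and A :: "nat \<Rightarrow> nat \<Rightarrow> rat poly fract"
    and f :: "nat \<Rightarrow> rat fps"
  assumes Z: "3 \<le> Z" "m \<le> Z" "q + 1 \<le> Z" and m: "1 \<le> m"
    and system: "\<And>i. i < m \<Longrightarrow>
      rat_fps T * fps_deriv (f i) = (\<Sum>j<m. rat_fps (numer_entry T A i j) * f j)"
    and degree_T: "degree T \<le> q" and height_T: "\<And>l. \<bar>coeff T l\<bar> \<le> int Z"
    and degree_numer: "\<And>i j. i < m \<Longrightarrow> j < m \<Longrightarrow> degree (numer_entry T A i j) \<le> q"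
    and height_numer: "\<And>i j l. i < m \<Longrightarrow> j < m \<Longrightarrow> \<bar>coeff (numer_entry T A i j) l\<bar> \<le> int Z"
    and egf_coeff_le: "\<And>i l. i < m \<Longrightarrow> \<bar>egf_coeff (f i) l\<bar> \<le> of_nat Z ^ (l + 1)"
    and common_denominators: "\<And>i l. i < m \<Longrightarrow>
      \<exists>d. 0 < d \<and> d \<le> Z ^ (l + 1) \<and> (\<forall>k\<le>l. of_nat d * egf_coeff (f i) k \<in> \<int>)"
begin

abbreviation "P Q k i \<equiv> shidlovskii_poly m T A Q k i"

definition linear_form :: "(nat \<Rightarrow> int poly) \<Rightarrow> nat \<Rightarrow> rat fps" where
  "linear_form Q k = (\<Sum>i<m. rat_fps (P Q k i) * f i)"

text \<open>The recursion of \<open>shidlovskii_poly\<close> is the product rule combined with the differential system.\<close>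

lemma linear_form_Suc: "linear_form Q (Suc k) = rat_fps T * fps_deriv (linear_form Q k)"
proof -
  have "rat_fps T * fps_deriv (linear_form Q k) =
      (\<Sum>i<m. rat_fps T * fps_deriv (rat_fps (P Q k i)) * f i) +
      (\<Sum>i<m. rat_fps (P Q k i) * (rat_fps T * fps_deriv (f i)))"
    by (simp add: linear_form_def fps_deriv_sum sum_distrib_left algebra_simps sum.distrib)
  also have "(\<Sum>i<m. rat_fps (P Q k i) * (rat_fps T * fps_deriv (f i))) =
      (\<Sum>i<m. \<Sum>j<m. rat_fps (P Q k i) * rat_fps (numer_entry T A i j) * f j)"
    by (intro sum.cong refl) (simp add: system sum_distrib_left mult.assoc)
  also have "\<dots> = (\<Sum>j<m. (\<Sum>i<m. rat_fps (numer_entry T A i j) * rat_fps (P Q k i)) * f j)"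
    by (subst sum.swap) (simp add: sum_distrib_left sum_distrib_right mult_ac)
  finally show ?thesis
    by (simp add: linear_form_def rat_fps_add rat_fps_sum rat_fps_mult rat_fps_pderiv
        distrib_right sum.distrib)
qed

lemma norm_le_square:
  assumes "degree p \<le> q" "\<And>l. \<bar>coeff p l\<bar> \<le> int Z"
  shows "coeff_sum_norm p \<le> int Z ^ 2"
proof -
  have "coeff_sum_norm p \<le> (int q + 1) * int Z" by (rule coeff_sum_norm_le) (use assms in auto)
  also have "\<dots> \<le> int Z * int Z" using Z by (intro mult_right_mono) auto
  finally show ?thesis by (simp add: power2_eq_square)
qed

lemma degree_shidlovskii_poly_le:
  assumes "\<And>i. i < m \<Longrightarrow> degree (Q i) \<le> n" "i < m"
  shows "degree (P Q k i) \<le> n + k * q"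
  using assms(2)
proof (induction k arbitrary: i)
  case (Suc k)
  have "degree (T * pderiv (P Q k i)) \<le> n + Suc k * q"
    using degree_mult_le[of T "pderiv (P Q k i)"] degree_T Suc.IH[OF Suc.prems] degree_pderiv[of "P Q k i"]
    by simp
  moreover have "degree (\<Sum>j<m. numer_entry T A j i * P Q k j) \<le> n + Suc k * q"
  proof (intro degree_sum_le)
    fix j assume "j \<in> {..<m}"
    hence j: "j < m" by simp
    show "degree (numer_entry T A j i * P Q k j) \<le> n + Suc k * q"
      using degree_mult_le[of "numer_entry T A j i" "P Q k j"] degree_numer[OF j Suc.prems] Suc.IH[OF j] by simp
  qed simp
  ultimately show ?case by (simp add: degree_add_le)
qed (use assms in auto)

text \<open>Each step multiplies the norm by at most \<open>Z\<^sup>2\<close> times \<open>n + L q + m\<close>, for the degree of the polynomials and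
the number of terms in the system; the hypothesis on \<open>L\<close> turns this into \<open>Z\<^sup>3 n\<close>.\<close>

lemma coeff_sum_norm_shidlovskii_poly_le:
  assumes deg: "\<And>i. i < m \<Longrightarrow> degree (Q i) \<le> n" and norm: "\<And>i. i < m \<Longrightarrow> coeff_sum_norm (Q i) \<le> b"
    and L: "n + L * q + m \<le> 3 * n" and k: "k \<le> L" and i: "i < m"
  shows "coeff_sum_norm (P Q k i) \<le> b * (int Z ^ 3 * int n) ^ k"
  using k i
proof (induction k arbitrary: i)
  case (Suc k)
  define N where "N = b * (int Z ^ 3 * int n) ^ k"
  have IH: "coeff_sum_norm (P Q k j) \<le> N" if "j < m" for j
    using Suc.IH[of j] Suc.prems(1) that by (simp add: N_def)
  have N: "0 \<le> N" using order_trans[OF coeff_sum_norm_nonneg IH[OF Suc.prems(2)]] .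
  have T: "coeff_sum_norm T \<le> int Z ^ 2" by (intro norm_le_square degree_T height_T)
  have "coeff_sum_norm (T * pderiv (P Q k i)) \<le> coeff_sum_norm T * coeff_sum_norm (pderiv (P Q k i))"
    by (rule coeff_sum_norm_mult)
  also have "\<dots> \<le> int Z ^ 2 * (int (n + L * q) * N)"
  proof (intro mult_mono T)
    have "degree (P Q k i) \<le> n + k * q" by (rule degree_shidlovskii_poly_le[OF deg Suc.prems(2)])
    also have "\<dots> \<le> n + L * q" using Suc.prems(1) by (intro add_left_mono mult_right_mono) auto
    finally have "int (degree (P Q k i)) * coeff_sum_norm (P Q k i) \<le> int (n + L * q) * N"
      using N by (intro mult_mono IH Suc.prems) (simp_all del: of_nat_add of_nat_mult)
    with coeff_sum_norm_pderiv[of "P Q k i"] show "coeff_sum_norm (pderiv (P Q k i)) \<le> int (n + L * q) * N"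
      by linarith
  qed auto
  finally have 1: "coeff_sum_norm (T * pderiv (P Q k i)) \<le> int Z ^ 2 * (int (n + L * q) * N)" .
  have "coeff_sum_norm (\<Sum>j<m. numer_entry T A j i * P Q k j) \<le>
      (\<Sum>j<m. coeff_sum_norm (numer_entry T A j i * P Q k j))"
    by (rule coeff_sum_norm_sum)
  also have "\<dots> \<le> (\<Sum>j<m. int Z ^ 2 * N)"
  proof (rule sum_mono)
    fix j assume "j \<in> {..<m}"
    hence j: "j < m" by simp
    have "coeff_sum_norm (numer_entry T A j i) \<le> int Z ^ 2"
      by (intro norm_le_square degree_numer height_numer j Suc.prems)
    hence "coeff_sum_norm (numer_entry T A j i) * coeff_sum_norm (P Q k j) \<le> int Z ^ 2 * N"
      by (intro mult_mono IH j) auto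
    with coeff_sum_norm_mult show "coeff_sum_norm (numer_entry T A j i * P Q k j) \<le> int Z ^ 2 * N"
      by (rule order_trans)
  qed
  also have "\<dots> = int Z ^ 2 * (int m * N)" by simp
  finally have "coeff_sum_norm (P Q (Suc k) i) \<le> int Z ^ 2 * (int (n + L * q) * N) + int Z ^ 2 * (int m * N)"
    using 1 coeff_sum_norm_add[of "T * pderiv (P Q k i)" "\<Sum>j<m. numer_entry T A j i * P Q k j"] by simp
  also have "\<dots> = int Z ^ 2 * N * int (n + L * q + m)" by (simp add: algebra_simps)
  also have "\<dots> \<le> int Z ^ 2 * N * int (3 * n)" using L N by (intro mult_left_mono) (auto simp del: of_nat_add of_nat_mult)
  also have "\<dots> \<le> int Z ^ 2 * N * (int Z * int n)" using Z N by (intro mult_left_mono) (auto intro: mult_right_mono)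
  also have "\<dots> = b * (int Z ^ 3 * int n) ^ Suc k" by (simp add: N_def power3_eq_cube power2_eq_square mult_ac)
  finally show ?case .
qed (use norm in auto)

lemma linear_form_eq_0:
  assumes "\<And>l. l < M \<Longrightarrow> fps_nth (linear_form Q 0) l = 0" "l + k < M"
  shows "fps_nth (linear_form Q k) l = 0"
  using assms(2)
proof (induction k arbitrary: l)
  case (Suc k)
  hence "fps_nth (linear_form Q k) (l - j + 1) = 0" for j by (intro Suc.IH) simp
  thus ?case by (simp add: linear_form_Suc fps_mult_nth)
qed (use assms in auto)

text \<open>The powers of \<open>l\<close> that come from multiplying by \<open>T\<close> accumulate to the exponent \<open>q k\<close>. They are harmless
because \<open>k\<close> will be a small fraction of \<open>n\<close>.\<close>

lemma abs_nth_linear_form_le: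
  assumes "\<And>l. \<bar>fps_nth (linear_form Q 0) l\<bar> * fact l \<le> c * X ^ l" "1 \<le> X"
  shows "\<bar>fps_nth (linear_form Q k) l\<bar> * fact l \<le> c * of_nat Z ^ (2 * k) * of_nat (l + k) ^ (q * k) * X ^ (l + k)"
proof (induction k arbitrary: l)
  case (Suc k)
  have c: "0 \<le> c" using assms(1)[of 0] by (simp add: order_trans[OF abs_ge_zero])
  define w where "w l = c * of_nat Z ^ (2 * k) * of_nat (l + k) ^ (q * k) * X ^ (l + k)" for l
  have w: "mono w"
    unfolding w_def using c assms(2)
    by (intro monoI mult_mono mult_nonneg_nonneg power_mono power_increasing mult_left_mono) auto
  have w0: "0 \<le> w l" for l unfolding w_def using c assms(2) by simp
  have "\<bar>fps_nth (linear_form Q (Suc k)) l\<bar> * fact l \<le>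
      of_int (coeff_sum_norm T) * of_nat (Suc l) ^ q * w (Suc l)"
    unfolding linear_form_Suc
    by (rule abs_nth_poly_times_deriv_le[OF degree_T _ w]) (use Suc.IH in \<open>simp add: w_def\<close>)
  also have "\<dots> \<le> of_int (int Z ^ 2) * of_nat (Suc l + k) ^ q * w (Suc l)"
    by (intro mult_right_mono mult_mono power_mono w0)
      (use norm_le_square[OF degree_T height_T] in \<open>simp_all only: of_int_le_iff\<close>, simp_all)
  also have "\<dots> = c * of_nat Z ^ (2 * Suc k) * of_nat (l + Suc k) ^ (q * Suc k) * X ^ (l + Suc k)"
    by (simp add: w_def power_add power2_eq_square mult_ac)
  finally show ?case .
qed (use assms in auto)

text \<open>Writing the unknown coefficients as \<open>n! x\<^sub>i\<^sub>k / k!\<close> turns the coefficient of \<open>z\<^sup>l\<close> in the form into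
\<open>n!/l!\<close> times \<open>\<Sum> (l choose k) \<phi>\<^sub>i\<^sub>,\<^sub>l\<^sub>-\<^sub>k x\<^sub>i\<^sub>k\<close>, where \<open>\<phi>\<^sub>i\<^sub>,\<^sub>l\<close> is the Taylor coefficient of \<open>f\<^sub>i\<close> without its
factorial. After multiplication by a common denominator the equations therefore have integer
coefficients of merely exponential size, and so have the solutions that Siegel's lemma provides.\<close>

lemma exists_auxiliary_form:
  fixes n M h :: nat
  assumes n: "1 \<le> n" and M: "M < m * (n + 1)" and h: "M < h * (m * (n + 1) - M)"
  defines "Y \<equiv> (2 * (m * (n + 1)) * Z ^ ((m + 2) * (m * (n + 1)))) ^ h"
  shows "\<exists>Q. (\<forall>i<m. degree (Q i) \<le> n \<and> coeff_sum_norm (Q i) \<le> int ((n + 1) * fact n * Y)) \<and>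
    (\<exists>i<m. Q i \<noteq> 0) \<and> (\<forall>l<M. fps_nth (linear_form Q 0) l = 0) \<and>
    (\<forall>l. \<bar>fps_nth (linear_form Q 0) l\<bar> * fact l \<le> of_nat (fact n * Y * (m * Z)) * of_nat (Z ^ 2) ^ l)"
proof -
  define I where "I = {..<m} \<times> {..n}"
  define co where "co l = (\<lambda>(i, k). of_nat (l choose k) * egf_coeff (f i) (l - k))" for l
  obtain d where d: "\<And>i l. i < m \<Longrightarrow> 0 < d i l \<and> d i l \<le> Z ^ (l + 1) \<and> (\<forall>k\<le>l. of_nat (d i l) * egf_coeff (f i) k \<in> \<int>)"
    using common_denominators by metis
  define D where "D l = (\<Prod>i<m. d i l)" for l
  have D: "0 < D l" "D l \<le> Z ^ (m * (l + 1))" for l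
  proof -
    show "0 < D l" unfolding D_def using d by (intro prod_pos) auto
    have "D l \<le> (\<Prod>i<m. Z ^ (l + 1))" unfolding D_def using d by (intro prod_mono) auto
    also have "\<dots> = Z ^ (m * (l + 1))" by (simp only: prod_constant card_lessThan mult.commute[of m] power_mult)
    finally show "D l \<le> Z ^ (m * (l + 1))" .
  qed
  define c where "c l x = \<lfloor>of_nat (D l) * co l x\<rfloor>" for l x
  have c: "of_int (c l x) = of_nat (D l) * co l x" if x: "x \<in> I" for l x
  proof -
    obtain i k where ik: "x = (i, k)" "i < m" using x by (auto simp: I_def)
    have "of_nat (d i l) * egf_coeff (f i) (l - k) \<in> \<int>" using d[OF ik(2)] by simp
    hence "of_nat ((\<Prod>j\<in>{..<m} - {i}. d j l) * (l choose k)) * (of_nat (d i l) * egf_coeff (f i) (l - k)) \<in> \<int>"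
      by (rule Ints_mult[OF Ints_of_nat])
    also have "of_nat ((\<Prod>j\<in>{..<m} - {i}. d j l) * (l choose k)) * (of_nat (d i l) * egf_coeff (f i) (l - k)) = of_nat (D l) * co l x"
      unfolding D_def using ik by (subst (2) prod.remove[of _ i]) (simp_all add: co_def mult_ac)
    finally show ?thesis unfolding c_def by (metis Ints_cases floor_of_int)
  qed
  have co: "\<bar>co l (i, k)\<bar> \<le> of_nat (l choose k) * of_nat Z ^ (l + 1)" if "i < m" for l i k
  proof -
    have "\<bar>egf_coeff (f i) (l - k)\<bar> \<le> of_nat Z ^ (l - k + 1)" by (rule egf_coeff_le[OF that])
    also have "\<dots> \<le> of_nat Z ^ (l + 1)" using Z by (intro power_increasing) auto
    finally show ?thesis by (simp add: co_def abs_mult mult_left_mono)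
  qed
  have "\<exists>x :: nat \<times> nat \<Rightarrow> int. (\<exists>ik\<in>I. x ik \<noteq> 0) \<and> (\<forall>l<M. (\<Sum>ik\<in>I. c l ik * x ik) = 0) \<and>
      (\<forall>ik\<in>I. \<bar>x ik\<bar> \<le> int ((2 * (m * (n + 1)) * Z ^ ((m + 2) * (m * (n + 1)))) ^ h))"
  proof (rule siegel_lemma)
    show "finite I" "card I = m * (n + 1)" by (auto simp: I_def)
    fix l ik assume l: "l < M" and ik: "ik \<in> I"
    then obtain i k where [simp]: "ik = (i, k)" and i: "i < m" by (auto simp: I_def)
    have "of_int \<bar>c l ik\<bar> = of_nat (D l) * \<bar>co l ik\<bar>" using c[OF ik] by (simp add: abs_mult)
    also have "\<dots> \<le> of_nat (Z ^ (m * (l + 1))) * (of_nat (l choose k) * of_nat Z ^ (l + 1))"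
      using D[of l] co[OF i, of l k] by (intro mult_mono) (simp_all only: of_nat_le_iff, simp_all)
    also have "\<dots> = of_nat (Z ^ (m * (l + 1)) * ((l choose k) * Z ^ (l + 1)))" by simp
    finally have "\<bar>c l ik\<bar> \<le> int (Z ^ (m * (l + 1)) * ((l choose k) * Z ^ (l + 1)))"
      by (metis of_int_le_iff of_int_of_nat_eq)
    also have "Z ^ (m * (l + 1)) * ((l choose k) * Z ^ (l + 1)) \<le> Z ^ (m * (l + 1)) * (Z ^ (l + 1) * Z ^ (l + 1))"
    proof (intro mult_left_mono mult_right_mono)
      have "l choose k \<le> 2 ^ l" by (rule binomial_le_pow2)
      also have "\<dots> \<le> Z ^ l" using Z by (intro power_mono) auto
      also have "\<dots> \<le> Z ^ (l + 1)" using Z by (intro power_increasing) auto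
      finally show "l choose k \<le> Z ^ (l + 1)" .
    qed auto
    also have "\<dots> = Z ^ ((m + 2) * (l + 1))" by (simp add: algebra_simps flip: power_add)
    also have "\<dots> \<le> Z ^ ((m + 2) * (m * (n + 1)))" using l M Z by (intro power_increasing mult_left_mono) auto
    finally show "\<bar>c l ik\<bar> \<le> int (Z ^ ((m + 2) * (m * (n + 1))))" by simp
  qed (use M h Z in auto)
  then obtain x where x: "\<exists>ik\<in>I. x ik \<noteq> 0" "\<And>l. l < M \<Longrightarrow> (\<Sum>ik\<in>I. c l ik * x ik) = 0"
    "\<And>ik. ik \<in> I \<Longrightarrow> \<bar>x ik\<bar> \<le> int Y" unfolding Y_def by blast
  define Q where "Q i = (\<Sum>k\<le>n. monom ((fact n div fact k) * x (i, k)) k)" for i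
  have Q: "coeff (Q i) k = (if k \<le> n then (fact n div fact k) * x (i, k) else 0)" for i k
    by (simp add: Q_def coeff_sum)
  have div_le: "fact n div fact k \<le> (fact n :: int)" for k
    using zdiv_mono2[of "fact n" 1 "fact k"] by (simp add: fact_ge_1)
  have nth: "fps_nth (linear_form Q 0) l = fact n / fact l * (\<Sum>ik\<in>I. co l ik * of_int (x ik))" for l
  proof -
    have "fps_nth (rat_fps (Q i) * f i) l = (\<Sum>k\<le>n. fact n / fact l * (co l (i, k) * of_int (x (i, k))))" for i
    proof -
      have "fps_nth (rat_fps (Q i) * f i) l = (\<Sum>k\<le>l. of_int (coeff (Q i) k) * fps_nth (f i) (l - k))"
        by (simp add: fps_mult_nth atLeast0AtMost coeff_map_poly)
      also have "\<dots> = (\<Sum>k\<in>{..l} \<inter> {..n}. of_int (coeff (Q i) k) * fps_nth (f i) (l - k))"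
        by (intro sum.mono_neutral_right) (auto simp: Q)
      also have "\<dots> = (\<Sum>k\<in>{..l} \<inter> {..n}. fact n / fact l * (co l (i, k) * of_int (x (i, k))))"
      proof (intro sum.cong refl)
        fix k assume "k \<in> {..l} \<inter> {..n}"
        hence k: "k \<le> l" "k \<le> n" by auto
        have "(of_int (fact n div fact k) :: rat) = fact n / fact k"
          using fact_dvd[OF k(2), where 'a = int] by (simp add: of_int_div)
        moreover have "(of_nat (l choose k) :: rat) = fact l / (fact k * fact (l - k))"
          by (rule binomial_fact[OF k(1)])
        ultimately show "of_int (coeff (Q i) k) * fps_nth (f i) (l - k) = fact n / fact l * (co l (i, k) * of_int (x (i, k)))"
          using k by (simp add: Q co_def egf_coeff_def)
      qed
      also have "\<dots> = (\<Sum>k\<le>n. fact n / fact l * (co l (i, k) * of_int (x (i, k))))"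
        by (intro sum.mono_neutral_left) (auto simp: co_def binomial_eq_0)
      finally show ?thesis .
    qed
    thus ?thesis
      by (simp add: linear_form_def fps_sum_nth I_def sum.cartesian_product sum_distrib_left split_def)
  qed
  show ?thesis
  proof (intro exI[of _ Q] conjI allI impI)
    fix i assume i: "i < m"
    show deg: "degree (Q i) \<le> n" by (intro degree_le) (simp add: Q)
    have "coeff_sum_norm (Q i) \<le> (int n + 1) * (fact n * int Y)"
    proof (rule coeff_sum_norm_le[OF _ deg])
      fix k
      show "\<bar>coeff (Q i) k\<bar> \<le> fact n * int Y"
      proof (cases "k \<le> n")
        case True
        hence "\<bar>x (i, k)\<bar> \<le> int Y" using x(3)[of "(i, k)"] i by (simp add: I_def)
        hence "\<bar>fact n div fact k\<bar> * \<bar>x (i, k)\<bar> \<le> fact n * int Y"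
          using div_le[of k] by (intro mult_mono) (auto simp: pos_imp_zdiv_nonneg_iff abs_of_nonneg)
        with True show ?thesis by (simp add: Q abs_mult)
      qed (simp add: Q)
    qed
    thus "coeff_sum_norm (Q i) \<le> int ((n + 1) * fact n * Y)" by (simp add: algebra_simps)
  next
    obtain i k where ik: "i < m" "k \<le> n" "x (i, k) \<noteq> 0" using x(1) by (auto simp: I_def)
    have "fact n div fact k \<noteq> (0 :: int)"
      using fact_dvd[OF ik(2), where 'a = int] by (metis dvd_div_eq_0_iff fact_nonzero)
    hence "coeff (Q i) k \<noteq> 0" using ik by (simp add: Q)
    thus "\<exists>i<m. Q i \<noteq> 0" using ik(1) by (metis coeff_0)
  next
    fix l assume "l < M"
    have "of_nat (D l) * (\<Sum>ik\<in>I. co l ik * of_int (x ik)) = of_int (\<Sum>ik\<in>I. c l ik * x ik)"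
      by (simp add: sum_distrib_left c mult.assoc)
    also have "\<dots> = 0" using x(2)[OF \<open>l < M\<close>] by simp
    finally show "fps_nth (linear_form Q 0) l = 0" unfolding nth using D(1)[of l] by simp
  next
    fix l
    have "\<bar>\<Sum>ik\<in>I. co l ik * of_int (x ik)\<bar> \<le> (\<Sum>ik\<in>I. \<bar>co l ik * of_int (x ik)\<bar>)" by (rule sum_abs)
    also have "\<dots> \<le> (\<Sum>ik\<in>I. of_nat (l choose (snd ik)) * of_nat Z ^ (l + 1) * of_nat Y)"
    proof (rule sum_mono)
      fix ik assume ik: "ik \<in> I"
      have "\<bar>rat_of_int (x ik)\<bar> \<le> of_nat Y" using x(3)[OF ik]
        by (metis of_int_abs of_int_le_iff of_int_of_nat_eq)
      thus "\<bar>co l ik * of_int (x ik)\<bar> \<le> of_nat (l choose (snd ik)) * of_nat Z ^ (l + 1) * of_nat Y"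
        unfolding abs_mult using co[of "fst ik" l "snd ik"] ik by (intro mult_mono) (auto simp: I_def)
    qed
    also have "\<dots> = of_nat (m * (\<Sum>k\<le>n. l choose k) * Z ^ (l + 1) * Y)"
      by (simp add: I_def sum.cartesian_product' sum_distrib_right sum_distrib_left mult.assoc)
    also have "(\<Sum>k\<le>n. l choose k) \<le> 2 ^ l"
    proof -
      have "(\<Sum>k\<le>n. l choose k) \<le> (\<Sum>k\<le>max n l. l choose k)" by (intro sum_mono2) auto
      also have "\<dots> = (\<Sum>k\<le>l. l choose k)" by (intro sum.mono_neutral_right) (auto simp: binomial_eq_0)
      finally show ?thesis by (simp add: choose_row_sum)
    qed
    also have "(2 :: nat) ^ l \<le> Z ^ l" using Z by (intro power_mono) auto
    finally have *: "\<bar>\<Sum>ik\<in>I. co l ik * of_int (x ik)\<bar> \<le> of_nat (m * Z ^ l * Z ^ (l + 1) * Y)"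
      by (simp add: mult_left_mono mult_right_mono)
    have "\<bar>fps_nth (linear_form Q 0) l\<bar> * fact l = fact n * \<bar>\<Sum>ik\<in>I. co l ik * of_int (x ik)\<bar>"
      by (simp add: nth abs_mult)
    also have "\<dots> \<le> fact n * of_nat (m * Z ^ l * Z ^ (l + 1) * Y)" by (intro mult_left_mono *) auto
    also have "\<dots> = of_nat (fact n * Y * (m * Z)) * of_nat (Z ^ 2) ^ l"
      by (simp add: power2_eq_square power_mult_distrib mult_ac)
    finally show "\<bar>fps_nth (linear_form Q 0) l\<bar> * fact l \<le> of_nat (fact n * Y * (m * Z)) * of_nat (Z ^ 2) ^ l" .
  qed
qed

end

section \<open>Values at a rational point\<close>

lemma abs_of_rat: "real_of_rat \<bar>x\<bar> = \<bar>real_of_rat x\<bar>"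
  by (simp add: abs_if of_rat_minus)

lemma of_rat_fact: "(of_rat (fact n) :: 'a :: field_char_0) = fact n"
  by (metis of_nat_fact of_rat_of_nat_eq)

definition real_fps :: "rat fps \<Rightarrow> real fps" where
  "real_fps F = Abs_fps (\<lambda>n. of_rat (fps_nth F n))"

lemma real_fps_nth [simp]: "fps_nth (real_fps F) n = of_rat (fps_nth F n)"
  by (simp add: real_fps_def)

lemma real_fps_add: "real_fps (F + G) = real_fps F + real_fps G"
  by (rule fps_ext) (simp add: of_rat_add)

lemma real_fps_mult: "real_fps (F * G) = real_fps F * real_fps G"
  by (rule fps_ext) (simp add: fps_mult_nth of_rat_sum of_rat_mult)

lemma real_fps_rat_fps: "real_fps (rat_fps p) = fps_of_poly (map_poly of_int p)"
  by (rule fps_ext) (simp add: coeff_map_poly)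

lemma E_value_eq: "E_value F x = eval_fps (real_fps F) (of_rat x)"
  by (simp add: E_value_def real_fps_def)

lemma fps_conv_radius_real_fps:
  fixes c :: nat
  assumes F: "\<And>l. \<bar>egf_coeff F l\<bar> \<le> of_nat c ^ (l + 1)"
  shows "fps_conv_radius (real_fps F) = \<infinity>"
proof -
  have "summable (\<lambda>n. fps_nth (real_fps F) n * of_real r ^ n)" if "0 < r" for r :: real
  proof (rule summable_comparison_test')
    show "summable (\<lambda>n. c * ((c * r) ^ n /\<^sub>R fact n))"
      by (intro summable_mult summable_exp_generic)
    fix n
    have "\<bar>fps_nth F n\<bar> * fact n \<le> of_nat c ^ (n + 1)"
      using F[of n] by (simp add: egf_coeff_def abs_mult)
    hence "of_rat (\<bar>fps_nth F n\<bar> * fact n) \<le> (of_rat (of_nat c ^ (n + 1)) :: real)"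
      by (simp only: of_rat_less_eq)
    hence "\<bar>real_of_rat (fps_nth F n)\<bar> * fact n \<le> real c ^ (n + 1)"
      by (simp only: of_rat_mult of_rat_power abs_of_rat of_rat_of_nat_eq of_rat_fact)
    hence "\<bar>real_of_rat (fps_nth F n)\<bar> \<le> real c ^ (n + 1) / fact n"
      by (simp add: field_simps)
    hence "\<bar>real_of_rat (fps_nth F n)\<bar> * r ^ n \<le> real c ^ (n + 1) / fact n * r ^ n"
      using that by (intro mult_right_mono) auto
    thus "norm (fps_nth (real_fps F) n * of_real r ^ n) \<le> c * ((c * r) ^ n /\<^sub>R fact n)"
      using that by (simp add: abs_mult power_mult_distrib field_simps)
  qed
  hence "\<infinity> \<le> fps_conv_radius (real_fps F)"
    unfolding fps_conv_radius_def by (intro conv_radius_geI_ex')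
  thus ?thesis by simp
qed

lemma E_value_linear_combination:
  assumes "finite I" "\<And>i. i \<in> I \<Longrightarrow> fps_conv_radius (real_fps (f i)) = \<infinity>"
  shows "E_value (\<Sum>i\<in>I. rat_fps (p i) * f i) x =
    (\<Sum>i\<in>I. poly (map_poly of_int (p i)) (of_rat x) * E_value (f i) x)"
proof -
  have prod: "fps_conv_radius (real_fps (rat_fps (p i) * f i)) = \<infinity>" if "i \<in> I" for i
    using fps_conv_radius_mult[of "real_fps (rat_fps (p i))" "real_fps (f i)"] assms(2)[OF that]
    by (simp add: real_fps_mult real_fps_rat_fps)
  have "fps_conv_radius (real_fps (\<Sum>i\<in>J. rat_fps (p i) * f i)) = \<infinity> \<and>
      E_value (\<Sum>i\<in>J. rat_fps (p i) * f i) x = (\<Sum>i\<in>J. E_value (rat_fps (p i) * f i) x)"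
    if "J \<subseteq> I" for J
    using finite_subset[OF that assms(1)] that
  proof (induction J rule: finite_induct)
    case empty
    have "real_fps 0 = 0" by (rule fps_ext) simp
    thus ?case by (simp add: E_value_eq)
  next
    case (insert j J)
    hence IH: "fps_conv_radius (real_fps (\<Sum>i\<in>J. rat_fps (p i) * f i)) = \<infinity>"
      "E_value (\<Sum>i\<in>J. rat_fps (p i) * f i) x = (\<Sum>i\<in>J. E_value (rat_fps (p i) * f i) x)"
      and j: "fps_conv_radius (real_fps (rat_fps (p j) * f j)) = \<infinity>" using prod by auto
    from IH(1) j have "fps_conv_radius (real_fps (rat_fps (p j) * f j) + real_fps (\<Sum>i\<in>J. rat_fps (p i) * f i)) = \<infinity>"
      using fps_conv_radius_add[of "real_fps (rat_fps (p j) * f j)" "real_fps (\<Sum>i\<in>J. rat_fps (p i) * f i)"] by simp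
    moreover have "eval_fps (real_fps (rat_fps (p j) * f j) + real_fps (\<Sum>i\<in>J. rat_fps (p i) * f i)) (of_rat x) =
        E_value (rat_fps (p j) * f j) x + E_value (\<Sum>i\<in>J. rat_fps (p i) * f i) x"
      unfolding E_value_eq using IH(1) j by (intro eval_fps_add) auto
    ultimately show ?case using insert.hyps IH(2) by (simp add: real_fps_add E_value_eq)
  qed
  from this[of I] have "E_value (\<Sum>i\<in>I. rat_fps (p i) * f i) x = (\<Sum>i\<in>I. E_value (rat_fps (p i) * f i) x)" by simp
  also have "\<dots> = (\<Sum>i\<in>I. poly (map_poly of_int (p i)) (of_rat x) * E_value (f i) x)"
    using assms(2) by (intro sum.cong refl) (simp add: E_value_eq real_fps_mult real_fps_rat_fps eval_fps_mult)
  finally show ?thesis .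
qed

lemma power_le_fact_mult_exp:
  fixes x :: real
  assumes "0 \<le> x"
  shows "x ^ n \<le> fact n * exp x"
proof -
  have "(\<Sum>k\<in>{n}. x ^ k /\<^sub>R fact k) \<le> (\<Sum>k. x ^ k /\<^sub>R fact k)"
    using assms by (intro sum_le_suminf summable_exp_generic) auto
  hence "x ^ n / fact n \<le> exp x" by (simp add: exp_def divide_inverse mult.commute)
  thus ?thesis by (simp add: field_simps)
qed

lemma exp_nat_le: "exp (real n) \<le> 3 ^ n"
proof -
  have "exp (real n) = exp 1 ^ n" using exp_of_nat_mult[of n 1] by simp
  also have "\<dots> \<le> 3 ^ n" by (intro power_mono exp_le) simp
  finally show ?thesis .
qed

text \<open>The polynomial factor is removed by \<open>(l + k)\<^sup>N \<le> N! e\<^sup>l\<^sup>+\<^sup>k\<close>; what remains is a tail of the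
exponential series, bounded by its first term times \<open>exp (3 X z)\<close>.\<close>

lemma abs_E_value_le:
  fixes c X z N k y :: nat
  assumes bound: "\<And>l. \<bar>fps_nth F l\<bar> * fact l \<le> of_nat c * of_nat (l + k) ^ N * of_nat X ^ (l + k)"
    and zero: "\<And>l. l < y \<Longrightarrow> fps_nth F l = 0" and z: "\<bar>x\<bar> \<le> of_nat z"
  shows "\<bar>E_value F x\<bar> \<le> c * fact N * (3 * X) ^ k * (real (3 * X * z) ^ y / fact y) * 3 ^ (3 * X * z)"
proof -
  define B :: real where "B = c * fact N * (3 * X) ^ k"
  define G where "G = 3 * X * z"
  define u where "u l = real_of_rat (fps_nth F l) * of_rat x ^ l" for l
  have B: "0 \<le> B" by (simp add: B_def)
  have u: "\<bar>u l\<bar> \<le> B * (real G ^ l / fact l)" for l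
  proof -
    have "of_rat (\<bar>fps_nth F l\<bar> * fact l) \<le> (of_rat (of_nat c * of_nat (l + k) ^ N * of_nat X ^ (l + k)) :: real)"
      using bound[of l] by (simp only: of_rat_less_eq)
    hence "\<bar>real_of_rat (fps_nth F l)\<bar> * fact l \<le> real c * real (l + k) ^ N * real X ^ (l + k)"
      by (simp only: of_rat_mult of_rat_power abs_of_rat of_rat_of_nat_eq of_rat_fact)
    also have "\<dots> \<le> real c * (fact N * 3 ^ (l + k)) * real X ^ (l + k)"
    proof (intro mult_right_mono mult_left_mono)
      have "real (l + k) ^ N \<le> fact N * exp (real (l + k))" by (rule power_le_fact_mult_exp) simp
      also have "\<dots> \<le> fact N * 3 ^ (l + k)" by (intro mult_left_mono exp_nat_le) auto
      finally show "real (l + k) ^ N \<le> fact N * 3 ^ (l + k)" .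
    qed auto
    also have "\<dots> = B * real (3 * X) ^ l"
      by (simp add: B_def power_add power_mult_distrib mult_ac)
    finally have 1: "\<bar>real_of_rat (fps_nth F l)\<bar> \<le> B * real (3 * X) ^ l / fact l"
      by (simp add: field_simps)
    have "\<bar>real_of_rat x\<bar> \<le> real z"
      using z by (metis abs_of_rat of_rat_less_eq of_rat_of_nat_eq)
    hence "\<bar>u l\<bar> \<le> (B * real (3 * X) ^ l / fact l) * real z ^ l"
      unfolding u_def abs_mult power_abs by (intro mult_mono 1 power_mono) (use B in auto)
    thus ?thesis by (simp add: G_def power_mult_distrib mult_ac)
  qed
  have sG: "summable (\<lambda>l. B * (real G ^ l / fact l))"
    using summable_exp_generic[of "real G"] by (intro summable_mult) (simp add: divide_inverse mult.commute)
  have su: "summable u" by (rule summable_comparison_test'[OF sG]) (use u in auto)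
  have "E_value F x = (\<Sum>l. u l)" by (simp add: E_value_eq eval_fps_def u_def)
  also have "\<dots> = (\<Sum>l. u (l + y)) + (\<Sum>l<y. u l)" by (rule suminf_split_initial_segment[OF su])
  also have "(\<Sum>l<y. u l) = 0" using zero by (simp add: u_def)
  finally have E: "E_value F x = (\<Sum>l. u (l + y))" by simp
  have u': "norm (u (l + y)) \<le> B * (real G ^ y / fact y) * (real G ^ l /\<^sub>R fact l)" for l
  proof -
    have "fact l * fact y \<le> (fact (l + y) :: real)"
      using fact_fact_dvd_fact[of l y, where 'a = nat] by (metis dvd_imp_le fact_gt_zero of_nat_fact of_nat_le_iff of_nat_mult)
    hence "real G ^ (l + y) / fact (l + y) \<le> real G ^ (l + y) / (fact l * fact y)"
      by (intro divide_left_mono) auto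
    hence "B * (real G ^ (l + y) / fact (l + y)) \<le> B * (real G ^ (l + y) / (fact l * fact y))"
      using B by (rule mult_left_mono)
    moreover have "B * (real G ^ (l + y) / (fact l * fact y)) = B * (real G ^ y / fact y) * (real G ^ l /\<^sub>R fact l)"
      by (simp add: power_add field_simps)
    ultimately show ?thesis using u[of "l + y"] unfolding real_norm_def by linarith
  qed
  have sG': "summable (\<lambda>l. B * (real G ^ y / fact y) * (real G ^ l /\<^sub>R fact l))"
    by (intro summable_mult summable_exp_generic)
  have "\<bar>E_value F x\<bar> \<le> (\<Sum>l. B * (real G ^ y / fact y) * (real G ^ l /\<^sub>R fact l))"
    unfolding E using norm_suminf_le[OF u' sG'] by simp
  also have "\<dots> = B * (real G ^ y / fact y) * exp (real G)"
    using summable_exp_generic[of "real G"] by (subst suminf_mult) (simp_all add: exp_def)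
  also have "\<dots> \<le> B * (real G ^ y / fact y) * 3 ^ G"
    using B by (intro mult_left_mono exp_nat_le) auto
  finally show ?thesis by (simp add: B_def G_def)
qed

context bounded_E_system
begin

lemma E_value_linear_form:
  "E_value (linear_form Q k) x = (\<Sum>i<m. poly (map_poly of_int (P Q k i)) (of_rat x) * E_value (f i) x)"
  unfolding linear_form_def
  by (rule E_value_linear_combination) (auto intro: fps_conv_radius_real_fps[OF egf_coeff_le])

end

section \<open>Growth bounds for the auxiliary forms\<close>

text \<open>The factorial \<open>y!\<close> that makes the forms small will be compared with a power of \<open>n\<close>, even for \<open>y\<close> much
larger than \<open>n\<close>.\<close>

lemma fact_ge_power:
  assumes "n \<le> y"
  shows "n ^ y \<le> 3 ^ n * fact y"
  using assms
proof (induction y rule: dec_induct)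
  case base
  have "real n ^ n \<le> fact n * exp (real n)" by (rule power_le_fact_mult_exp) simp
  also have "\<dots> \<le> fact n * 3 ^ n" by (intro mult_left_mono exp_nat_le) auto
  finally have "real (n ^ n) \<le> real (3 ^ n * fact n)" by (simp add: mult.commute)
  thus ?case by (simp only: of_nat_le_iff)
next
  case (step y)
  have "n ^ Suc y \<le> Suc y * (3 ^ n * fact y)"
    using step unfolding power_Suc by (intro mult_mono) auto
  thus ?case by (simp only: fact_Suc of_nat_id mult_ac)
qed

text \<open>The parameter \<open>\<epsilon>\<close> of the zero estimate is \<open>1 / step_size m q\<close>. It has to be below \<open>1/(2m - 1)\<close>, and so small
that the loss from \<open>L \<le> 2 \<epsilon> n\<close> derivations, \<open>n\<close> to the power \<open>(m + q) L\<close>, is at most \<open>n\<^sup>n\<^sup>/\<^sup>4\<close>.\<close>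

definition step_size :: "nat \<Rightarrow> nat \<Rightarrow> nat" where
  "step_size m q = 8 * (m + q)"

text \<open>The solution of Siegel's lemma is bounded by \<open>Z\<close> to the power \<open>siegel_exponent m q * n\<close>: the ratio of equations
to excess unknowns is below \<open>2 m step_size m q\<close>, and twice the number of unknowns times the
bound of the coefficients is at most \<open>Z\<close> to the power \<open>(3 + 2 m (m + 2)) n\<close>.\<close>

definition siegel_exponent :: "nat \<Rightarrow> nat \<Rightarrow> nat" where
  "siegel_exponent m q = 2 * m * step_size m q * (3 + 2 * m * (m + 2))"

text \<open>All factors \<open>Z\<^sup>O\<^sup>(\<^sup>n\<^sup>)\<close> occurring in the final estimate together are at most \<open>Z\<close> to the power
\<open>size_exponent m q * n\<close>.\<close>

definition size_exponent :: "nat \<Rightarrow> nat \<Rightarrow> nat" where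
  "size_exponent m q = m * (siegel_exponent m q + 15)"

context bounded_E_system
begin

abbreviation "step \<equiv> step_size m q"
abbreviation "g \<equiv> siegel_exponent m q"
abbreviation "e1 \<equiv> size_exponent m q"

lemma step_pos: "0 < step"
  using m by (simp add: step_size_def)

text \<open>The number of equations falls short of the number of unknowns by \<open>n div step + 1\<close>, which is proportional to
\<open>n\<close>; this keeps the solution exponential in \<open>n\<close>.\<close>

lemma exists_small_auxiliary_form:
  assumes n: "1 \<le> n" and M: "M = m * (n + 1) - n div step - 1"
  obtains Q where "\<And>i. i < m \<Longrightarrow> degree (Q i) \<le> n" "\<exists>i<m. Q i \<noteq> 0"
    "\<And>i. i < m \<Longrightarrow> coeff_sum_norm (Q i) \<le> int (n ^ n * Z ^ ((g + 1) * n))"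
    "\<And>l. l < M \<Longrightarrow> fps_nth (linear_form Q 0) l = 0"
    "\<And>l. \<bar>fps_nth (linear_form Q 0) l\<bar> * fact l \<le> of_nat (n ^ n * Z ^ ((g + 2) * n)) * of_nat (Z ^ 2) ^ l"
proof -
  define t where "t = n div step"
  define h where "h = 2 * m * step"
  define Y where "Y = (2 * (m * (n + 1)) * Z ^ ((m + 2) * (m * (n + 1)))) ^ h"
  have t: "t \<le> n" by (simp add: t_def)
  have "n < step * (t + 1)"
    using dividend_less_times_div[OF step_pos, of n] by (simp add: t_def)
  have mn: "1 * (n + 1) \<le> m * (n + 1)" using m by (rule mult_right_mono) simp
  have M': "m * (n + 1) - M = t + 1" "M < m * (n + 1)" using t mn unfolding M t_def[symmetric] by auto
  have "m * (n + 1) \<le> 2 * m * n" using n m by (simp add: algebra_simps)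
  also have "\<dots> \<le> 2 * m * (step * (t + 1))" using \<open>n < step * (t + 1)\<close> by (intro mult_left_mono) auto
  finally have hM: "M < h * (m * (n + 1) - M)" unfolding M'(1) h_def mult.assoc using M'(2) by (simp only: mult.assoc)
  have n1: "n + 1 \<le> Z ^ n"
  proof -
    have "n + 1 \<le> 2 ^ n" using less_exp[of n] by linarith
    also have "\<dots> \<le> Z ^ n" using Z by (intro power_mono) auto
    finally show ?thesis .
  qed
  have Y: "Y \<le> Z ^ (g * n)"
  proof -
    have "2 * (m * (n + 1)) * Z ^ ((m + 2) * (m * (n + 1))) \<le> Z ^ 1 * (Z ^ 1 * Z ^ n) * Z ^ ((m + 2) * (m * (2 * n)))"
      using Z n1 n by (intro mult_mono power_increasing) auto
    also have "\<dots> = Z ^ (1 + (1 + n) + (m + 2) * (m * (2 * n)))" by (simp only: power_add)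
    also have "\<dots> \<le> Z ^ ((3 + 2 * m * (m + 2)) * n)"
      using Z n by (intro power_increasing) (auto simp: algebra_simps)
    finally have "Y \<le> (Z ^ ((3 + 2 * m * (m + 2)) * n)) ^ h" unfolding Y_def by (rule power_mono) simp
    also have "\<dots> = Z ^ (g * n)" by (simp only: power_mult[symmetric] siegel_exponent_def h_def mult_ac)
    finally show ?thesis .
  qed
  from exists_auxiliary_form[OF n M'(2) hM, folded Y_def] obtain Q where
    Q: "\<And>i. i < m \<Longrightarrow> degree (Q i) \<le> n" "\<And>i. i < m \<Longrightarrow> coeff_sum_norm (Q i) \<le> int ((n + 1) * fact n * Y)"
    "\<exists>i<m. Q i \<noteq> 0" "\<And>l. l < M \<Longrightarrow> fps_nth (linear_form Q 0) l = 0"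
    "\<And>l. \<bar>fps_nth (linear_form Q 0) l\<bar> * fact l \<le> of_nat (fact n * Y * (m * Z)) * of_nat (Z ^ 2) ^ l"
    by blast
  have fn: "fact n \<le> n ^ n" using fact_le_power[where 'a = nat] by simp
  show thesis
  proof (rule that[OF Q(1,3) _ Q(4)])
    fix i assume "i < m"
    have "(n + 1) * fact n * Y \<le> Z ^ n * n ^ n * Z ^ (g * n)" using n1 fn Y by (intro mult_mono) auto
    also have "\<dots> = n ^ n * Z ^ ((g + 1) * n)" by (simp add: power_add algebra_simps)
    finally have "int ((n + 1) * fact n * Y) \<le> int (n ^ n * Z ^ ((g + 1) * n))" by (simp only: of_nat_le_iff)
    with Q(2)[OF \<open>i < m\<close>] show "coeff_sum_norm (Q i) \<le> int (n ^ n * Z ^ ((g + 1) * n))" by (rule order_trans)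
  next
    fix l
    have "fact n * Y * (m * Z) \<le> n ^ n * Z ^ (g * n) * (Z * Z)" using fn Y Z by (intro mult_mono) auto
    also have "\<dots> = n ^ n * Z ^ (g * n + 2 * 1)" by (simp add: power_add power2_eq_square)
    also have "\<dots> \<le> n ^ n * Z ^ (g * n + 2 * n)" using n Z by (intro mult_left_mono power_increasing add_left_mono) auto
    finally have "fact n * Y * (m * Z) \<le> n ^ n * Z ^ ((g + 2) * n)" by (simp only: distrib_right)
    hence "of_nat (fact n * Y * (m * Z)) * of_nat (Z ^ 2) ^ l \<le>
        (of_nat (n ^ n * Z ^ ((g + 2) * n)) * of_nat (Z ^ 2) ^ l :: rat)"
      by (intro mult_right_mono) (simp_all only: of_nat_le_iff, simp)
    with Q(5)[of l] show "\<bar>fps_nth (linear_form Q 0) l\<bar> * fact l \<le> of_nat (n ^ n * Z ^ ((g + 2) * n)) * of_nat (Z ^ 2) ^ l"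
      by (rule order_trans)
  qed
qed

lemma coeff_sum_norm_shidlovskii_poly_le':
  assumes Q: "\<And>i. i < m \<Longrightarrow> degree (Q i) \<le> n"
    "\<And>i. i < m \<Longrightarrow> coeff_sum_norm (Q i) \<le> int (n ^ n * Z ^ ((g + 1) * n))"
    and L: "4 * ((m + q) * L) \<le> n" "m \<le> L" and k: "k \<le> L" and i: "i < m"
  shows "coeff_sum_norm (P Q k i) \<le> int (n ^ (n + L) * Z ^ ((g + 4) * n))"
proof -
  have "L \<le> m * L" using m by (cases m) auto
  moreover have "4 * (m * L) + 4 * (q * L) \<le> n" using L(1) by (simp only: distrib_left distrib_right)
  ultimately have Ln: "L \<le> n" "L * q \<le> n" "1 \<le> n" using m L(2) mult.commute[of L q] by linarith+
  have "coeff_sum_norm (P Q k i) \<le> int (n ^ n * Z ^ ((g + 1) * n)) * (int Z ^ 3 * int n) ^ k"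
    by (rule coeff_sum_norm_shidlovskii_poly_le[OF Q _ k i]) (use Ln L in auto)
  also have "\<dots> = int (n ^ n * Z ^ ((g + 1) * n) * (Z ^ (3 * k) * n ^ k))"
    by (simp add: power_mult power_mult_distrib)
  also have "\<dots> \<le> int (n ^ n * Z ^ ((g + 1) * n) * (Z ^ (3 * n) * n ^ L))"
    unfolding of_nat_le_iff using k Ln Z by (intro mult_left_mono mult_mono power_increasing) auto
  also have "n ^ n * Z ^ ((g + 1) * n) * (Z ^ (3 * n) * n ^ L) = n ^ (n + L) * Z ^ ((g + 1) * n + 3 * n)"
    by (simp only: power_add mult_ac)
  also have "(g + 1) * n + 3 * n = (g + 4) * n" by (simp add: algebra_simps)
  finally show ?thesis .
qed

text \<open>The form \<open>R\<^sub>k\<close> still vanishes to order \<open>y = M - k \<ge> m n - 2 L\<close>, which gives the gain \<open>1 / y!\<close>. Apart from powers of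
\<open>Z\<^sup>n\<close>, the losses are \<open>n!\<close> from the coefficients and \<open>(q k)!\<close> from the factors \<open>T\<close>. Both sides are
multiplied by \<open>n\<^sup>m\<^sup>n\<close> to avoid quotients.\<close>

lemma abs_E_value_linear_form_le:
  assumes m2: "2 \<le> m" and n: "Z ^ 4 \<le> n" and M: "M = m * (n + 1) - n div step - 1"
    and Q: "\<And>l. l < M \<Longrightarrow> fps_nth (linear_form Q 0) l = 0"
    "\<And>l. \<bar>fps_nth (linear_form Q 0) l\<bar> * fact l \<le> of_nat (n ^ n * Z ^ ((g + 2) * n)) * of_nat (Z ^ 2) ^ l"
    and L: "4 * ((m + q) * L) \<le> n" "n div step \<le> L" and k: "k < L" and x: "\<bar>x\<bar> \<le> of_nat Z"
  shows "\<bar>E_value (linear_form Q k) x\<bar> * real n ^ (m * n) \<le> real (Z ^ ((g + 9 + 8 * m) * n) * n ^ (n + (q + 2) * L))"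
proof -
  define c where "c = n ^ n * Z ^ ((g + 2) * n) * Z ^ (2 * k)"
  define y where "y = M - k"
  have "1 ^ 4 \<le> Z ^ 4" using Z by (intro power_mono) auto
  hence n1: "1 \<le> n" using n by simp
  have "L \<le> m * L" using m by (cases m) auto
  moreover have "4 * (m * L) + 4 * (q * L) \<le> n" using L(1) by (simp only: distrib_left distrib_right)
  ultimately have Ln: "4 * L \<le> n" "q * L \<le> n" by linarith+
  have qk: "q * k \<le> q * L" using k by simp
  have "\<bar>E_value (linear_form Q k) x\<bar> \<le>
      c * fact (q * k) * (3 * Z ^ 2) ^ k * (real (3 * Z ^ 2 * Z) ^ y / fact y) * 3 ^ (3 * Z ^ 2 * Z)"
  proof (rule abs_E_value_le[OF _ _ x, where X = "Z ^ 2"])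
    show "\<bar>fps_nth (linear_form Q k) l\<bar> * fact l \<le> of_nat c * of_nat (l + k) ^ (q * k) * of_nat (Z ^ 2) ^ (l + k)" for l
    proof -
      have "(1 :: rat) \<le> of_nat Z" using Z by simp
      hence "(1 :: rat) \<le> of_nat (Z ^ 2)" by (simp add: one_le_power)
      from abs_nth_linear_form_le[OF Q(2) this, of k l] show ?thesis
        by (simp add: c_def)
    qed
    show "fps_nth (linear_form Q k) l = 0" if "l < y" for l
    proof -
      have "l + k < M" using that unfolding y_def by linarith
      show ?thesis by (rule linear_form_eq_0[where M = M, OF Q(1) \<open>l + k < M\<close>])
    qed
  qed
  also have "\<dots> = real (c * fact (q * k) * (3 * Z ^ 2) ^ k * (3 * Z ^ 2 * Z) ^ y * 3 ^ (3 * Z ^ 2 * Z)) / fact y"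
    by simp
  finally have *: "\<bar>E_value (linear_form Q k) x\<bar> * fact y \<le>
      real (c * fact (q * k) * (3 * Z ^ 2) ^ k * (3 * Z ^ 2 * Z) ^ y * 3 ^ (3 * Z ^ 2 * Z))"
    by (simp add: pos_le_divide_eq)
  have G: "3 * Z ^ 2 * Z \<le> Z ^ 4"
    using Z by (simp add: power2_eq_square power4_eq_xxxx)
  have "c * fact (q * k) * (3 * Z ^ 2) ^ k * (3 * Z ^ 2 * Z) ^ y * 3 ^ (3 * Z ^ 2 * Z) \<le>
     (n ^ n * Z ^ ((g + 2) * n) * Z ^ (2 * n)) * n ^ (q * L) * Z ^ (3 * n) * Z ^ (8 * (m * n)) * Z ^ n"
  proof (intro mult_mono)
    show "c \<le> n ^ n * Z ^ ((g + 2) * n) * Z ^ (2 * n)"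
      unfolding c_def using k Ln Z by (intro mult_left_mono power_increasing) auto
    have "fact (q * k) \<le> (q * k) ^ (q * k)" using fact_le_power[where 'a = nat] by simp
    also have "\<dots> \<le> n ^ (q * k)" using order_trans[OF qk Ln(2)] by (rule power_mono) simp
    also have "\<dots> \<le> n ^ (q * L)" using qk n1 by (intro power_increasing) auto
    finally show "fact (q * k) \<le> n ^ (q * L)" .
    have "(3 * Z ^ 2) ^ k \<le> (Z * Z ^ 2) ^ k" using Z by (intro power_mono) auto
    also have "\<dots> = Z ^ (3 * k)" by (simp add: power_mult power2_eq_square power3_eq_cube mult.assoc)
    also have "\<dots> \<le> Z ^ (3 * n)" using k Ln Z by (intro power_increasing) auto
    finally show "(3 * Z ^ 2) ^ k \<le> Z ^ (3 * n)" .
    have "(3 * Z ^ 2 * Z) ^ y \<le> (Z ^ 4) ^ y" by (rule power_mono[OF G]) simp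
    also have "\<dots> = Z ^ (4 * y)" by (simp add: power_mult)
    also have "\<dots> \<le> Z ^ (8 * (m * n))"
    proof (intro power_increasing)
      have "y \<le> m * (n + 1)" by (simp add: y_def M)
      also have "\<dots> \<le> m * (2 * n)" using n1 by (intro mult_left_mono) auto
      finally show "4 * y \<le> 8 * (m * n)" by simp
    qed (use Z in simp)
    finally show "(3 * Z ^ 2 * Z) ^ y \<le> Z ^ (8 * (m * n))" .
    have "3 ^ (3 * Z ^ 2 * Z) \<le> Z ^ (3 * Z ^ 2 * Z)" using Z by (intro power_mono) auto
    also have "\<dots> \<le> Z ^ n" using G n Z by (intro power_increasing) auto
    finally show "3 ^ (3 * Z ^ 2 * Z) \<le> Z ^ n" .
  qed auto
  also have "\<dots> = n ^ (n + q * L) * Z ^ ((g + 2) * n + 2 * n + 3 * n + 8 * (m * n) + n)"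
    by (simp only: power_add mult_ac)
  also have "(g + 2) * n + 2 * n + 3 * n + 8 * (m * n) + n = (g + 8 + 8 * m) * n"
    by (simp add: algebra_simps)
  finally have c_le: "real (c * fact (q * k) * (3 * Z ^ 2) ^ k * (3 * Z ^ 2 * Z) ^ y * 3 ^ (3 * Z ^ 2 * Z)) \<le>
      real (n ^ (n + q * L) * Z ^ ((g + 8 + 8 * m) * n))" by (simp only: of_nat_le_iff)
  have "m * n \<le> y + 2 * L" using k L(2) m by (simp add: y_def M algebra_simps)
  moreover have "2 * n \<le> m * n" using m2 by (intro mult_right_mono) auto
  ultimately have y: "n \<le> y" using Ln by linarith
  have "n ^ (m * n) \<le> n ^ (y + 2 * L)" using n1 \<open>m * n \<le> y + 2 * L\<close> by (intro power_increasing) auto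
  also have "\<dots> = n ^ y * n ^ (2 * L)" by (rule power_add)
  also have "\<dots> \<le> 3 ^ n * fact y * n ^ (2 * L)" by (intro mult_right_mono fact_ge_power y) simp
  also have "\<dots> \<le> Z ^ n * fact y * n ^ (2 * L)" using Z by (intro mult_right_mono power_mono) auto
  finally have "real (n ^ (m * n)) \<le> real (Z ^ n * fact y * n ^ (2 * L))" by (simp only: of_nat_le_iff)
  hence "\<bar>E_value (linear_form Q k) x\<bar> * real n ^ (m * n) \<le>
      \<bar>E_value (linear_form Q k) x\<bar> * real (Z ^ n * fact y * n ^ (2 * L))"
    by (intro mult_left_mono) auto
  also have "\<dots> = (\<bar>E_value (linear_form Q k) x\<bar> * fact y) * real (Z ^ n * n ^ (2 * L))"
    by simp
  also have "\<dots> \<le> real (n ^ (n + q * L) * Z ^ ((g + 8 + 8 * m) * n)) * real (Z ^ n * n ^ (2 * L))"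
    by (intro mult_right_mono order_trans[OF * c_le]) simp
  also have "\<dots> = real ((n ^ (n + q * L) * n ^ (2 * L)) * (Z ^ ((g + 8 + 8 * m) * n) * Z ^ n))"
    by simp
  also have "n ^ (n + q * L) * n ^ (2 * L) = n ^ (n + (q + 2) * L)"
    by (simp only: power_add[symmetric] distrib_right add.assoc)
  also have "Z ^ ((g + 8 + 8 * m) * n) * Z ^ n = Z ^ ((g + 9 + 8 * m) * n)"
    by (simp add: algebra_simps flip: power_add)
  finally show ?thesis by (simp only: mult.commute)
qed

end

section \<open>Small independent forms at the point\<close>

context bounded_E_system
begin

text \<open>The forms selected by the zero estimate at the complex point \<open>u/v\<close>. Their coefficient vectors become integral after
multiplication by \<open>v\<^sup>2\<^sup>n\<close>, since \<open>2 n\<close> bounds all degrees involved.\<close>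

lemma independent_small_forms:
  fixes u v :: int and \<xi> :: rat
  assumes m2: "2 \<le> m" and n: "Z ^ 4 \<le> n" "n0 \<le> n"
    and n0: "zero_estimate_constant m p q T A f n0"
    and L: "L = m + q * (m * (m - 1) div 2) + p + n div step" "4 * ((m + q) * L) \<le> n"
    and \<xi>: "\<xi> = of_int u / of_int v" "v \<noteq> 0" "\<bar>u\<bar> \<le> int Z" "\<bar>v\<bar> \<le> int Z"
    and nz: "\<xi> * poly (map_poly of_int T) \<xi> \<noteq> 0"
  obtains w :: "nat \<Rightarrow> nat \<Rightarrow> int"
  where "\<And>c :: nat \<Rightarrow> complex. \<forall>i<m. (\<Sum>k<m. c k * of_int (w k i)) = 0 \<Longrightarrow> \<forall>k<m. c k = 0"
    and "\<And>k i. k < m \<Longrightarrow> i < m \<Longrightarrow> \<bar>w k i\<bar> \<le> int (n ^ (n + L) * Z ^ ((g + 6) * n))"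
    and "\<And>k. k < m \<Longrightarrow> \<bar>\<Sum>i<m. of_int (w k i) * E_value (f i) \<xi>\<bar> * real n ^ (m * n) \<le>
      real (Z ^ ((g + 11 + 8 * m) * n) * n ^ (n + (q + 2) * L))"
proof -
  define t where "t = n div step"
  define M where "M = m * (n + 1) - n div step - 1"
  define \<zeta> :: complex where "\<zeta> = of_int u / of_int v"
  have "Z ^ 1 \<le> Z ^ 4" using Z by (intro power_increasing) auto
  with n(1) Z have n1: "1 \<le> n" by simp
  have mL: "m \<le> L" "n div step \<le> L" using L(1) by simp_all
  have "L \<le> m * L" using m by (cases m) auto
  moreover have "4 * (m * L) + 4 * (q * L) \<le> n" using L(2) by (simp only: distrib_left distrib_right)
  ultimately have qL: "L * q \<le> n" using mult.commute[of L q] by linarith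
  obtain Q where Q: "\<And>i. i < m \<Longrightarrow> degree (Q i) \<le> n" "\<exists>i<m. Q i \<noteq> 0"
    "\<And>i. i < m \<Longrightarrow> coeff_sum_norm (Q i) \<le> int (n ^ n * Z ^ ((g + 1) * n))"
    "\<And>l. l < M \<Longrightarrow> fps_nth (linear_form Q 0) l = 0"
    "\<And>l. \<bar>fps_nth (linear_form Q 0) l\<bar> * fact l \<le> of_nat (n ^ n * Z ^ ((g + 2) * n)) * of_nat (Z ^ 2) ^ l"
    by (rule exists_small_auxiliary_form[OF n1 M_def]) (rule that)
  have step: "2 * m < step + 1" "1 < step" using m by (simp_all add: step_size_def)
  have floor: "\<lfloor>1 / real step * real n\<rfloor> = int t"
    unfolding t_def by (simp add: floor_divide_of_nat_eq)
  have \<zeta>T: "\<zeta> * eval_int_poly T \<zeta> \<noteq> 0"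
  proof -
    have "of_int (homogenize q T u v) = (of_int v :: rat) ^ q * poly (map_poly of_int T) \<xi>"
      unfolding \<xi>(1) by (rule of_int_homogenize[OF degree_T \<xi>(2)])
    hence "homogenize q T u v \<noteq> 0" using nz \<xi>(2) by auto
    moreover have "of_int (homogenize q T u v) = (of_int v :: complex) ^ q * eval_int_poly T \<zeta>"
      unfolding eval_int_poly_def \<zeta>_def by (rule of_int_homogenize[OF degree_T \<xi>(2)])
    ultimately show ?thesis using nz \<xi> by (auto simp: \<zeta>_def)
  qed
  have "\<exists>K \<subseteq> {..< m + (q * (m * (m - 1) div 2) + nat \<lfloor>1 / real step * real n\<rfloor> + p)}.
      card K = m \<and> (\<forall>c :: nat \<Rightarrow> complex.
        (\<forall>i<m. (\<Sum>k\<in>K. c k * eval_int_poly (P Q k i) \<zeta>) = 0) \<longrightarrow> (\<forall>k\<in>K. c k = 0))"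
  proof (rule n0[unfolded zero_estimate_constant_def, rule_format], intro conjI allI impI)
    show "0 < 1 / real step" using step by simp
    have "2 * real m - 1 < real step" "0 < 2 * real m - 1" using step m by linarith+
    thus "1 / real step < 1 / (2 * real m - 1)" by (intro divide_strict_left_mono) auto
    fix l assume "int l < int (m * (n + 1)) - \<lfloor>1 / real step * real n\<rfloor> - 1"
    hence "l < M" unfolding floor M_def t_def[symmetric] by linarith
    from Q(4)[OF this] show "fps_nth (\<Sum>i<m. rat_fps (Q i) * f i) l = 0"
      by (simp add: linear_form_def)
  qed (use Q(1,2) n(2) \<zeta>T in auto)
  hence "\<exists>K \<subseteq> {..<L}. card K = m \<and> (\<forall>c :: nat \<Rightarrow> complex.
        (\<forall>i<m. (\<Sum>k\<in>K. c k * eval_int_poly (P Q k i) \<zeta>) = 0) \<longrightarrow> (\<forall>k\<in>K. c k = 0))"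
    unfolding floor L(1) t_def by (simp add: ac_simps)
  then obtain K where K: "K \<subseteq> {..<L}" "card K = m"
    and indep: "\<And>c :: nat \<Rightarrow> complex. \<forall>i<m. (\<Sum>k\<in>K. c k * eval_int_poly (P Q k i) \<zeta>) = 0 \<Longrightarrow> \<forall>k\<in>K. c k = 0"
    by blast
  obtain e where e: "bij_betw e {..<m} K"
    using ex_bij_betw_nat_finite[of K] finite_subset[OF K(1)] K(2) by (auto simp: atLeast0LessThan)
  have eL: "e k < L" if "k < m" for k using e K(1) that by (auto simp: bij_betw_def)
  define w where "w k i = homogenize (2 * n) (P Q (e k) i) u v" for k i
  have deg: "degree (P Q (e k) i) \<le> 2 * n" if "k < m" "i < m" for k i
  proof -
    have "degree (P Q (e k) i) \<le> n + e k * q" by (rule degree_shidlovskii_poly_le[OF Q(1) that(2)])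
    also have "e k * q \<le> L * q" using eL[OF that(1)] by (intro mult_right_mono) auto
    finally show ?thesis using qL by linarith
  qed
  show thesis
  proof (rule that[of w])
    fix c :: "nat \<Rightarrow> complex" assume c: "\<forall>i<m. (\<Sum>k<m. c k * of_int (w k i)) = 0"
    define c' where "c' k = c (the_inv_into {..<m} e k)" for k
    have c': "c' (e k) = c k" if "k < m" for k
      using e that by (simp add: c'_def bij_betw_def the_inv_into_f_f)
    have "\<forall>i<m. (\<Sum>k\<in>K. c' k * eval_int_poly (P Q k i) \<zeta>) = 0"
    proof (intro allI impI)
      fix i assume i: "i < m"
      have "(\<Sum>k\<in>K. c' k * eval_int_poly (P Q k i) \<zeta>) = (\<Sum>k<m. c k * eval_int_poly (P Q (e k) i) \<zeta>)"
        using c' by (subst sum.reindex_bij_betw[OF e, symmetric]) simp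
      also have "of_int v ^ (2 * n) * \<dots> = (\<Sum>k<m. c k * of_int (w k i))"
        unfolding sum_distrib_left w_def
        by (intro sum.cong refl, subst of_int_homogenize[OF deg \<xi>(2)])
          (use i in \<open>simp_all add: eval_int_poly_def \<zeta>_def\<close>)
      also have "\<dots> = 0" using c i by blast
      finally show "(\<Sum>k\<in>K. c' k * eval_int_poly (P Q k i) \<zeta>) = 0" using \<xi>(2) by simp
    qed
    from indep[OF this] have "\<forall>k\<in>K. c' k = 0" .
    thus "\<forall>k<m. c k = 0" using c' e by (metis bij_betw_apply lessThan_iff)
  next
    fix k i assume ki: "k < m" "i < m"
    have "\<bar>w k i\<bar> \<le> coeff_sum_norm (P Q (e k) i) * int Z ^ (2 * n)"
      unfolding w_def by (rule abs_homogenize_le[OF \<xi>(3,4)])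
    also have "\<dots> \<le> int (n ^ (n + L) * Z ^ ((g + 4) * n)) * int Z ^ (2 * n)"
      by (intro mult_right_mono coeff_sum_norm_shidlovskii_poly_le'[OF Q(1,3) L(2) mL(1)])
        (use eL[OF ki(1)] ki(2) in auto)
    also have "\<dots> = int (n ^ (n + L) * (Z ^ ((g + 4) * n) * Z ^ (2 * n)))" by simp
    also have "Z ^ ((g + 4) * n) * Z ^ (2 * n) = Z ^ ((g + 6) * n)"
      by (simp add: algebra_simps flip: power_add)
    finally show "\<bar>w k i\<bar> \<le> int (n ^ (n + L) * Z ^ ((g + 6) * n))" .
  next
    fix k assume k: "k < m"
    have "of_rat \<xi> = (of_int u / of_int v :: real)" by (simp add: \<xi>(1) of_rat_divide)
    hence "(\<Sum>i<m. of_int (w k i) * E_value (f i) \<xi>) = of_int v ^ (2 * n) * E_value (linear_form Q (e k)) \<xi>"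
      unfolding E_value_linear_form sum_distrib_left w_def
      by (intro sum.cong refl, subst of_int_homogenize[OF deg[OF k] \<xi>(2)]) simp_all
    hence "\<bar>\<Sum>i<m. of_int (w k i) * E_value (f i) \<xi>\<bar> * real n ^ (m * n) =
        \<bar>of_int v\<bar> ^ (2 * n) * (\<bar>E_value (linear_form Q (e k)) \<xi>\<bar> * real n ^ (m * n))"
      by (simp add: abs_mult power_abs)
    also have "\<dots> \<le> real Z ^ (2 * n) * real (Z ^ ((g + 9 + 8 * m) * n) * n ^ (n + (q + 2) * L))"
    proof (intro mult_mono power_mono)
      show "\<bar>real_of_int v\<bar> \<le> real Z" using \<xi>(4) by linarith
      have "\<bar>\<xi>\<bar> \<le> of_nat Z"
      proof -
        have "\<bar>\<xi>\<bar> = of_int \<bar>u\<bar> / of_int \<bar>v\<bar>" by (simp add: \<xi>(1))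
        also have "\<dots> \<le> of_int \<bar>u\<bar> / 1"
        proof (rule divide_left_mono)
          have "1 \<le> \<bar>v\<bar>" using \<xi>(2) by linarith
          thus "1 \<le> (of_int \<bar>v\<bar> :: rat)" by (simp only: of_int_1_le_iff)
        qed (use \<xi>(2) in auto)
        also have "\<dots> = of_int \<bar>u\<bar>" by simp
        also have "\<dots> \<le> of_int (int Z)" using \<xi>(3) by (simp only: of_int_le_iff)
        finally show ?thesis by simp
      qed
      note \<xi>_le = this
      show "\<bar>E_value (linear_form Q (e k)) \<xi>\<bar> * real n ^ (m * n) \<le> real (Z ^ ((g + 9 + 8 * m) * n) * n ^ (n + (q + 2) * L))"
        by (rule abs_E_value_linear_form_le[OF m2 n(1) M_def Q(4,5) L(2) mL(2) eL[OF k] \<xi>_le])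
    qed auto
    also have "\<dots> = real ((Z ^ (2 * n) * Z ^ ((g + 9 + 8 * m) * n)) * n ^ (n + (q + 2) * L))" by simp
    also have "Z ^ (2 * n) * Z ^ ((g + 9 + 8 * m) * n) = Z ^ ((g + 11 + 8 * m) * n)"
      by (simp add: algebra_simps flip: power_add)
    finally show "\<bar>\<Sum>i<m. of_int (w k i) * E_value (f i) \<xi>\<bar> * real n ^ (m * n) \<le>
      real (Z ^ ((g + 11 + 8 * m) * n) * n ^ (n + (q + 2) * L))" .
  qed
qed

text \<open>With \<open>\<omega> = n\<^sup>n\<^sup>/\<^sup>4\<close>, each of \<open>H\<close>, the total geometric factor \<open>Z\<close> to the power \<open>e1 * n\<close>, and the total loss
\<open>n\<close> to the power \<open>(m + q) L\<close> due to the derivations is at most \<open>\<omega>\<close>. In the error term these three meet the gain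
\<open>n\<^sup>-\<^sup>n = \<omega>\<^sup>-\<^sup>4\<close>, the net result of \<open>m - 1\<close> factors of size \<open>n\<^sup>n\<close> against \<open>n\<^sup>-\<^sup>m\<^sup>n\<close>: this leaves \<open>1/\<omega>\<close>.\<close>

lemma coordinate_bound:
  fixes u v :: int and \<xi> :: rat and a :: "nat \<Rightarrow> int" and H :: nat
  assumes m2: "2 \<le> m" and pZ: "p \<le> Z" and n: "Z ^ (4 * e1) \<le> n" "n0 \<le> n"
    and n0: "zero_estimate_constant m p q T A f n0"
    and \<xi>: "\<xi> = of_int u / of_int v" "v \<noteq> 0" "\<bar>u\<bar> \<le> int Z" "\<bar>v\<bar> \<le> int Z"
    and nz: "\<xi> * poly (map_poly of_int T) \<xi> \<noteq> 0"
    and a: "\<exists>i<m. a i \<noteq> 0" "\<And>i. i < m \<Longrightarrow> \<bar>a i\<bar> \<le> int H" and H: "H ^ 4 \<le> n ^ n"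
    and j: "j < m"
  defines "\<omega> \<equiv> real n powr (real n / 4)"
  shows "\<bar>E_value (f j) \<xi>\<bar> \<le> \<omega> ^ (4 * m) * \<bar>\<Sum>i<m. of_int (a i) * E_value (f i) \<xi>\<bar> + 1 / \<omega>"
proof -
  define c0 where "c0 = m + q * (m * (m - 1) div 2) + p"
  define L where "L = m + q * (m * (m - 1) div 2) + p + n div step"
  have e1: "15 \<le> e1"
  proof -
    have "1 * 15 \<le> m * (g + 15)" using m by (intro mult_mono) auto
    thus ?thesis by (simp add: size_exponent_def)
  qed
  have "Z ^ 4 \<le> Z ^ (4 * e1)" "Z ^ 8 \<le> Z ^ (4 * e1)" using Z e1 by (auto intro!: power_increasing)
  with n have n4: "Z ^ 4 \<le> n" and n8: "Z ^ 8 \<le> n" by linarith+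
  have "Z ^ 1 \<le> Z ^ 4" using Z by (intro power_increasing) auto
  with n4 Z have n1: "1 \<le> n" by simp
  \<comment> \<open>The part of the number of derivations that is independent of \<open>n\<close> is dominated by \<open>n div step\<close>, so that
    \<open>L \<le> 2 (n div step)\<close>.\<close>
  have "step * c0 \<le> n"
  proof -
    have Z2: "2 * Z \<le> Z ^ 2" "Z ^ 2 + Z ^ 3 \<le> Z ^ 4" "16 \<le> Z ^ 3"
    proof -
      show "2 * Z \<le> Z ^ 2" using Z by (simp add: power2_eq_square)
      have "Z ^ 2 \<le> Z ^ 3" using Z by (intro power_increasing) auto
      moreover have "2 * Z ^ 3 \<le> Z * Z ^ 3" using Z by (intro mult_right_mono) auto
      moreover have "Z * Z ^ 3 = Z ^ 4" by (simp add: power4_eq_xxxx power3_eq_cube)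
      ultimately show "Z ^ 2 + Z ^ 3 \<le> Z ^ 4" by linarith
      have "3 ^ 3 \<le> Z ^ 3" using Z by (intro power_mono) auto
      thus "16 \<le> Z ^ 3" by simp
    qed
    have "step \<le> 16 * Z" using Z by (simp add: step_size_def)
    also have "\<dots> \<le> Z ^ 3 * Z" using Z2 by (intro mult_right_mono) auto
    also have "\<dots> = Z ^ 4" by (simp add: power4_eq_xxxx power3_eq_cube)
    finally have 1: "step \<le> Z ^ 4" .
    have "m * (m - 1) div 2 \<le> m * m" by (rule order_trans[OF div_le_dividend]) simp
    also have "\<dots> \<le> Z * Z" using Z by (intro mult_mono) auto
    finally have "q * (m * (m - 1) div 2) \<le> Z * (Z * Z)" using Z by (intro mult_mono) auto
    hence "c0 \<le> 2 * Z + Z ^ 3" using pZ Z by (simp add: c0_def power3_eq_cube mult.assoc)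
    hence "c0 \<le> Z ^ 4" using Z2 by linarith
    with 1 have "step * c0 \<le> Z ^ 4 * Z ^ 4" by (rule mult_mono) auto
    also have "\<dots> = Z ^ 8" by (simp flip: power_add)
    finally show ?thesis using n8 by linarith
  qed
  hence "c0 \<le> n div step" using step_pos by (simp add: less_eq_div_iff_mult_less_eq mult.commute)
  hence "L \<le> 2 * (n div step)" by (simp add: L_def c0_def)
  hence "step * L \<le> 2 * (step * (n div step))" by simp
  also have "step * (n div step) \<le> n" by simp
  finally have L: "4 * ((m + q) * L) \<le> n" by (simp add: step_size_def algebra_simps)
  obtain w where w: "\<And>c :: nat \<Rightarrow> complex. \<forall>i<m. (\<Sum>k<m. c k * of_int (w k i)) = 0 \<Longrightarrow> \<forall>k<m. c k = 0"
    "\<And>k i. k < m \<Longrightarrow> i < m \<Longrightarrow> \<bar>w k i\<bar> \<le> int (n ^ (n + L) * Z ^ ((g + 6) * n))"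
    "\<And>k. k < m \<Longrightarrow> \<bar>\<Sum>i<m. of_int (w k i) * E_value (f i) \<xi>\<bar> * real n ^ (m * n) \<le>
      real (Z ^ ((g + 11 + 8 * m) * n) * n ^ (n + (q + 2) * L))"
    by (rule independent_small_forms[OF m2 n4 n(2) n0 L_def L \<xi> nz]) (rule that)
  define b where "b = n ^ (n + L) * Z ^ ((g + 6) * n)"
  define U where "U = Z ^ ((g + 11 + 8 * m) * n) * n ^ (n + (q + 2) * L)"
  define S where "S = \<bar>\<Sum>i<m. of_int (a i) * E_value (f i) \<xi>\<bar>"
  have "\<bar>E_value (f j) \<xi>\<bar> \<le> fact m * (of_int (int b) ^ (m - 1) * S + of_int (int H) * of_int (int b) ^ (m - 2) * (real U / real n ^ (m * n)))"
    unfolding S_def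
    by (rule coordinate_bound_of_linear_forms[OF m2 w(1) _ a _ j])
      (use w(2,3) n1 in \<open>auto simp: b_def U_def pos_le_divide_eq\<close>)
  also have "\<dots> = real (fact m * b ^ (m - 1)) * S + real (fact m * (H * b ^ (m - 2) * U)) / real n ^ (m * n)"
    by (simp add: algebra_simps)
  finally have bound: "\<bar>E_value (f j) \<xi>\<bar> \<le> \<dots>" .
  have \<omega>: "0 < \<omega>" "\<omega> ^ 4 = real n ^ n"
    using n1 by (simp_all add: \<omega>_def powr_power powr_realpow)
  have le_\<omega>: "real x \<le> \<omega>" if "x ^ 4 \<le> n ^ n" for x
  proof -
    have "real x ^ 4 \<le> \<omega> ^ 4" using that unfolding \<omega>(2) by (simp only: of_nat_le_iff flip: of_nat_power)
    thus ?thesis using \<omega>(1) by (simp add: power_mono_iff)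
  qed
  have H\<omega>: "real H \<le> \<omega>" by (rule le_\<omega>[OF H])
  have Z\<omega>: "real (Z ^ (e1 * n)) \<le> \<omega>"
  proof (rule le_\<omega>)
    have "(Z ^ (e1 * n)) ^ 4 = (Z ^ (4 * e1)) ^ n" by (simp add: mult_ac flip: power_mult)
    also have "\<dots> \<le> n ^ n" using n(1) by (rule power_mono) simp
    finally show "(Z ^ (e1 * n)) ^ 4 \<le> n ^ n" .
  qed
  have L\<omega>: "real (n ^ ((m + q) * L)) \<le> \<omega>"
  proof (rule le_\<omega>)
    have "(n ^ ((m + q) * L)) ^ 4 = n ^ (4 * ((m + q) * L))" by (simp add: mult_ac flip: power_mult)
    also have "\<dots> \<le> n ^ n" using L n1 by (intro power_increasing) auto
    finally show "(n ^ ((m + q) * L)) ^ 4 \<le> n ^ n" .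
  qed
  have fact_m: "fact m \<le> Z ^ (m * n)"
  proof -
    have "fact m \<le> m ^ m" using fact_le_power[where 'a = nat] by simp
    also have "\<dots> \<le> Z ^ m" using Z by (intro power_mono) auto
    also have "\<dots> \<le> Z ^ (m * n)" using Z n1 by (intro power_increasing) auto
    finally show ?thesis .
  qed
  have first: "real (fact m * b ^ (m - 1)) \<le> \<omega> ^ (4 * m)"
  proof -
    have "fact m * b ^ (m - 1) \<le> Z ^ (m * n) * (n ^ (n * (m - 1)) * n ^ (L * (m - 1)) * Z ^ ((g + 6) * n * (m - 1)))"
      using fact_m by (intro mult_mono) (simp_all add: b_def power_mult_distrib power_add power_mult)
    also have "\<dots> \<le> Z ^ (e1 * n) * n ^ (n * (m - 1)) * n ^ ((m + q) * L)"
    proof -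
      have "m * n + (g + 6) * n * (m - 1) \<le> e1 * n"
      proof -
        have "m * n + (g + 6) * n * (m - 1) \<le> m * n + (g + 6) * n * m" by simp
        also have "\<dots> \<le> e1 * n" by (simp add: size_exponent_def algebra_simps)
        finally show ?thesis .
      qed
      hence "Z ^ (m * n) * Z ^ ((g + 6) * n * (m - 1)) \<le> Z ^ (e1 * n)"
        unfolding power_add[symmetric] using Z by (intro power_increasing) auto
      moreover have "L * (m - 1) \<le> (m + q) * L"
        unfolding mult.commute[of L] by (rule mult_right_mono) auto
      hence "n ^ (L * (m - 1)) \<le> n ^ ((m + q) * L)" using n1 by (intro power_increasing) auto
      ultimately have "(Z ^ (m * n) * Z ^ ((g + 6) * n * (m - 1))) * n ^ (n * (m - 1)) * n ^ (L * (m - 1)) \<le>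
          Z ^ (e1 * n) * n ^ (n * (m - 1)) * n ^ ((m + q) * L)"
        by (intro mult_mono) auto
      thus ?thesis by (simp only: mult_ac)
    qed
    finally have "real (fact m * b ^ (m - 1)) \<le> real (Z ^ (e1 * n)) * (real n ^ n) ^ (m - 1) * real (n ^ ((m + q) * L))"
      unfolding power_mult[symmetric] by (simp only: of_nat_le_iff flip: of_nat_mult of_nat_power)
    also have "\<dots> \<le> \<omega> * (\<omega> ^ 4) ^ (m - 1) * \<omega>"
      unfolding \<omega>(2) using Z\<omega> L\<omega> \<omega>(1) by (intro mult_mono) auto
    also have "\<dots> = \<omega> ^ (1 + 4 * (m - 1) + 1)" by (simp only: power_add power_mult power_one_right)
    also have "\<dots> \<le> \<omega> ^ (4 * m)"
    proof (intro power_increasing)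
      have "1 ^ 4 \<le> n ^ n" using n1 by simp
      from le_\<omega>[OF this] show "1 \<le> \<omega>" by simp
    qed (use m in simp)
    finally show ?thesis .
  qed
  have second: "real (fact m * (H * b ^ (m - 2) * U)) / real n ^ (m * n) \<le> 1 / \<omega>"
  proof -
    have m1: "m - 2 + 1 = m - 1" using m2 by simp
    have "fact m * (H * b ^ (m - 2) * U) \<le>
        Z ^ (m * n) * (H * (n ^ (n * (m - 2)) * n ^ (L * (m - 2)) * Z ^ ((g + 6) * n * (m - 2))) *
          (Z ^ ((g + 11 + 8 * m) * n) * (n ^ n * n ^ ((q + 2) * L))))"
      using fact_m by (intro mult_mono) (simp_all add: b_def U_def power_mult_distrib power_add power_mult)
    also have "\<dots> = H * Z ^ (m * n + (g + 6) * n * (m - 2) + (g + 11 + 8 * m) * n) *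
        n ^ (n * (m - 2) + n) * n ^ (L * (m - 2) + (q + 2) * L)"
      by (simp only: power_add mult_ac)
    also have "n * (m - 2) + n = n * (m - 1)" unfolding m1[symmetric] by (simp only: distrib_left mult_1_right)
    also have "L * (m - 2) + (q + 2) * L = (m + q) * L"
    proof -
      obtain k where "m = k + 2" using m2 by (metis add.commute le_Suc_ex)
      thus ?thesis by (simp add: algebra_simps)
    qed
    also have "H * Z ^ (m * n + (g + 6) * n * (m - 2) + (g + 11 + 8 * m) * n) * n ^ (n * (m - 1)) * n ^ ((m + q) * L)
        \<le> H * Z ^ (e1 * n) * n ^ (n * (m - 1)) * n ^ ((m + q) * L)"
    proof (intro mult_right_mono mult_left_mono power_increasing)
      obtain k where k: "m = k + 2" using m2 by (metis add.commute le_Suc_ex)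
      have "m + (x + 6) * (m - 2) + (x + 11 + 8 * m) \<le> m * (x + 15)" for x
        unfolding k by (simp add: algebra_simps)
      from this[of g] have "m + (g + 6) * (m - 2) + (g + 11 + 8 * m) \<le> e1"
        by (simp only: size_exponent_def)
      hence "(m + (g + 6) * (m - 2) + (g + 11 + 8 * m)) * n \<le> e1 * n" by (rule mult_right_mono) simp
      thus "m * n + (g + 6) * n * (m - 2) + (g + 11 + 8 * m) * n \<le> e1 * n"
        by (simp only: distrib_right mult.assoc mult.commute[of n "m - 2"])
    qed (use Z in auto)
    finally have "real (fact m * (H * b ^ (m - 2) * U)) \<le>
        real H * real (Z ^ (e1 * n)) * real (n ^ (n * (m - 1))) * real (n ^ ((m + q) * L))"
      by (simp only: of_nat_le_iff flip: of_nat_mult)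
    also have "\<dots> \<le> \<omega> * \<omega> * real (n ^ (n * (m - 1))) * \<omega>"
      using H\<omega> Z\<omega> L\<omega> \<omega>(1) by (intro mult_mono) auto
    finally have "real (fact m * (H * b ^ (m - 2) * U)) / real n ^ (m * n) \<le>
        \<omega> * \<omega> * real (n ^ (n * (m - 1))) * \<omega> / real n ^ (m * n)"
      by (rule divide_right_mono) simp
    also have "\<dots> = 1 / \<omega>"
    proof -
      have "m * n = n * (m - 1) + n" using m by (cases m) simp_all
      hence "real n ^ (m * n) = real (n ^ (n * (m - 1))) * \<omega> ^ 4"
        by (simp only: power_add \<omega>(2) of_nat_power)
      thus ?thesis using \<omega>(1) n1 by (simp add: field_simps power4_eq_xxxx)
    qed
    finally show ?thesis .
  qed
  have "real (fact m * b ^ (m - 1)) * S \<le> \<omega> ^ (4 * m) * S"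
    using first by (rule mult_right_mono) (simp add: S_def)
  with bound second show ?thesis unfolding S_def by linarith
qed

end

section \<open>The lower bound with an explicit exponent\<close>

text \<open>The least \<open>n\<close> with \<open>n\<^sup>n \<ge> H\<^sup>K\<close>. Passing from \<open>n - 1\<close> to \<open>n\<close> raises \<open>n\<^sup>n\<close> at most to its fourth power, since
\<open>n \<le> (n - 1)\<^sup>2\<close> for \<open>n \<ge> 3\<close>.\<close>

lemma exists_self_power_between:
  fixes H K :: nat
  assumes H: "3 \<le> H" and K: "2 \<le> K"
  obtains n where "3 \<le> n" "H ^ K \<le> n ^ n" "n ^ n < H ^ (4 * K)"
proof -
  define n where "n = (LEAST n. H ^ K \<le> n ^ n)"
  have "H ^ K \<le> (H ^ K) ^ 1" by simp
  also have "\<dots> \<le> (H ^ K) ^ (H ^ K)" using H by (intro power_increasing) auto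
  finally have ex: "H ^ K \<le> (H ^ K) ^ (H ^ K)" .
  have n: "H ^ K \<le> n ^ n" unfolding n_def by (rule LeastI[of "\<lambda>n. H ^ K \<le> n ^ n", OF ex])
  have "(3 :: nat) ^ 2 \<le> 3 ^ K" using K by (intro power_increasing) auto
  also have "\<dots> \<le> H ^ K" using H by (intro power_mono) auto
  also note n
  finally have "9 \<le> n ^ n" by simp
  have n3: "3 \<le> n"
  proof (rule ccontr)
    assume "\<not> 3 \<le> n"
    hence "n = 0 \<or> n = 1 \<or> n = 2" by linarith
    thus False using \<open>9 \<le> n ^ n\<close> by auto
  qed
  then obtain k where k: "n = Suc k" "2 \<le> k" by (cases n) auto
  have "\<not> H ^ K \<le> k ^ k" using not_less_Least[of k "\<lambda>n. H ^ K \<le> n ^ n"] k(1) by (simp add: n_def)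
  have "2 * k \<le> k * k" using k(2) by (rule mult_right_mono) simp
  hence "n \<le> k ^ 2" using k unfolding power2_eq_square by linarith
  hence "n ^ n \<le> (k ^ 2) ^ n" by (rule power_mono) simp
  also have "\<dots> = k ^ (2 * n)" by (simp only: power_mult)
  also have "\<dots> \<le> k ^ (k * 4)" using k by (intro power_increasing) auto
  also have "\<dots> = (k ^ k) ^ 4" by (simp only: power_mult)
  also have "\<dots> < (H ^ K) ^ 4" using \<open>\<not> H ^ K \<le> k ^ k\<close> by (intro power_strict_mono) auto
  also have "\<dots> = H ^ (4 * K)" by (simp only: mult.commute[of 4] power_mult)
  finally show thesis using that n3 n by blast
qed

lemma le_of_self_power_le:
  fixes a n :: nat
  assumes "a ^ a \<le> n ^ n" "1 \<le> n"
  shows "a \<le> n"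
proof (rule ccontr)
  assume "\<not> a \<le> n"
  hence na: "n < a" by simp
  have "n ^ n \<le> a ^ n" using na by (intro power_mono) auto
  also have "\<dots> < a ^ a" using na assms(2) by (intro power_strict_increasing) auto
  finally show False using assms(1) by simp
qed

context bounded_E_system
begin

text \<open>With \<open>n\<close> chosen such that \<open>H\<^sup>K \<le> n\<^sup>n < H\<^sup>4\<^sup>K\<close>, the quantity \<open>\<omega> = n\<^sup>n\<^sup>/\<^sup>4\<close> lies between \<open>H\<close> to the power
\<open>K/4\<close> and \<open>H\<^sup>K\<close>. The lower bound makes the error \<open>1/\<omega>\<close> less than \<open>\<kappa>/2\<close>, and the upper one turns
powers of \<open>\<omega>\<close> into powers of \<open>H\<close>. The condition \<open>n \<ge> Z\<close> to the power \<open>4 e1\<close> follows by comparing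
self-powers: for \<open>B\<close> equal to this power of \<open>Z\<close> one has \<open>B\<^sup>B \<le> 3\<close> to the power \<open>B\<^sup>2\<close>, and \<open>B\<^sup>2 \<le> K\<close>. For \<open>m = 1\<close> the
linear form is a nonzero integer multiple of the only value, and no auxiliary forms are needed.\<close>

lemma linear_form_lower_bound:
  fixes u v :: int and \<xi> :: rat and a :: "nat \<Rightarrow> int" and H K :: nat and \<kappa> :: real
  assumes pZ: "p \<le> Z" and n0: "zero_estimate_constant m p q T A f n0"
    and \<xi>: "\<xi> = of_int u / of_int v" "v \<noteq> 0" "\<bar>u\<bar> \<le> int Z" "\<bar>v\<bar> \<le> int Z"
    and nz: "\<xi> * poly (map_poly of_int T) \<xi> \<noteq> 0"
    and \<kappa>: "0 < \<kappa>" "\<exists>j<m. \<kappa> \<le> \<bar>E_value (f j) \<xi>\<bar>"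
    and K: "Z ^ (8 * e1) \<le> K" "8 / \<kappa> \<le> K"
    and H: "3 \<le> H" "n0 ^ n0 \<le> H"
    and a: "\<exists>i<m. a i \<noteq> 0" "\<And>i. i < m \<Longrightarrow> \<bar>a i\<bar> \<le> int H"
  shows "1 / real H ^ (K * (4 * m + 1)) < \<bar>\<Sum>i<m. of_int (a i) * E_value (f i) \<xi>\<bar>"
proof -
  obtain j where j: "j < m" "\<kappa> \<le> \<bar>E_value (f j) \<xi>\<bar>" using \<kappa> by blast
  have "1 * 15 \<le> m * (g + 15)" using m by (intro mult_mono) auto
  hence e1: "15 \<le> e1" by (simp add: size_exponent_def)
  have "Z ^ 2 \<le> Z ^ (8 * e1)" using e1 Z by (intro power_increasing) auto
  moreover have "3 ^ 2 \<le> Z ^ 2" using Z by (intro power_mono) auto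
  ultimately have K4: "4 \<le> K" using K(1) by simp
  have K\<kappa>: "2 / \<kappa> < real H ^ (K div 4)"
  proof -
    have "2 / \<kappa> = (8 / \<kappa>) / 4" by simp
    also have "\<dots> \<le> real K / 4" using K(2) by (rule divide_right_mono) simp
    also have "\<dots> < real (K div 4 + 1)" by linarith
    also have "K div 4 + 1 \<le> 2 ^ (K div 4)" using less_exp[of "K div 4"] by linarith
    also have "real (2 ^ (K div 4)) = 2 ^ (K div 4)" by simp
    also have "\<dots> \<le> real H ^ (K div 4)" using H by (intro power_mono) auto
    finally show ?thesis by simp
  qed
  show ?thesis
  proof (cases "m = 1")
    case True
    have "1 \<le> \<bar>a 0\<bar>" using a True by (auto simp: not_less)
    hence a0: "1 \<le> real_of_int \<bar>a 0\<bar>" by (simp only: of_int_1_le_iff)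
    have "1 / \<kappa> \<le> 2 / \<kappa>" using \<kappa>(1) by (intro divide_right_mono) auto
    also note K\<kappa>
    also have "real H ^ (K div 4) \<le> real H ^ (K * (4 * m + 1))"
    proof (intro power_increasing)
      have "K div 4 \<le> K * 1" by simp
      also have "\<dots> \<le> K * (4 * m + 1)" by (intro mult_left_mono) auto
      finally show "K div 4 \<le> K * (4 * m + 1)" .
    qed (use H in simp)
    finally have "1 / real H ^ (K * (4 * m + 1)) < \<kappa>"
      using \<kappa>(1) H(1) by (simp add: field_simps)
    also have "\<dots> \<le> 1 * \<bar>E_value (f 0) \<xi>\<bar>" using j True by simp
    also have "\<dots> \<le> real_of_int \<bar>a 0\<bar> * \<bar>E_value (f 0) \<xi>\<bar>" using a0 by (rule mult_right_mono) simp
    also have "\<dots> = \<bar>\<Sum>i<m. of_int (a i) * E_value (f i) \<xi>\<bar>" by (simp add: True abs_mult)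
    finally show ?thesis .
  next
    case False
    hence m2: "2 \<le> m" using m by simp
    obtain n where n: "3 \<le> n" "H ^ K \<le> n ^ n" "n ^ n < H ^ (4 * K)"
      using exists_self_power_between[OF H(1), of K] K4 by auto
    have n1: "1 \<le> n" using n(1) by simp
    define \<omega> where "\<omega> = real n powr (real n / 4)"
    have \<omega>: "0 < \<omega>" "\<omega> ^ 4 = real n ^ n"
      using n1 by (simp_all add: \<omega>_def powr_power powr_realpow)
    have HK: "H ^ i \<le> n ^ n" if "i \<le> K" for i
    proof -
      have "H ^ i \<le> H ^ K" using that H by (intro power_increasing) auto
      thus ?thesis using n(2) by linarith
    qed
    have n_ge: "Z ^ (4 * e1) \<le> n"
    proof (rule le_of_self_power_le[OF _ n1])
      define B where "B = Z ^ (4 * e1)"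
      have "B ^ B \<le> (3 ^ B) ^ B"
      proof (rule power_mono)
        have "B < 2 ^ B" by (rule less_exp)
        also have "(2 :: nat) ^ B \<le> 3 ^ B" by (rule power_mono) auto
        finally show "B \<le> 3 ^ B" by simp
      qed simp
      also have "\<dots> = 3 ^ (B * B)" by (simp only: power_mult)
      also have "B * B = Z ^ (8 * e1)" by (simp add: B_def flip: power_add)
      also have "(3 :: nat) ^ \<dots> \<le> H ^ \<dots>" using H by (intro power_mono) auto
      also have "\<dots> \<le> n ^ n" by (rule HK[OF K(1)])
      finally show "(Z ^ (4 * e1)) ^ (Z ^ (4 * e1)) \<le> n ^ n" by (simp only: B_def)
    qed
    have n0n: "n0 \<le> n"
      by (rule le_of_self_power_le[OF _ n1]) (use H(2) HK[of 1] K4 in simp)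
    define S where "S = \<bar>\<Sum>i<m. of_int (a i) * E_value (f i) \<xi>\<bar>"
    have "\<kappa> \<le> \<omega> ^ (4 * m) * S + 1 / \<omega>"
      using coordinate_bound[OF m2 pZ n_ge n0n n0 \<xi> nz a HK[OF K4] j(1)] j(2)
      unfolding S_def \<omega>_def by linarith
    have \<omega>H: "\<omega> < real H ^ K"
    proof -
      have "\<omega> ^ 4 < real (H ^ (4 * K))" unfolding \<omega>(2) using n(3) by (simp only: of_nat_less_iff flip: of_nat_power)
      also have "\<dots> = (real H ^ K) ^ 4" by (simp add: mult.commute flip: power_mult)
      finally show ?thesis by (rule power_less_imp_less_base) simp
    qed
    have "2 / \<kappa> < \<omega>"
    proof -
      have "(real H ^ (K div 4)) ^ 4 = real (H ^ (K div 4 * 4))" by (simp flip: power_mult)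
      also have "\<dots> \<le> real (n ^ n)" unfolding of_nat_le_iff by (rule HK) simp
      also have "\<dots> = \<omega> ^ 4" using \<omega> by simp
      finally have "real H ^ (K div 4) \<le> \<omega>" using \<omega>(1) by (simp add: power_mono_iff)
      with K\<kappa> show ?thesis by linarith
    qed
    hence "2 / \<omega> < \<kappa>" using \<kappa>(1) \<omega>(1) by (simp add: field_simps)
    with \<open>\<kappa> \<le> \<omega> ^ (4 * m) * S + 1 / \<omega>\<close> have "1 / \<omega> < \<omega> ^ (4 * m) * S" by simp
    hence "1 / \<omega> ^ (4 * m + 1) < S" using \<omega>(1) by (simp add: field_simps)
    moreover have "\<omega> ^ (4 * m + 1) \<le> (real H ^ K) ^ (4 * m + 1)" using \<omega> \<omega>H by (intro power_mono) auto
    hence "1 / (real H ^ K) ^ (4 * m + 1) \<le> 1 / \<omega> ^ (4 * m + 1)"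
      using \<omega>(1) H(1) by (intro divide_left_mono mult_pos_pos zero_less_power) auto
    ultimately show ?thesis unfolding S_def by (simp only: power_mult)
  qed
qed

end

section \<open>Comparison of the exponent with the polynomial\<close>

lemma one_plus_power_le:
  fixes x :: real
  assumes "0 \<le> x" "N \<le> W"
  shows "(1 + x) ^ N \<le> 2 ^ N * (\<Sum>i\<le>W. x ^ i)"
proof -
  have "(1 + x) ^ N = (\<Sum>i\<le>N. of_nat (N choose i) * x ^ i)"
    using binomial_ring[of x 1 N] by (simp add: add.commute)
  also have "\<dots> \<le> (\<Sum>i\<le>N. 2 ^ N * x ^ i)"
  proof (intro sum_mono mult_right_mono)
    fix i show "real (N choose i) \<le> 2 ^ N"
      using binomial_le_pow2[of N i] by (metis of_nat_le_iff of_nat_numeral of_nat_power)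
  qed (use assms in auto)
  also have "\<dots> \<le> (\<Sum>i\<le>W. 2 ^ N * x ^ i)" using assms by (intro sum_mono2) auto
  finally show ?thesis by (simp add: sum_distrib_left)
qed

lemma size_exponent_le:
  assumes "m + q \<le> s"
  shows "8 * size_exponent m q \<le> (8 * (s + 8)) ^ 7"
proof -
  define S where "S = 8 * (s + 8)"
  have S: "64 \<le> S" "m \<le> S" "2 * m \<le> S" "8 * (m + q) \<le> S" using assms by (auto simp: S_def)
  have "2 * m * (m + 2) + 3 \<le> 2 * s * (s + 2) + 3" using assms by (intro add_mono mult_mono) auto
  also have "\<dots> \<le> S * S" by (simp add: S_def algebra_simps)
  finally have "2 * m * (8 * (m + q)) * (3 + 2 * m * (m + 2)) \<le> S * S * (S * S)"
    using S by (intro mult_mono) auto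
  also have "\<dots> = S ^ 4" by (simp add: power4_eq_xxxx mult.assoc)
  finally have "m * (2 * m * (8 * (m + q)) * (3 + 2 * m * (m + 2)) + 15) \<le> S * (S ^ 4 + S ^ 4)"
  proof (intro mult_mono add_mono)
    have "S ^ 1 \<le> S ^ 4" using S by (intro power_increasing) auto
    thus "15 \<le> S ^ 4" using S by simp
  qed (use S in auto)
  also have "\<dots> = 2 * S ^ 5" by (simp add: eval_nat_numeral algebra_simps)
  finally have "8 * (m * (2 * m * (8 * (m + q)) * (3 + 2 * m * (m + 2)) + 15)) \<le> 16 * S ^ 5"
    by simp
  also have "\<dots> \<le> (S * S) * S ^ 5"
  proof (rule mult_right_mono)
    have "64 * 64 \<le> S * S" using S by (intro mult_mono) auto
    thus "16 \<le> S * S" by simp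
  qed simp
  also have "\<dots> = S ^ 7" by (simp add: eval_nat_numeral)
  finally show ?thesis
    by (simp only: size_exponent_def siegel_exponent_def step_size_def S_def)
qed

text \<open>The bound \<open>Z\<close> is affine in \<open>C, D, E\<close>, hence at most \<open>S (1 + C) (1 + D) (1 + E)\<close> with \<open>S = 8 (s + 8)\<close>. Its
\<open>N\<close>-th power expands into monomials of degree at most \<open>N\<close> in each variable, with coefficients below \<open>S\<close> to
the power \<open>4 N\<close>, and \<open>W\<close> exceeds both the degree and these coefficients.\<close>

lemma exponent_le_eval3:
  fixes C D E \<kappa> :: real
  assumes mq: "m + q \<le> s" and C: "0 \<le> C" "0 \<le> D" "0 \<le> E" and \<kappa>: "0 < \<kappa>"
    and Z: "1 \<le> Z" "real Z \<le> real s + 5 + C + D + E"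
    and K: "K = Z ^ (8 * size_exponent m q) + nat \<lceil>8 / \<kappa>\<rceil>" and W: "W = box_size s"
  shows "real (K * (4 * m + 1)) \<le> eval3 (box_poly W (real W + real W / \<kappa>)) C D E"
proof -
  define S where "S = 8 * (s + 8)"
  define N where "N = S ^ 7"
  define box where "box = (\<Sum>i\<le>W. C ^ i) * (\<Sum>j\<le>W. D ^ j) * (\<Sum>k\<le>W. E ^ k)"
  have S: "64 \<le> S" by (simp add: S_def)
  have W': "W = S ^ (S ^ 8)" by (simp add: W box_size_def S_def)
  have "S ^ 1 \<le> S ^ 8" using S by (intro power_increasing) auto
  hence "7 \<le> S ^ 8" using S by simp
  hence NW: "N \<le> W" unfolding N_def W' using S by (intro power_increasing) auto
  have sum1: "1 \<le> (\<Sum>i\<le>W. x ^ i)" if "0 \<le> x" for x :: real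
  proof -
    have "(\<Sum>i\<in>{0}. x ^ i) \<le> (\<Sum>i\<le>W. x ^ i)" using that by (intro sum_mono2) auto
    thus ?thesis by simp
  qed
  have sum0: "0 \<le> (\<Sum>i\<le>W. x ^ i)" if "0 \<le> x" for x :: real
    using sum1[OF that] by simp
  have box1: "1 \<le> box"
  proof -
    have "1 * 1 * 1 \<le> box" unfolding box_def using C sum1 sum0 by (intro mult_mono) auto
    thus ?thesis by simp
  qed
  have "real Z \<le> real S * ((1 + C) * (1 + D) * (1 + E))"
  proof -
    have "real Z \<le> real S * (1 + C + D + E)" using Z C
      by (simp add: S_def algebra_simps add_nonneg_nonneg) (smt (verit) mult_nonneg_nonneg of_nat_0_le_iff)
    also have "1 + C + D + E \<le> (1 + C) * (1 + D) * (1 + E)"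
      using C by (simp add: algebra_simps)
    finally show ?thesis by (simp add: mult_left_mono)
  qed
  hence "real Z ^ N \<le> (real S * ((1 + C) * (1 + D) * (1 + E))) ^ N" by (rule power_mono) simp
  also have "\<dots> = real S ^ N * ((1 + C) ^ N * (1 + D) ^ N * (1 + E) ^ N)"
    by (simp only: power_mult_distrib)
  also have "\<dots> \<le> real S ^ N * ((2 ^ N * (\<Sum>i\<le>W. C ^ i)) * (2 ^ N * (\<Sum>j\<le>W. D ^ j)) * (2 ^ N * (\<Sum>k\<le>W. E ^ k)))"
    using C sum0 by (intro mult_left_mono mult_mono one_plus_power_le NW) (auto intro!: mult_nonneg_nonneg)
  also have "\<dots> = real S ^ N * (2 ^ N * 2 ^ N * 2 ^ N) * box" by (simp add: box_def mult_ac)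
  also have "\<dots> \<le> real S ^ N * (real S ^ N * real S ^ N * real S ^ N) * box"
    using S box1 by (intro mult_right_mono mult_left_mono mult_mono power_mono) auto
  also have "\<dots> = real S ^ (4 * N) * box"
    by (simp add: mult.commute[of 4] power_mult power4_eq_xxxx mult_ac)
  finally have ZN: "real Z ^ N \<le> real S ^ (4 * N) * box" .
  have "real Z ^ (8 * size_exponent m q) \<le> real Z ^ N"
    unfolding N_def S_def using Z(1) by (intro power_increasing size_exponent_le mq) auto
  moreover have "real (nat \<lceil>8 / \<kappa>\<rceil>) \<le> 8 / \<kappa> + 1" using \<kappa> by (simp add: of_nat_nat ceiling_correct)
  ultimately have K_le: "real K \<le> real S ^ (4 * N) * box + (8 / \<kappa> + 1)"
    unfolding K of_nat_add of_nat_power using ZN by linarith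
  have S2: "real S \<le> real S ^ 2" "real S ^ 2 \<le> real S ^ (4 * N + 1)"
  proof -
    have N1: "1 \<le> N" unfolding N_def using S by (intro one_le_power) auto
    show "real S \<le> real S ^ 2" using power_increasing[of 1 2 "real S"] S by simp
    show "real S ^ 2 \<le> real S ^ (4 * N + 1)" using S N1 by (intro power_increasing) auto
  qed
  have SW: "2 * real S ^ (4 * N + 1) \<le> real W"
  proof -
    have "2 * S ^ (4 * N + 1) \<le> S * S ^ (4 * N + 1)" using S by (intro mult_right_mono) auto
    also have "\<dots> = S ^ (4 * N + 2)" by simp
    also have "\<dots> \<le> S ^ (S ^ 8)"
    proof (rule power_increasing)
      have "1 \<le> N" unfolding N_def using S by (intro one_le_power) auto
      hence "4 * N + 2 \<le> 64 * N" by simp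
      also have "\<dots> \<le> S * N" using S by (rule mult_right_mono) simp
      also have "\<dots> = S ^ 8" by (simp add: N_def eval_nat_numeral)
      finally show "4 * N + 2 \<le> S ^ 8" .
    qed (use S in simp)
    finally have "real (2 * S ^ (4 * N + 1)) \<le> real W" unfolding W' of_nat_le_iff .
    thus ?thesis by simp
  qed
  have "real (K * (4 * m + 1)) \<le> (real S ^ (4 * N) * box + (8 / \<kappa> + 1)) * real S"
    unfolding of_nat_mult using K_le mq C box1 \<kappa>
    by (intro mult_mono) (auto simp: S_def intro!: add_nonneg_nonneg mult_nonneg_nonneg)
  also have "\<dots> = real S ^ (4 * N + 1) * box + (real S + 8 * real S / \<kappa>)"
    by (simp add: field_simps)
  also have "\<dots> \<le> real S ^ (4 * N + 1) * box + (real S ^ 2 + real S ^ 2 / \<kappa>) * box"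
  proof (intro add_left_mono)
    have "8 * real S \<le> real S ^ 2" using S by (simp add: power2_eq_square)
    hence "real S + 8 * real S / \<kappa> \<le> (real S ^ 2 + real S ^ 2 / \<kappa>) * 1"
      using S2 \<kappa> by (auto intro!: add_mono divide_right_mono)
    also have "\<dots> \<le> (real S ^ 2 + real S ^ 2 / \<kappa>) * box"
      using box1 \<kappa> by (intro mult_left_mono) auto
    finally show "real S + 8 * real S / \<kappa> \<le> (real S ^ 2 + real S ^ 2 / \<kappa>) * box" .
  qed
  also have "\<dots> = (real S ^ (4 * N + 1) + real S ^ 2 + real S ^ 2 / \<kappa>) * box"
    by (simp only: distrib_right add.assoc)
  also have "\<dots> \<le> (real W + real W / \<kappa>) * box"
  proof -
    have "real S ^ (4 * N + 1) + real S ^ 2 \<le> real W" "real S ^ 2 \<le> real W"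
      using S2 SW zero_le_power[of "real S" 2] by linarith+
    thus ?thesis using box1 \<kappa> by (intro mult_right_mono add_mono divide_right_mono) auto
  qed
  also have "\<dots> = eval3 (box_poly W (real W + real W / \<kappa>)) C D E"
    by (simp add: eval3_box_poly box_def mult_ac)
  finally show ?thesis .
qed

section \<open>From rational functions to power series\<close>

lemma ratfun_fls_mult: "ratfun_fls (a * b) = ratfun_fls a * ratfun_fls b"
proof -
  obtain p q r s where "a = Fract p q" "q \<noteq> 0" "b = Fract r s" "s \<noteq> 0"
    by (metis Fract_cases)
  thus ?thesis by (simp add: ratfun_fls_Fract fps_of_poly_mult fls_times_fps_to_fls)
qed

lemma ratfun_fls_int_ratfun: "ratfun_fls (int_ratfun S) = fps_to_fls (rat_fps S)"
  by (simp add: int_ratfun_def to_fract_def ratfun_fls_Fract)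

text \<open>The description of \<open>numer_entry\<close> denotes: integer polynomials embed into the rational functions.\<close>

lemma int_ratfun_numer_entry:
  assumes "is_common_denominator m A T" "i < m" "j < m"
  shows "int_ratfun (numer_entry T A i j) = int_ratfun T * A i j"
proof -
  obtain S where S: "int_ratfun S = int_ratfun T * A i j"
    using assms unfolding is_common_denominator_def by (metis rangeE)
  have "numer_entry T A i j = S"
    unfolding numer_entry_def by (rule the_equality[of _ S]) (use S inj_int_ratfun in \<open>auto simp: inj_def\<close>)
  with S show ?thesis by simp
qed

text \<open>The system, multiplied by \<open>T\<close>, has polynomial coefficients and is an identity of formal power series.\<close>

lemma solves_system_cleared:
  assumes A: "is_common_denominator m A T" and f: "solves_system m A f" and i: "i < m"
  shows "rat_fps T * fps_deriv (f i) = (\<Sum>j<m. rat_fps (numer_entry T A i j) * f j)"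
proof -
  have sum: "fps_to_fls (\<Sum>j\<in>J. F j) = (\<Sum>j\<in>J. fps_to_fls (F j))" for J :: "nat set" and F :: "nat \<Rightarrow> rat fps"
    by (induction J rule: infinite_finite_induct) auto
  have "fps_to_fls (rat_fps T * fps_deriv (f i)) =
      ratfun_fls (int_ratfun T) * (\<Sum>j<m. ratfun_fls (A i j) * fps_to_fls (f j))"
    using f i by (simp add: solves_system_def fls_times_fps_to_fls ratfun_fls_int_ratfun)
  also have "\<dots> = (\<Sum>j<m. ratfun_fls (int_ratfun (numer_entry T A i j)) * fps_to_fls (f j))"
    unfolding sum_distrib_left
    using i by (intro sum.cong refl) (simp add: int_ratfun_numer_entry[OF A] ratfun_fls_mult mult.assoc)
  also have "\<dots> = fps_to_fls (\<Sum>j<m. rat_fps (numer_entry T A i j) * f j)"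
    by (simp add: sum fls_times_fps_to_fls ratfun_fls_int_ratfun)
  finally show ?thesis by simp
qed

lemma common_denom_spec:
  assumes "strict_E_function F"
  shows "0 < common_denom F k" "l \<le> k \<Longrightarrow> of_nat (common_denom F k) * egf_coeff F l \<in> \<int>"
proof -
  have "\<exists>d. 0 < d \<and> (\<forall>l\<le>k. of_nat d * egf_coeff F l \<in> \<int>)"
    using assms unfolding strict_E_function_def by blast
  from LeastI_ex[OF this] show "0 < common_denom F k"
    "l \<le> k \<Longrightarrow> of_nat (common_denom F k) * egf_coeff F l \<in> \<int>"
    unfolding common_denom_def by blast+
qed

lemma abs_coeff_le_system_height:
  shows "\<bar>coeff T l\<bar> \<le> system_height m T A \<or> T = 0"
    and "i < m \<Longrightarrow> j < m \<Longrightarrow> T \<noteq> 0 \<Longrightarrow> \<bar>coeff (numer_entry T A i j) l\<bar> \<le> system_height m T A"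
proof -
  define X where "X = abs ` (set (coeffs T) \<union> (\<Union>i<m. \<Union>j<m. set (coeffs (numer_entry T A i j))))"
  have X: "finite X" "system_height m T A = Max X" by (auto simp: X_def system_height_def)
  have mem: "\<bar>c\<bar> \<le> system_height m T A" if "\<bar>c\<bar> \<in> X" for c
    unfolding X(2) using that X(1) by (rule Max_ge[rotated])
  have nonneg: "0 \<le> system_height m T A" if "T \<noteq> 0"
  proof -
    have "\<bar>lead_coeff T\<bar> \<in> X" using that unfolding X_def by (intro imageI UnI1 coeff_in_coeffs) auto
    from mem[OF this] show ?thesis by linarith
  qed
  have range: "coeff p l = 0 \<or> coeff p l \<in> set (coeffs p)" for p :: "int poly"
  proof -
    have "coeff p l \<in> range (coeff p)" by simp
    thus ?thesis unfolding range_coeff by simp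
  qed
  show "\<bar>coeff T l\<bar> \<le> system_height m T A \<or> T = 0"
    using range[of T] mem[of "coeff T l"] nonneg by (auto simp: X_def)
  assume "i < m" "j < m" "T \<noteq> 0"
  thus "\<bar>coeff (numer_entry T A i j) l\<bar> \<le> system_height m T A"
    using range[of "numer_entry T A i j"] mem[of "coeff (numer_entry T A i j) l"] nonneg by (auto simp: X_def)
qed

lemma degree_le_system_degree:
  shows "degree T \<le> system_degree m T A"
    and "i < m \<Longrightarrow> j < m \<Longrightarrow> degree (numer_entry T A i j) \<le> system_degree m T A"
  unfolding system_degree_def by (auto intro!: Max_ge)

lemma abs_le_int_encode: "\<bar>x\<bar> \<le> int (int_encode x)"
  by (simp add: int_encode_def sum_encode_def)

section \<open>The lower bound for linear forms in values of strict E-functions\<close>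

theorem proposition3:
  shows "\<exists>\<Phi> :: nat \<Rightarrow> nat \<Rightarrow> nat \<Rightarrow> rat \<Rightarrow> int poly \<Rightarrow> real \<Rightarrow> real poly poly poly.
    effectively_computable \<Phi> \<and>
    (\<forall>(m :: nat) (p :: nat) (q :: nat) (\<xi> :: rat) (T :: int poly) (\<kappa> :: real).
      1 \<le> m \<and> T \<noteq> 0 \<and> \<xi> * poly (map_poly of_int T) \<xi> \<noteq> 0 \<and> 0 < \<kappa> \<longrightarrow>
      (\<forall>i j k. 0 \<le> coeff3 (\<Phi> m p q \<xi> T \<kappa>) i j k) \<and>
      (\<forall>(f :: nat \<Rightarrow> rat fps) (A :: nat \<Rightarrow> nat \<Rightarrow> rat poly fract)
         (C :: real) (D :: real) (n0 :: nat).
        (\<forall>j<m. strict_E_function (f j)) \<and>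
        lin_indep_over_Qz m f \<and>
        solves_system m A f \<and>
        is_min_common_denominator m A T \<and>
        p = Min ((\<lambda>j. subdegree (f j)) ` {..<m}) \<and>
        q = system_degree m T A \<and>
        \<kappa> \<le> Max ((\<lambda>j. \<bar>E_value (f j) \<xi>\<bar>) ` {..<m}) \<and>
        0 < C \<and> (\<forall>i<m. \<forall>k. \<bar>real_of_rat (egf_coeff (f i) k)\<bar> \<le> C ^ (k + 1)) \<and>
        0 < D \<and> (\<forall>i<m. \<forall>k. real (common_denom (f i) k) \<le> D ^ (k + 1)) \<and>
        zero_estimate_constant m p q T A f n0 \<longrightarrow>
        (\<forall>(H :: int) (a :: nat \<Rightarrow> int).
          max 3 (int (n0 ^ n0)) \<le> H \<and> (\<exists>j<m. a j \<noteq> 0) \<and> (\<forall>j<m. \<bar>a j\<bar> \<le> H) \<longrightarrow>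
          \<bar>\<Sum>j<m. of_int (a j) * E_value (f j) \<xi>\<bar> >
            1 / real_of_int H powr eval3 (\<Phi> m p q \<xi> T \<kappa>) C D (of_int (system_height m T A)))))"
proof (rule exI[of _ exponent_poly], intro conjI effectively_computable_exponent_poly allI impI; (elim conjE)?)
  fix m p q :: nat and \<xi> :: rat and T :: "int poly" and \<kappa> :: real and i j k :: nat
  assume "0 < \<kappa>"
  thus "0 \<le> coeff3 (exponent_poly m p q \<xi> T \<kappa>) i j k"
    by (simp add: exponent_poly_def Let_def coeff3_box_poly)
next
  fix m p q :: nat and \<xi> :: rat and T :: "int poly" and \<kappa> :: real
    and f :: "nat \<Rightarrow> rat fps" and A :: "nat \<Rightarrow> nat \<Rightarrow> rat poly fract" and C D :: real and n0 :: nat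
    and H :: int and a :: "nat \<Rightarrow> int"
  assume m: "1 \<le> m" and T: "T \<noteq> 0" and nz: "\<xi> * poly (map_poly of_int T) \<xi> \<noteq> 0" and \<kappa>: "0 < \<kappa>"
    and f: "\<forall>j<m. strict_E_function (f j)" and sys: "solves_system m A f"
    and min: "is_min_common_denominator m A T" and q: "q = system_degree m T A"
    and max: "\<kappa> \<le> Max ((\<lambda>j. \<bar>E_value (f j) \<xi>\<bar>) ` {..<m})"
    and C: "0 < C" "\<forall>i<m. \<forall>k. \<bar>real_of_rat (egf_coeff (f i) k)\<bar> \<le> C ^ (k + 1)"
    and D: "0 < D" "\<forall>i<m. \<forall>k. real (common_denom (f i) k) \<le> D ^ (k + 1)"
    and n0: "zero_estimate_constant m p q T A f n0"
    and H: "max 3 (int (n0 ^ n0)) \<le> H" and a: "\<exists>j<m. a j \<noteq> 0" "\<forall>j<m. \<bar>a j\<bar> \<le> H"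
  define E where "E = system_height m T A"
  define s where "s = data_size m p q \<xi>"
  \<comment> \<open>An integer bound for all the data, affine in \<open>C, D, E\<close> up to rounding.\<close>
  define Z where "Z = s + 3 + nat \<lceil>C\<rceil> + nat \<lceil>D\<rceil> + nat E"
  define K where "K = Z ^ (8 * size_exponent m q) + nat \<lceil>8 / \<kappa>\<rceil>"
  obtain u v where uv: "quotient_of \<xi> = (u, v)" by force
  have v: "0 < v" using quotient_of_denom_pos[OF uv] .
  have E: "\<And>l. \<bar>coeff T l\<bar> \<le> E" "\<And>i j l. i < m \<Longrightarrow> j < m \<Longrightarrow> \<bar>coeff (numer_entry T A i j) l\<bar> \<le> E"
    using abs_coeff_le_system_height(1)[where T = T and m = m and A = A]
      abs_coeff_le_system_height(2)[where T = T and m = m and A = A] T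
    by (auto simp: E_def)
  have E0: "0 \<le> E" using order_trans[OF abs_ge_zero E(1)] .
  have s: "s = m + p + q + int_encode u + nat v" by (simp add: s_def data_size_def uv)
  have Z_ge: "s + 3 \<le> Z" "C \<le> real Z" "D \<le> real Z" "E \<le> int Z"
    using C D E0 by (auto simp: Z_def) linarith+
  have den: "is_common_denominator m A T" using min by (simp add: is_min_common_denominator_def)
  interpret bounded_E_system m q Z T A f
  proof
    show "3 \<le> Z" "m \<le> Z" "q + 1 \<le> Z" using Z_ge(1) s by auto
    show "\<bar>coeff T l\<bar> \<le> int Z" for l using E(1)[of l] Z_ge(4) by linarith
    fix i assume i: "i < m"
    show "rat_fps T * fps_deriv (f i) = (\<Sum>j<m. rat_fps (numer_entry T A i j) * f j)"
      by (rule solves_system_cleared[OF den sys i])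
    show "\<bar>egf_coeff (f i) l\<bar> \<le> of_nat Z ^ (l + 1)" for l
    proof -
      have "\<bar>real_of_rat (egf_coeff (f i) l)\<bar> \<le> C ^ (l + 1)" using C(2) i by blast
      also have "\<dots> \<le> real Z ^ (l + 1)" using C(1) Z_ge(2) by (intro power_mono) auto
      finally have "real_of_rat \<bar>egf_coeff (f i) l\<bar> \<le> of_rat (of_nat Z ^ (l + 1))"
        by (simp only: abs_of_rat of_rat_power of_rat_of_nat_eq)
      thus ?thesis by (simp only: of_rat_less_eq)
    qed
    fix l
    have "real (common_denom (f i) l) \<le> D ^ (l + 1)" using D(2) i by blast
    also have "\<dots> \<le> real Z ^ (l + 1)" using D(1) Z_ge(3) by (intro power_mono) auto
    finally have "common_denom (f i) l \<le> Z ^ (l + 1)" by (simp only: of_nat_le_iff flip: of_nat_power)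
    thus "\<exists>d. 0 < d \<and> d \<le> Z ^ (l + 1) \<and> (\<forall>k\<le>l. of_nat d * egf_coeff (f i) k \<in> \<int>)"
      using common_denom_spec f i by blast
  next
    fix i j assume ij: "i < m" "j < m"
    show "degree (numer_entry T A i j) \<le> q" unfolding q by (rule degree_le_system_degree(2)[OF ij])
    show "\<bar>coeff (numer_entry T A i j) l\<bar> \<le> int Z" for l using E(2)[OF ij, of l] Z_ge(4) by linarith
  qed (use m in \<open>auto simp: q intro: degree_le_system_degree\<close>)
  have lower: "1 / real (nat H) ^ (K * (4 * m + 1)) < \<bar>\<Sum>i<m. of_int (a i) * E_value (f i) \<xi>\<bar>"
  proof (rule linear_form_lower_bound[where u = u and v = v and K = K, OF _ n0 _ _ _ _ nz \<kappa>])
    show "p \<le> Z" using Z_ge(1) s by simp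
    show "\<xi> = of_int u / of_int v" by (rule quotient_of_div[OF uv])
    show "v \<noteq> 0" using v by simp
    show "\<bar>u\<bar> \<le> int Z" using abs_le_int_encode[of u] Z_ge(1) s by linarith
    show "\<bar>v\<bar> \<le> int Z" using v Z_ge(1) s by linarith
    have "Max ((\<lambda>j. \<bar>E_value (f j) \<xi>\<bar>) ` {..<m}) \<in> (\<lambda>j. \<bar>E_value (f j) \<xi>\<bar>) ` {..<m}"
      using m by (intro Max_in) (auto simp: lessThan_empty_iff)
    thus "\<exists>j<m. \<kappa> \<le> \<bar>E_value (f j) \<xi>\<bar>" using max by auto
    show "Z ^ (8 * size_exponent m q) \<le> K" by (simp add: K_def)
    have "8 / \<kappa> \<le> real (nat \<lceil>8 / \<kappa>\<rceil>)" by (rule real_nat_ceiling_ge)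
    thus "8 / \<kappa> \<le> real K" by (simp add: K_def add_increasing)
    show "3 \<le> nat H" using H by linarith
    show "n0 ^ n0 \<le> nat H" using H by linarith
    show "\<exists>i<m. a i \<noteq> 0" by (rule a(1))
    show "\<bar>a i\<bar> \<le> int (nat H)" if "i < m" for i using a(2) that H by (metis dual_order.trans int_nat_eq max.boundedE zle_iff_zadd zero_le_numeral)
  qed
  have "real (K * (4 * m + 1)) \<le> eval3 (exponent_poly m p q \<xi> T \<kappa>) C D (of_int E)"
    unfolding exponent_poly_def Let_def s_def[symmetric]
  proof (rule exponent_le_eval3)
    have "real (nat \<lceil>C\<rceil>) \<le> C + 1" "real (nat \<lceil>D\<rceil>) \<le> D + 1" "real (nat E) = of_int E"
      using C(1) D(1) E0 by (auto simp: of_nat_nat)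
    thus "real Z \<le> real s + 5 + C + D + of_int E" by (simp add: Z_def)
  qed (use C D E0 \<kappa> Z_ge s in \<open>auto simp: K_def\<close>)
  hence powr_le: "real_of_int H powr real (K * (4 * m + 1)) \<le>
      real_of_int H powr eval3 (exponent_poly m p q \<xi> T \<kappa>) C D (of_int E)"
    using H by (intro powr_mono) auto
  have power_eq: "real (nat H) ^ (K * (4 * m + 1)) = real_of_int H powr real (K * (4 * m + 1))"
    using H by (subst powr_realpow) auto
  have "1 / real_of_int H powr eval3 (exponent_poly m p q \<xi> T \<kappa>) C D (of_int E) \<le>
      1 / real_of_int H powr real (K * (4 * m + 1))"
    using powr_le H by (intro divide_left_mono) auto
  from this lower[unfolded power_eq]
  show "1 / real_of_int H powr eval3 (exponent_poly m p q \<xi> T \<kappa>) C D (of_int (system_height m T A))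
      < \<bar>\<Sum>j<m. of_int (a j) * E_value (f j) \<xi>\<bar>"
    unfolding E_def by (rule le_less_trans)
qed

end
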